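(* Let $\Omega\subset\mathbb{C}^2$ be a smoothly bounded domain of finite type, with defining function $\rho$, such that $|z|\le 1$ for all $z\in\Omega$, $(1,0)\in\partial\Omega$, $\frac{\partial\rho}{\partial z_1}$ and $\frac{\partial\rho}{\partial\overline z_1}$ do not vanish at $(1,0)$, and the vector $\langle 1,0\rangle$ is an outward normal vector to $\partial\Omega$ at $(1,0)$. Let $h_1,h_2:(0,1]\to[1,+\infty)$ be continuous decreasing functions with $\lim_{x\to0+}h_i(x)=+\infty$ for $i=1,2$, and let $\mathscr{A}_{h_1,h_2}(\zeta)$ be the approach region at $\zeta$ defined in the context. Then Fatou's theorem fails for the regions $\mathscr{A}_{h_1,h_2}$: it is not true that for every bounded holomorphic function $f$ on $\Omega$ the limit $$\lim_{\mathscr{A}_{h_1,h_2}(\zeta)\ni z\to\zeta}f(z)$$ exists for almost every (with respect to surface measure) $\zeta\in\partial\Omega\cap V$, where $V$ is the neighborhood of $(1,0)$ fixed in the context.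
   Context: Vector fields and type. In a small neighborhood $V$ of $(1,0)$ in $\mathbb{C}^2$ on which $\frac{\partial\rho}{\partial z_1}\neq0$ and $\frac{\partial\rho}{\partial\overline z_1}\ne 0$, put $$L=-\frac{\partial \rho}{\partial z_2}\frac{\partial}{\partial z_1}+\frac{\partial \rho}{\partial z_1}\frac{\partial}{\partial z_2},\quad \overline{L}=-\frac{\partial \rho}{\partial \overline{z}_2}\frac{\partial}{\partial \overline{z}_1}+\frac{\partial \rho}{\partial \overline{z}_1}\frac{\partial}{\partial \overline{z}_2},\quad T=\frac{\partial \rho}{\partial \overline{z}_1}\frac{\partial}{\partial z_1}-\frac{\partial \rho}{\partial z_1}\frac{\partial}{\partial \overline{z}_1};$$ these span the (complexified) tangent space to $\partial\Omega$ at every boundary point in $V$. The fields $L,\overline L$ are iterated commutators of degree $1$; if $\mathscr{L}_{k-1}$ is an iterated commutator of degree $k-1$, then $[L,\mathscr{L}_{k-1}]$ and $[\overline L,\mathscr{L}_{k-1}]$ are iterated commutators of degree $k$. Each iterated commutator $\mathscr{L}$ satisfies $\mathscr{L}\equiv\lambda_{\mathscr{L}}T \bmod (L,\overline L)$ for a coefficient function $\lambda_{\mathscr{L}}$. Let $\mathscr{M}_k$ be the collection of all these linearly independent iterated commutators of degree less than or equal to $k$, and $$\Lambda_k(z)=\sqrt{\sum_{\mathscr{L}\in\mathscr{M}_k}|\lambda_{\mathscr{L}}(z)|^2}.$$ The type $\tau_z$ of a boundary point $z$ is the smallest $k$ with $\Lambda_k(z)\ne0$ (for boundary points outside $V$,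 defined in the same way after a choice of coordinates in which the $z_1$-derivatives of $\rho$ do not vanish). Finite type means that all boundary points have finite type, and $\tau=\max_{z\in\partial\Omega}\tau_z<\infty$. Distances. For $z\in\Omega$ near $\partial\Omega$, $\pi(z)$ is the Euclidean normal projection of $z$ on $\partial\Omega$, $\delta(z)=|z-\pi(z)|$ is the Euclidean distance from $z$ to $\partial\Omega$, and $\delta_n(z)$ is the distance from $z$ to $\pi(z)$ in the complex normal direction (the modulus of the component of $z-\pi(z)$ along the complex normal direction to $\partial\Omega$ at $\pi(z)$). Set $$D(z)=\inf_{2\le k\le\tau}\Big(\frac{\delta(z)}{\Lambda_k(\pi(z))}\Big)^{1/k},\qquad \Lambda^{\theta}(\zeta)=\sum_{k=2}^{\tau}\theta^k\Lambda_k(\zeta),$$ where terms with $\Lambda_k(\pi(z))=0$ in the infimum are read as $+\infty$. Polarization. $R(z,w)$ is a fixed polarization of $\rho$: a $C^\infty$ complex-valued function with $R(z,z)=\rho(z)$, with $\overline\partial_zR(z,w)$ vanishing to infinite order on $z=w$, and with $R(z,w)-\overline{R(w,z)}$ vanishing to infinite order on $z=w$. Approach region. For $w\in\partial\Omega\cap V$, $\mathscr{A}_{h_1,h_2}(w)$ is the set of $z\in\Omega\cap V$ (with $V$ small enough that the quantities above are defined) such that $$|z-w|<h_1(\delta_n(z))\,D(z)\quad\text{and}\quad |R(\pi(z),w)|<h_2(\delta_n(z))\,\Lambda^{D(z)}(w).$$ *)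

theory Defs
  imports "HOL-Analysis.Analysis" "HOL-Library.Landau_Symbols"
begin

type_synonym c2 = "complex^2"

text \<open>\<open>C\<^sup>k\<close> and smooth maps on an open set \<open>S\<close>, by iterated directional derivatives.\<close>

fun Ck_on :: "nat \<Rightarrow> 'a::real_normed_vector set \<Rightarrow> ('a \<Rightarrow> 'b::real_normed_vector) \<Rightarrow> bool" where
  "Ck_on 0 S f \<longleftrightarrow> continuous_on S f"
| "Ck_on (Suc k) S f \<longleftrightarrow>
     (\<forall>x\<in>S. f differentiable (at x)) \<and> (\<forall>v. Ck_on k S (\<lambda>x. frechet_derivative f (at x) v))"

definition smooth_on :: "'a::real_normed_vector set \<Rightarrow> ('a \<Rightarrow> 'b::real_normed_vector) \<Rightarrow> bool" where
  "smooth_on S f \<longleftrightarrow> (\<forall>k. Ck_on k S f)"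

definition holomorphic_c2 :: "(c2 \<Rightarrow> complex) \<Rightarrow> c2 set \<Rightarrow> bool" where
  "holomorphic_c2 f S \<longleftrightarrow>
     (\<forall>z\<in>S. \<exists>f'. (f has_derivative f') (at z) \<and> (\<forall>c v. f' (c *s v) = c * f' v))"

text \<open>The Wirtinger derivatives \<open>\<partial>f/\<partial>z\<^sub>j\<close> and \<open>\<partial>f/\<partial>\<zeta>\<^sub>j\<close>, where \<open>\<zeta>\<^sub>j\<close> is the conjugate of \<open>z\<^sub>j\<close>.\<close>

definition dz :: "2 \<Rightarrow> (c2 \<Rightarrow> complex) \<Rightarrow> c2 \<Rightarrow> complex" where
  "dz j f z = (frechet_derivative f (at z) (axis j 1)
               - \<i> * frechet_derivative f (at z) (axis j \<i>)) / 2"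

definition dzbar :: "2 \<Rightarrow> (c2 \<Rightarrow> complex) \<Rightarrow> c2 \<Rightarrow> complex" where
  "dzbar j f z = (frechet_derivative f (at z) (axis j 1)
                  + \<i> * frechet_derivative f (at z) (axis j \<i>)) / 2"

abbreviation rdz :: "2 \<Rightarrow> (c2 \<Rightarrow> real) \<Rightarrow> c2 \<Rightarrow> complex" where
  "rdz j \<rho> \<equiv> dz j (\<lambda>z. complex_of_real (\<rho> z))"

abbreviation rdzbar :: "2 \<Rightarrow> (c2 \<Rightarrow> real) \<Rightarrow> c2 \<Rightarrow> complex" where
  "rdzbar j \<rho> \<equiv> dzbar j (\<lambda>z. complex_of_real (\<rho> z))"

text \<open>
  \<open>\<rho>\<close> need only be defined on a neighbourhood \<open>U\<close> of the boundary.  Together with openness of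
  \<open>\<Omega>\<close> the conditions force \<open>\<rho> = 0\<close> on the boundary, and the boundary is a smooth hypersurface.
\<close>

definition defining_function :: "(c2 \<Rightarrow> real) \<Rightarrow> c2 set \<Rightarrow> c2 set \<Rightarrow> bool" where
  "defining_function \<rho> U \<Omega> \<longleftrightarrow>
     open U \<and> frontier \<Omega> \<subseteq> U \<and> smooth_on U \<rho> \<and> \<Omega> \<inter> U = {z\<in>U. \<rho> z < 0} \<and>
     (\<forall>z\<in>frontier \<Omega>. frechet_derivative \<rho> (at z) \<noteq> (\<lambda>v. 0))"

text \<open>\<open>n\<close> is a positive multiple of the gradient of \<open>\<rho>\<close> at \<open>p\<close>.\<close>

definition outward_normal :: "(c2 \<Rightarrow> real) \<Rightarrow> c2 \<Rightarrow> c2 \<Rightarrow> bool" where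
  "outward_normal \<rho> p n \<longleftrightarrow>
     n \<noteq> 0 \<and> (\<exists>c>0. frechet_derivative \<rho> (at p) = (\<lambda>v. c * (n \<bullet> v)))"

text \<open>
  A complexified vector field is given by its coefficients with respect to
  \<open>\<partial>/\<partial>z\<^sub>1, \<partial>/\<partial>z\<^sub>2, \<partial>/\<partial>\<zeta>\<^sub>1, \<partial>/\<partial>\<zeta>\<^sub>2\<close>, in this order.
\<close>

type_synonym cvf = "c2 \<Rightarrow> complex^4"

definition vf_apply :: "cvf \<Rightarrow> (c2 \<Rightarrow> complex) \<Rightarrow> c2 \<Rightarrow> complex" where
  "vf_apply X f z = X z $ 1 * dz 1 f z + X z $ 2 * dz 2 f z
                  + X z $ 3 * dzbar 1 f z + X z $ 4 * dzbar 2 f z"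

definition lie_bracket :: "cvf \<Rightarrow> cvf \<Rightarrow> cvf" where
  "lie_bracket X Y z =
     (\<chi> i. vf_apply X (\<lambda>w. Y w $ i) z - vf_apply Y (\<lambda>w. X w $ i) z)"

definition L_field :: "(c2 \<Rightarrow> real) \<Rightarrow> cvf" where
  "L_field \<rho> z = vector [- rdz 2 \<rho> z, rdz 1 \<rho> z, 0, 0]"

definition Lbar_field :: "(c2 \<Rightarrow> real) \<Rightarrow> cvf" where
  "Lbar_field \<rho> z = vector [0, 0, - rdzbar 2 \<rho> z, rdzbar 1 \<rho> z]"

definition T_field :: "(c2 \<Rightarrow> real) \<Rightarrow> cvf" where
  "T_field \<rho> z = vector [rdzbar 1 \<rho> z, 0, - rdz 1 \<rho> z, 0]"

inductive iterated_commutator :: "(c2 \<Rightarrow> real) \<Rightarrow> nat \<Rightarrow> cvf \<Rightarrow> bool" for \<rho> where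
  "iterated_commutator \<rho> 1 (L_field \<rho>)"
| "iterated_commutator \<rho> 1 (Lbar_field \<rho>)"
| "iterated_commutator \<rho> k X \<Longrightarrow> iterated_commutator \<rho> (Suc k) (lie_bracket (L_field \<rho>) X)"
| "iterated_commutator \<rho> k X \<Longrightarrow> iterated_commutator \<rho> (Suc k) (lie_bracket (Lbar_field \<rho>) X)"

text \<open>
  The coefficient of \<open>T\<close> modulo \<open>L\<close> and its conjugate.  It is unique where \<open>\<partial>\<rho>/\<partial>z\<^sub>1 \<noteq> 0\<close>, and it
  exists there for iterated commutators, because these annihilate \<open>\<rho>\<close>.
\<close>

definition T_coeff :: "(c2 \<Rightarrow> real) \<Rightarrow> cvf \<Rightarrow> c2 \<Rightarrow> complex" where
  "T_coeff \<rho> X z =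
     (THE l. \<exists>a b. X z = l *s T_field \<rho> z + a *s L_field \<rho> z + b *s Lbar_field \<rho> z)"

definition independent_fields :: "c2 set \<Rightarrow> cvf set \<Rightarrow> bool" where
  "independent_fields W B \<longleftrightarrow>
     (\<forall>c :: cvf \<Rightarrow> complex. (\<forall>z\<in>W. (\<Sum>X\<in>B. c X *s X z) = 0) \<longrightarrow> (\<forall>X\<in>B. c X = 0))"

text \<open>
  The iterated commutators of degree at most \<open>k\<close> satisfy linear relations (such as antisymmetry), so
  the collection \<open>\<M>\<^sub>k\<close> of the linearly independent ones is a choice of a maximal family that is
  linearly independent over the constants.  Different choices give comparable \<open>\<Lambda>\<^sub>k\<close>.
\<close>

definition commutator_basis :: "(c2 \<Rightarrow> real) \<Rightarrow> c2 set \<Rightarrow> nat \<Rightarrow> cvf set \<Rightarrow> bool" where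
  "commutator_basis \<rho> W k B \<longleftrightarrow>
     (\<forall>X\<in>B. \<exists>j\<le>k. iterated_commutator \<rho> j X) \<and> independent_fields W B \<and>
     (\<forall>X j. j \<le> k \<and> iterated_commutator \<rho> j X \<and> X \<notin> B \<longrightarrow> \<not> independent_fields W (insert X B))"

definition Lam :: "(c2 \<Rightarrow> real) \<Rightarrow> (nat \<Rightarrow> cvf set) \<Rightarrow> nat \<Rightarrow> c2 \<Rightarrow> real" where
  "Lam \<rho> M k z = sqrt (\<Sum>X\<in>M k. (cmod (T_coeff \<rho> X z))\<^sup>2)"

text \<open>
  The type at a point with \<open>\<partial>\<rho>/\<partial>z\<^sub>1 \<noteq> 0\<close>.  Whether \<open>\<Lambda>\<^sub>k(p)\<close> vanishes depends neither on the
  neighbourhood \<open>W\<close> nor on the choice of the families.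
\<close>

definition chart_type :: "(c2 \<Rightarrow> real) \<Rightarrow> c2 \<Rightarrow> enat" where
  "chart_type \<rho> p = Inf {enat k | k. \<exists>W M.
      open W \<and> p \<in> W \<and> (\<forall>z\<in>W. rdz 1 \<rho> z \<noteq> 0 \<and> rdzbar 1 \<rho> z \<noteq> 0) \<and>
      (\<forall>j. commutator_basis \<rho> W j (M j)) \<and> Lam \<rho> M k p \<noteq> 0}"

definition swap_coords :: "c2 \<Rightarrow> c2" where
  "swap_coords z = vector [z $ 2, z $ 1]"

text \<open>
  If \<open>\<partial>\<rho>/\<partial>z\<^sub>1\<close> vanishes at a boundary point then \<open>\<partial>\<rho>/\<partial>z\<^sub>2\<close> does not, and exchanging the coordinates
  is an admissible choice of coordinates.
\<close>

definition point_type :: "(c2 \<Rightarrow> real) \<Rightarrow> c2 \<Rightarrow> enat" where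
  "point_type \<rho> p =
     (if rdz 1 \<rho> p \<noteq> 0 then chart_type \<rho> p
      else chart_type (\<lambda>z. \<rho> (swap_coords z)) (swap_coords p))"

definition domain_type :: "(c2 \<Rightarrow> real) \<Rightarrow> c2 set \<Rightarrow> enat" where
  "domain_type \<rho> \<Omega> = (SUP z\<in>frontier \<Omega>. point_type \<rho> z)"

definition finite_type :: "(c2 \<Rightarrow> real) \<Rightarrow> c2 set \<Rightarrow> bool" where
  "finite_type \<rho> \<Omega> \<longleftrightarrow> domain_type \<rho> \<Omega> < \<infinity>"

abbreviation bproj :: "c2 set \<Rightarrow> c2 \<Rightarrow> c2" where
  "bproj \<Omega> z \<equiv> closest_point (frontier \<Omega>) z"

definition bdist :: "c2 set \<Rightarrow> c2 \<Rightarrow> real" where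
  "bdist \<Omega> z = norm (z - bproj \<Omega> z)"

text \<open>
  The complex normal direction at \<open>p\<close> is spanned by \<open>\<nu> = (\<partial>\<rho>/\<partial>\<zeta>\<^sub>1, \<partial>\<rho>/\<partial>\<zeta>\<^sub>2)\<close> (half the gradient of
  \<open>\<rho>\<close>); the component of \<open>v\<close> along it is the Hermitian product of \<open>v\<close> with \<open>\<nu>/|\<nu>|\<close>.
\<close>

definition complex_normal :: "(c2 \<Rightarrow> real) \<Rightarrow> c2 \<Rightarrow> c2" where
  "complex_normal \<rho> p = (\<chi> j. rdzbar j \<rho> p)"

definition normal_dist :: "(c2 \<Rightarrow> real) \<Rightarrow> c2 set \<Rightarrow> c2 \<Rightarrow> real" where
  "normal_dist \<rho> \<Omega> z =
     (let p = bproj \<Omega> z; \<nu> = complex_normal \<rho> p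
      in cmod (\<Sum>j\<in>UNIV. (z - p) $ j * cnj (\<nu> $ j)) / norm \<nu>)"

text \<open>
  Indices with \<open>\<Lambda>\<^sub>k(\<pi>(z)) = 0\<close> contribute \<open>+\<infinity>\<close> to the infimum and are therefore left out; the
  remaining index set is nonempty when \<open>\<pi>(z)\<close> has type at most \<open>\<tau>\<close>.
\<close>

definition D_fun :: "(c2 \<Rightarrow> real) \<Rightarrow> c2 set \<Rightarrow> (nat \<Rightarrow> cvf set) \<Rightarrow> nat \<Rightarrow> c2 \<Rightarrow> real" where
  "D_fun \<rho> \<Omega> M \<tau> z =
     (INF k\<in>{k\<in>{2..\<tau>}. Lam \<rho> M k (bproj \<Omega> z) \<noteq> 0}.
        (bdist \<Omega> z / Lam \<rho> M k (bproj \<Omega> z)) powr (1 / real k))"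

definition Lam_sum :: "(c2 \<Rightarrow> real) \<Rightarrow> (nat \<Rightarrow> cvf set) \<Rightarrow> nat \<Rightarrow> real \<Rightarrow> c2 \<Rightarrow> real" where
  "Lam_sum \<rho> M \<tau> \<theta> \<zeta> = (\<Sum>k=2..\<tau>. \<theta> ^ k * Lam \<rho> M k \<zeta>)"

definition flat_on_diagonal :: "c2 set \<Rightarrow> (c2 \<Rightarrow> c2 \<Rightarrow> complex) \<Rightarrow> bool" where
  "flat_on_diagonal U g \<longleftrightarrow>
     (\<forall>p\<in>U. \<forall>N. (\<lambda>(z, w). cmod (g z w)) \<in> O[nhds (p, p)](\<lambda>(z, w). norm (z - w) ^ N))"

definition polarization :: "(c2 \<Rightarrow> real) \<Rightarrow> c2 set \<Rightarrow> (c2 \<Rightarrow> c2 \<Rightarrow> complex) \<Rightarrow> bool" where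
  "polarization \<rho> U R \<longleftrightarrow>
     smooth_on (U \<times> U) (\<lambda>(z, w). R z w) \<and>
     (\<forall>z\<in>U. R z z = complex_of_real (\<rho> z)) \<and>
     (\<forall>j. flat_on_diagonal U (\<lambda>z w. dzbar j (\<lambda>\<xi>. R \<xi> w) z)) \<and>
     flat_on_diagonal U (\<lambda>z w. R z w - cnj (R w z))"

text \<open>
  \<open>V\<close> is small enough that \<open>L\<close>, its conjugate and \<open>T\<close> span the tangent space on \<open>V\<close>, that the
  projection \<open>\<pi>\<close> is well defined on \<open>\<Omega> \<inter> V\<close>, and that the \<open>\<Lambda>\<^sub>k\<close>, which live on \<open>V\<close>, can be
  evaluated at \<open>\<pi>(z)\<close>.
\<close>

definition admissible_nhd :: "(c2 \<Rightarrow> real) \<Rightarrow> c2 set \<Rightarrow> c2 set \<Rightarrow> c2 \<Rightarrow> c2 set \<Rightarrow> bool" where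
  "admissible_nhd \<rho> U \<Omega> p V \<longleftrightarrow>
     open V \<and> p \<in> V \<and> V \<subseteq> U \<and>
     (\<forall>z\<in>V. rdz 1 \<rho> z \<noteq> 0 \<and> rdzbar 1 \<rho> z \<noteq> 0) \<and>
     (\<forall>z\<in>\<Omega> \<inter> V. \<exists>!q. q \<in> frontier \<Omega> \<and> (\<forall>q'\<in>frontier \<Omega>. dist z q \<le> dist z q')) \<and>
     (\<forall>z\<in>\<Omega> \<inter> V. bproj \<Omega> z \<in> V)"

definition approach_region ::
  "(c2 \<Rightarrow> real) \<Rightarrow> c2 set \<Rightarrow> c2 set \<Rightarrow> (nat \<Rightarrow> cvf set) \<Rightarrow> (c2 \<Rightarrow> c2 \<Rightarrow> complex) \<Rightarrow>
   (real \<Rightarrow> real) \<Rightarrow> (real \<Rightarrow> real) \<Rightarrow> c2 \<Rightarrow> c2 set" where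
  "approach_region \<rho> \<Omega> V M R h1 h2 w =
     (let \<tau> = the_enat (domain_type \<rho> \<Omega>) in
      {z \<in> \<Omega> \<inter> V.
         norm (z - w) < h1 (normal_dist \<rho> \<Omega> z) * D_fun \<rho> \<Omega> M \<tau> z \<and>
         cmod (R (bproj \<Omega> z) w)
           < h2 (normal_dist \<rho> \<Omega> z) * Lam_sum \<rho> M \<tau> (D_fun \<rho> \<Omega> M \<tau> z) w})"

text \<open>
  \<open>d\<close>-dimensional Hausdorff (outer) measure, normalised to agree with \<open>d\<close>-dimensional volume.
  Boundedness is required explicitly because \<^const>\<open>diameter\<close> is unspecified on unbounded sets.
\<close>

definition hausdorff_measure :: "nat \<Rightarrow> 'a::metric_space set \<Rightarrow> ennreal" where
  "hausdorff_measure d A =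
     (SUP e\<in>{0<..}. INF C\<in>{C :: nat \<Rightarrow> 'a set. A \<subseteq> (\<Union>i. C i) \<and> (\<forall>i. bounded (C i) \<and> diameter (C i) \<le> e)}.
        \<Sum>i. ennreal (unit_ball_vol (real d) * (diameter (C i) / 2) ^ d))"

definition surface_measure :: "c2 set \<Rightarrow> c2 set \<Rightarrow> ennreal" where
  "surface_measure \<Omega> A = hausdorff_measure 3 (A \<inter> frontier \<Omega>)"

definition decreasing_aperture :: "(real \<Rightarrow> real) \<Rightarrow> bool" where
  "decreasing_aperture h \<longleftrightarrow>
     continuous_on {0<..1} h \<and> (\<forall>x\<in>{0<..1}. 1 \<le> h x) \<and> antimono_on {0<..1} h \<and>
     filterlim h at_top (at_right 0)"

end

theory Submission
  imports Defs "HOL-Complex_Analysis.Cauchy_Integral_Formula"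
begin

text \<open>
  Since \<open>\<Omega>\<close> lies in the unit ball and touches the sphere at \<open>p = (1,0)\<close>, it is strongly convex near \<open>p\<close>:
  with \<open>g\<close> the gradient of \<open>\<rho>\<close>, the linear function \<open>P \<zeta> z = \<langle>\<zeta> - z, g \<zeta>\<rangle>\<close> satisfies \<open>Re (P \<zeta> z) \<ge> const |\<zeta> - z|\<^sup>2\<close>
  on \<open>\<Omega>\<close>.  Hence \<open>p\<close> and its neighbours have type 2, \<open>D(z) \<approx> \<surd>\<delta>\<close> and \<open>|R(\<zeta>,w)| \<lesssim> |P \<zeta> w|\<close>, so the approach
  region at \<open>w\<close> contains the point at height \<open>\<delta>\<close> over each boundary point \<open>\<zeta>\<close> with \<open>|P \<zeta> w| \<le> k(\<delta>) \<delta>\<close>, where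
  \<open>k(\<delta>) \<longlongrightarrow> \<infinity>\<close>.

  For a maximal \<open>K\<delta>\<close>-separated set \<open>T\<close> of boundary points, the sum of \<open>(a/(a + P \<zeta>))\<^sup>7\<close> over \<open>\<zeta> \<in> T\<close> is bounded
  by nearly 1, is nearly 1 at the points over \<open>T\<close> and is tiny away from the boundary patch.  Composing it
  with a conformal map onto a thin neighbourhood of \<open>[0,1]\<close> gives \<open>F\<close> with \<open>|F| + |1 - F| \<le> 1 + \<kappa>\<close>.  The
  iteration \<open>f \<mapsto> (1 - F) f + F c\<close> with alternating \<open>c = 0, 1\<close>, summable \<open>\<kappa>\<close> and rapidly decreasing \<open>\<delta>\<close>
  converges to a bounded holomorphic function that has no limit at any point of the patch.
\<close>

section \<open>Koranyi geometry of a strongly convex boundary patch\<close>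

text \<open>Peaks that overlap would add up, so they need gaps of Koranyi size
  \<open>K * \<delta>\<close>, where \<open>K\<close> is large and depends on the accuracy. A point
  \<open>w\<close> of the patch then sees a peak only through an aperture of at least
  \<open>K\<close>. An unbounded aperture exceeds every such \<open>K\<close> once
  \<open>\<delta>\<close> is small, and this is the only way in which \<open>h1\<close> and
  \<open>h2\<close> tending to infinity enters. Hence the order of the quantifiers: \<open>K\<close>
  is fixed before the safety distance \<open>\<eta>\<close> and before the scale
  \<open>\<delta>\<close>. The other obstacle is boundedness. Adding infinitely many peak functions
  would destroy it. With \<open>F\<close> close to the segment [0,1] the update is almost a convex
  combination of \<open>f\<close> and \<open>c\<close>, so the sup norm grows only by a summable
  amount, while the values at the new peaks are replaced completely. Peaks are counted by boxes in
  real 4-space and not by surface measure of Koranyi balls. The count is cruder than the true one,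
  but a high power of the kernel makes up for it. All of this happens at every point of the patch;
  measure enters only at the end, to see that the patch is not a null set.\<close>

definition hpair :: "c2 \<Rightarrow> c2 \<Rightarrow> complex" where
  "hpair u v = cnj (u $ 1) * v $ 1 + cnj (u $ 2) * v $ 2"

lemma hpair_add_right: "hpair u (v + w) = hpair u v + hpair u w"
  and hpair_diff_right: "hpair u (v - w) = hpair u v - hpair u w"
  and hpair_diff_left: "hpair (u - u') v = hpair u v - hpair u' v"
  by (simp_all add: hpair_def algebra_simps)

lemma hpair_scaleR_right: "hpair u (r *\<^sub>R v) = complex_of_real r * hpair u v"
  by (simp add: hpair_def vector_scaleR_component) (simp add: scaleR_conv_of_real algebra_simps)

lemma norm_c2: "(norm v)\<^sup>2 = (cmod (v $ 1))\<^sup>2 + (cmod (v $ 2))\<^sup>2" for v :: c2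
  by (simp add: norm_vec_def L2_set_def sum_2)

lemma norm_c2_le: "norm v \<le> cmod (v $ 1) + cmod (v $ 2)" for v :: c2
  by (rule power2_le_imp_le) (auto simp: norm_c2 power2_sum)

lemma norm_hpair_le: "cmod (hpair u v) \<le> norm u * norm v"
proof -
  let ?a = "cmod (u $ 1)" and ?b = "cmod (u $ 2)" and ?x = "cmod (v $ 1)" and ?y = "cmod (v $ 2)"
  have "cmod (hpair u v) \<le> ?a * ?x + ?b * ?y"
    unfolding hpair_def by (rule order_trans[OF norm_triangle_ineq]) (simp add: norm_mult)
  also have "\<dots> \<le> norm u * norm v"
  proof (rule power2_le_imp_le)
    have "(norm u * norm v)\<^sup>2 - (?a * ?x + ?b * ?y)\<^sup>2 = (?a * ?y - ?b * ?x)\<^sup>2"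
      unfolding power_mult_distrib norm_c2 by (simp add: power2_eq_square algebra_simps)
    then show "(?a * ?x + ?b * ?y)\<^sup>2 \<le> (norm u * norm v)\<^sup>2"
      using zero_le_power2[of "?a * ?y - ?b * ?x"] by linarith
  qed simp
  finally show ?thesis .
qed

lemma Re_hpair: "Re (hpair u v) = u \<bullet> v"
  by (simp add: hpair_def inner_vec_def sum_2 inner_complex_def)

lemma hpair_self: "hpair u u = complex_of_real ((norm u)\<^sup>2)"
  by (simp add: hpair_def norm_c2 mult.commute flip: complex_norm_square)

text \<open>Pigeonhole on the unit grid of real 4-space: two complex numbers whose real and
  imaginary parts have equal floors are less than 2 apart, so the four floors determine the point.
  The map \<open>\<Phi>\<close> leaves the shape of the boxes to the application.\<close>

lemma card_separated_le:
  fixes \<Phi> :: "'a \<Rightarrow> complex \<times> complex"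
  assumes N: "0 \<le> N"
    and bound: "\<And>x. x \<in> T \<Longrightarrow> cmod (fst (\<Phi> x)) \<le> N \<and> cmod (snd (\<Phi> x)) \<le> N"
    and sep: "\<And>x y. x \<in> T \<Longrightarrow> y \<in> T \<Longrightarrow> x \<noteq> y \<Longrightarrow>
      2 \<le> cmod (fst (\<Phi> x) - fst (\<Phi> y)) \<or> 2 \<le> cmod (snd (\<Phi> x) - snd (\<Phi> y))"
  shows "finite T" and "real (card T) \<le> (2 * N + 3) ^ 4"
proof -
  define n :: int where "n = \<lceil>N\<rceil>"
  define \<Psi> where "\<Psi> x = ((\<lfloor>Re (fst (\<Phi> x))\<rfloor>, \<lfloor>Im (fst (\<Phi> x))\<rfloor>), (\<lfloor>Re (snd (\<Phi> x))\<rfloor>, \<lfloor>Im (snd (\<Phi> x))\<rfloor>))" for x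
  let ?I = "{-n..n}"
  have close: "cmod (a - b) < 2" if "\<lfloor>Re a\<rfloor> = \<lfloor>Re b\<rfloor>" "\<lfloor>Im a\<rfloor> = \<lfloor>Im b\<rfloor>" for a b
  proof -
    have "\<bar>Re (a - b)\<bar> < 1" "\<bar>Im (a - b)\<bar> < 1" using that by (simp; linarith)+
    then show ?thesis using cmod_le[of "a - b"] by linarith
  qed
  have inj: "inj_on \<Psi> T"
    by (rule inj_onI) (use sep close in \<open>force simp: \<Psi>_def\<close>)
  have mem: "\<lfloor>Re a\<rfloor> \<in> ?I \<and> \<lfloor>Im a\<rfloor> \<in> ?I" if "cmod a \<le> N" for a
  proof -
    have "\<bar>Re a\<bar> \<le> N" "\<bar>Im a\<bar> \<le> N"
      using that abs_Re_le_cmod[of a] abs_Im_le_cmod[of a] by linarith+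
    then have "\<bar>Re a\<bar> \<le> real_of_int n" "\<bar>Im a\<bar> \<le> real_of_int n"
      unfolding n_def using le_of_int_ceiling[of N] by linarith+
    then show ?thesis by (auto; linarith)
  qed
  have img: "\<Psi> ` T \<subseteq> (?I \<times> ?I) \<times> (?I \<times> ?I)"
    using bound mem by (auto simp: \<Psi>_def)
  then show "finite T" by (meson finite_SigmaI finite_atLeastAtMost_int finite_imageD finite_subset inj)
  have n0: "0 \<le> n" unfolding n_def using N by linarith
  have "card T \<le> card ((?I \<times> ?I) \<times> (?I \<times> ?I))"
    by (rule card_inj_on_le[OF inj img]) simp
  also have "\<dots> = nat (2 * n + 1) ^ 4"
    by (simp add: card_cartesian_product power4_eq_xxxx algebra_simps)
  finally have "real (card T) \<le> real (nat (2 * n + 1)) ^ 4"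
    by (metis of_nat_le_iff of_nat_power)
  also have "real (nat (2 * n + 1)) = 2 * real_of_int n + 1" using n0 by simp
  also have "(2 * real_of_int n + 1) ^ 4 \<le> (2 * N + 3) ^ 4"
  proof (rule power_mono)
    show "2 * real_of_int n + 1 \<le> 2 * N + 3" unfolding n_def by linarith
    show "0 \<le> 2 * real_of_int n + 1" using n0 by simp
  qed
  finally show "real (card T) \<le> (2 * N + 3) ^ 4" .
qed

text \<open>One constant \<open>C\<close> serves as convexity modulus, gradient bound, Lipschitz
  constant and nondegeneracy bound, so that later estimates only carry powers of \<open>C\<close>.
  The convexity inequality is also required between two points of \<open>S\<close>; this makes the
  modulus of \<open>P\<close> a quasi-distance on \<open>S\<close>.\<close>

locale convex_patch =
  fixes \<Omega> S :: "c2 set" and g :: "c2 \<Rightarrow> c2" and C :: real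
  assumes C: "1 \<le> C"
    and open_\<Omega>: "open \<Omega>"
    and norm_le: "z \<in> \<Omega> \<union> S \<Longrightarrow> norm z \<le> 1"
    and compact_S: "compact S"
    and disj: "\<Omega> \<inter> S = {}"
    and convex: "\<zeta> \<in> S \<Longrightarrow> z \<in> \<Omega> \<union> S \<Longrightarrow> (norm (\<zeta> - z))\<^sup>2 \<le> C * Re (hpair (g \<zeta>) (\<zeta> - z))"
    and norm_g: "\<zeta> \<in> S \<Longrightarrow> norm (g \<zeta>) \<le> C"
    and lip_g: "\<zeta> \<in> S \<Longrightarrow> \<zeta>' \<in> S \<Longrightarrow> norm (g \<zeta> - g \<zeta>') \<le> C * norm (\<zeta> - \<zeta>')"
    and g1: "\<zeta> \<in> S \<Longrightarrow> 1 \<le> C * cmod (g \<zeta> $ 1)"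
begin

text \<open>A support function that is complex affine in \<open>z\<close>; its zero set is the
  complex tangent plane at \<open>\<zeta>\<close> when \<open>g\<close> is the gradient.\<close>

definition P :: "c2 \<Rightarrow> c2 \<Rightarrow> complex" where
  "P \<zeta> z = hpair (g \<zeta>) (\<zeta> - z)"

lemma Re_P_nonneg: "\<zeta> \<in> S \<Longrightarrow> z \<in> \<Omega> \<union> S \<Longrightarrow> 0 \<le> Re (P \<zeta> z)"
  using convex[of \<zeta> z] C unfolding P_def
  by (metis mult_neg_pos mult.commute not_one_le_zero not_le order_trans zero_le_power2
      linorder_not_less order_less_le_trans zero_less_one)

lemma norm_diff_sq_le:
  assumes "\<zeta> \<in> S" "z \<in> \<Omega> \<union> S" "cmod (P \<zeta> z) \<le> r"
  shows "norm (\<zeta> - z) \<le> sqrt (C * r)"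
proof (rule real_le_rsqrt)
  have "Re (P \<zeta> z) \<le> r" using complex_Re_le_cmod[of "P \<zeta> z"] assms(3) by linarith
  then have "C * Re (P \<zeta> z) \<le> C * r" using C by (intro mult_left_mono) auto
  then show "(norm (\<zeta> - z))\<^sup>2 \<le> C * r" using convex[OF assms(1,2)] unfolding P_def by linarith
qed

lemma P_le: "\<zeta> \<in> S \<Longrightarrow> z \<in> \<Omega> \<union> S \<Longrightarrow> cmod (P \<zeta> z) \<le> 2 * C"
proof -
  assume a: "\<zeta> \<in> S" "z \<in> \<Omega> \<union> S"
  have "cmod (P \<zeta> z) \<le> norm (g \<zeta>) * norm (\<zeta> - z)" unfolding P_def by (rule norm_hpair_le)
  also have "\<dots> \<le> C * 2"
  proof (rule mult_mono)
    show "norm (\<zeta> - z) \<le> 2" using norm_triangle_ineq4[of \<zeta> z] norm_le[of \<zeta>] norm_le[of z] a by auto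
  qed (use norm_g a C in auto)
  finally show ?thesis by simp
qed

text \<open>Changing the base point costs the pairing of \<open>g \<zeta> - g \<zeta>'\<close> with
  \<open>z - \<zeta>'\<close>. Both factors are at most a constant times \<open>sqrt r\<close>,
  because the Koranyi distance dominates the squared Euclidean one, so the error is again of order
  \<open>r\<close>.\<close>

lemma P_quasi_triangle:
  assumes "\<zeta> \<in> S" "\<zeta>' \<in> S" "z \<in> \<Omega> \<union> S" "cmod (P \<zeta> z) \<le> r" "cmod (P \<zeta>' z) \<le> r"
  shows "cmod (P \<zeta> \<zeta>') \<le> (2 + 2 * C\<^sup>2) * r"
proof -
  have r0: "0 \<le> r" using assms(4) norm_ge_zero order_trans by blast
  let ?q = "sqrt (C * r)"
  have d: "norm (\<zeta> - z) \<le> ?q" "norm (\<zeta>' - z) \<le> ?q"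
    using norm_diff_sq_le assms by auto
  have d2: "norm (\<zeta> - \<zeta>') \<le> 2 * ?q"
    using norm_triangle_ineq4[of "\<zeta> - z" "\<zeta>' - z"] d by simp
  have eq: "P \<zeta> \<zeta>' = P \<zeta> z - P \<zeta>' z + hpair (g \<zeta> - g \<zeta>') (z - \<zeta>')"
    unfolding P_def by (simp add: hpair_diff_left hpair_diff_right)
  have "cmod (hpair (g \<zeta> - g \<zeta>') (z - \<zeta>')) \<le> norm (g \<zeta> - g \<zeta>') * norm (z - \<zeta>')"
    by (rule norm_hpair_le)
  also have "\<dots> \<le> (C * (2 * ?q)) * ?q"
  proof (intro mult_mono)
    show "norm (g \<zeta> - g \<zeta>') \<le> C * (2 * ?q)"
      using lip_g[OF assms(1,2)] d2 C by (meson mult_left_mono order_trans zero_le_one)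
  qed (use d C r0 in \<open>auto simp: norm_minus_commute\<close>)
  also have "\<dots> = 2 * C\<^sup>2 * r"
    using C r0 by (simp add: power2_eq_square)
  finally have "cmod (hpair (g \<zeta> - g \<zeta>') (z - \<zeta>')) \<le> 2 * C\<^sup>2 * r" .
  moreover have "cmod (P \<zeta> z - P \<zeta>' z) \<le> 2 * r"
    using norm_triangle_ineq4[of "P \<zeta> z" "P \<zeta>' z"] assms by linarith
  ultimately show ?thesis unfolding eq
    using norm_triangle_ineq[of "P \<zeta> z - P \<zeta>' z" "hpair (g \<zeta> - g \<zeta>') (z - \<zeta>')"]
    by (simp add: algebra_simps)
qed

text \<open>The failure of antisymmetry is quadratic in the Euclidean distance, and convexity bounds
  that square by the Koranyi distance itself.\<close>

lemma P_sym:
  assumes "\<zeta> \<in> S" "\<zeta>' \<in> S"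
  shows "cmod (P \<zeta> \<zeta>') \<le> (1 + C\<^sup>2) * cmod (P \<zeta>' \<zeta>)"
proof -
  have eq: "P \<zeta> \<zeta>' = - P \<zeta>' \<zeta> + hpair (g \<zeta> - g \<zeta>') (\<zeta> - \<zeta>')"
    unfolding P_def by (simp add: hpair_diff_left hpair_diff_right)
  have "cmod (hpair (g \<zeta> - g \<zeta>') (\<zeta> - \<zeta>')) \<le> norm (g \<zeta> - g \<zeta>') * norm (\<zeta> - \<zeta>')"
    by (rule norm_hpair_le)
  also have "\<dots> \<le> C * (norm (\<zeta>' - \<zeta>))\<^sup>2"
    using mult_right_mono[OF lip_g[OF assms], of "norm (\<zeta> - \<zeta>')"]
    by (simp add: power2_eq_square norm_minus_commute mult.assoc)
  also have "\<dots> \<le> C * (C * cmod (P \<zeta>' \<zeta>))"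
  proof (rule mult_left_mono)
    have "C * Re (P \<zeta>' \<zeta>) \<le> C * cmod (P \<zeta>' \<zeta>)"
      using complex_Re_le_cmod C by (intro mult_left_mono) auto
    then show "(norm (\<zeta>' - \<zeta>))\<^sup>2 \<le> C * cmod (P \<zeta>' \<zeta>)"
      using convex[of \<zeta>' \<zeta>] assms unfolding P_def by force
  qed (use C in auto)
  finally show ?thesis unfolding eq
    using norm_triangle_ineq[of "- P \<zeta>' \<zeta>" "hpair (g \<zeta> - g \<zeta>') (\<zeta> - \<zeta>')"]
    by (simp add: algebra_simps power2_eq_square)
qed

end

section \<open>Counting separated points in Koranyi balls\<close>

context convex_patch
begin

definition separated :: "real \<Rightarrow> c2 set \<Rightarrow> bool" where
  "separated s T \<longleftrightarrow> T \<subseteq> S \<and> (\<forall>\<zeta>\<in>T. \<forall>\<zeta>'\<in>T. \<zeta> \<noteq> \<zeta>' \<longrightarrow> s \<le> cmod (P \<zeta> \<zeta>'))"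

text \<open>Since \<open>g \<zeta> $ 1\<close> is bounded away from zero, the pairing with
  \<open>g \<zeta>\<close> and the second component are linear coordinates with uniformly bounded
  inverse.\<close>

lemma norm_le_coords:
  assumes "\<zeta> \<in> S"
  shows "norm v \<le> C * cmod (hpair (g \<zeta>) v) + 2 * C\<^sup>2 * cmod (v $ 2)"
proof -
  have g2: "cmod (g \<zeta> $ 2) \<le> C" using norm_g[OF assms] Finite_Cartesian_Product.norm_nth_le[of "g \<zeta>" 2] by linarith
  have "cmod (v $ 1) \<le> C * cmod (g \<zeta> $ 1) * cmod (v $ 1)"
    using mult_right_mono[OF g1[OF assms], of "cmod (v $ 1)"] by simp
  also have "\<dots> = C * cmod (hpair (g \<zeta>) v - cnj (g \<zeta> $ 2) * v $ 2)"
    by (simp add: hpair_def norm_mult)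
  also have "\<dots> \<le> C * (cmod (hpair (g \<zeta>) v) + C * cmod (v $ 2))"
  proof (rule mult_left_mono)
    have "cmod (cnj (g \<zeta> $ 2) * v $ 2) \<le> C * cmod (v $ 2)"
      using g2 by (simp add: norm_mult mult_right_mono)
    then show "cmod (hpair (g \<zeta>) v - cnj (g \<zeta> $ 2) * v $ 2) \<le> cmod (hpair (g \<zeta>) v) + C * cmod (v $ 2)"
      using norm_triangle_ineq4[of "hpair (g \<zeta>) v" "cnj (g \<zeta> $ 2) * v $ 2"] by linarith
  qed (use C in auto)
  finally have "cmod (v $ 1) \<le> C * cmod (hpair (g \<zeta>) v) + C\<^sup>2 * cmod (v $ 2)"
    by (simp add: algebra_simps power2_eq_square)
  moreover have "cmod (v $ 2) \<le> C\<^sup>2 * cmod (v $ 2)"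
    using mult_right_mono[of 1 "C\<^sup>2" "cmod (v $ 2)"] C by (simp add: one_le_power)
  ultimately show ?thesis using norm_c2_le[of v] by linarith
qed

text \<open>
  Around a fixed \<open>\<zeta>\<^sub>0\<close> the Koranyi ball of radius \<open>r\<close> is divided into boxes whose size in the \<open>z\<^sub>2\<close>
  direction is \<open>s/\<surd>r\<close> instead of the natural \<open>\<surd>s\<close>.  This costs a power of \<open>r/s\<close>, but compensates the
  variation of \<open>g\<close> over the ball.
\<close>

lemma packing:
  assumes T: "separated s T" and s: "0 < s" "s \<le> r" and r: "r \<le> 3 * C" and z: "z \<in> \<Omega> \<union> S"
  shows "finite {\<zeta>\<in>T. cmod (P \<zeta> z) \<le> r}"
    and "real (card {\<zeta>\<in>T. cmod (P \<zeta> z) \<le> r}) \<le> (147 * C ^ 6 * (r / s)) ^ 4"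
proof -
  let ?Q = "{\<zeta>\<in>T. cmod (P \<zeta> z) \<le> r}"
  have TS: "T \<subseteq> S" using T by (simp add: separated_def)
  have r0: "0 < r" using s by simp
  have "finite ?Q \<and> real (card ?Q) \<le> (147 * C ^ 6 * (r / s)) ^ 4"
  proof (cases "?Q = {}")
    case True
    then show ?thesis by (simp only: True) simp
  next
    case False
    then obtain \<zeta>0 where z0: "\<zeta>0 \<in> T" "cmod (P \<zeta>0 z) \<le> r" by auto
    then have z0S: "\<zeta>0 \<in> S" using TS by auto
    \<comment> \<open>Chosen so that the total error \<open>18 * C ^ 4 * (\<eta> * s)\<close> for
      two points in one box equals \<open>s\<close>, which contradicts separation.\<close>
    define \<eta> where "\<eta> = 1 / (18 * C ^ 4)"
    have eta: "0 < \<eta>" using C by (simp add: \<eta>_def)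
    define \<Phi> where "\<Phi> \<zeta> = (P \<zeta>0 \<zeta> / of_real (\<eta> * s), (\<zeta> - \<zeta>0) $ 2 * of_real (sqrt r / (\<eta> * s)))" for \<zeta>
    define N where "N = 72 * C ^ 6 * (r / s)"
    have C_pow: "C ^ m \<le> C ^ n" if "m \<le> n" for m n using power_increasing[OF that C] .
    have sqC: "sqrt C \<le> C" using C by (intro real_le_lsqrt) (auto simp: power2_eq_square)
    have near: "norm (\<zeta> - \<zeta>0) \<le> 2 * (C * sqrt r)" if "\<zeta> \<in> ?Q" for \<zeta>
    proof -
      have "norm (\<zeta> - z) \<le> sqrt (C * r)" "norm (\<zeta>0 - z) \<le> sqrt (C * r)"
        using norm_diff_sq_le that TS z z0 z0S by auto
      then have "norm (\<zeta> - \<zeta>0) \<le> 2 * sqrt (C * r)"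
        using norm_triangle_ineq4[of "\<zeta> - z" "\<zeta>0 - z"] by simp
      also have "\<dots> \<le> 2 * (C * sqrt r)"
        using mult_right_mono[OF sqC, of "sqrt r"] r0 by (simp add: real_sqrt_mult)
      finally show ?thesis .
    qed
    have N0: "0 \<le> N" using C s by (simp add: N_def)
    have bound: "cmod (fst (\<Phi> \<zeta>)) \<le> N \<and> cmod (snd (\<Phi> \<zeta>)) \<le> N" if Q: "\<zeta> \<in> ?Q" for \<zeta>
    proof
      have "cmod (P \<zeta>0 \<zeta>) \<le> (2 + 2 * C\<^sup>2) * r"
        using P_quasi_triangle[of \<zeta>0 \<zeta> z r] Q TS z z0 z0S by auto
      also have "\<dots> \<le> (4 * C\<^sup>2) * r"
        using C_pow[of 0 2] r0 by (intro mult_right_mono) auto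
      finally have "cmod (P \<zeta>0 \<zeta>) / (\<eta> * s) \<le> (4 * C\<^sup>2) * r / (\<eta> * s)"
        using eta s by (intro divide_right_mono) auto
      also have "\<dots> = N" using C s by (simp add: \<eta>_def N_def field_simps flip: power_add)
      finally show "cmod (fst (\<Phi> \<zeta>)) \<le> N" using eta s by (simp add: \<Phi>_def norm_divide norm_mult)
      have "cmod ((\<zeta> - \<zeta>0) $ 2) \<le> 2 * (C * sqrt r)"
        using near[OF Q] Finite_Cartesian_Product.norm_nth_le[of "\<zeta> - \<zeta>0" 2] by linarith
      then have "cmod ((\<zeta> - \<zeta>0) $ 2) * (sqrt r / (\<eta> * s)) \<le> 2 * (C * sqrt r) * (sqrt r / (\<eta> * s))"
        using eta s r0 by (intro mult_right_mono) auto
      also have "\<dots> = 36 * C ^ 5 * (r / s)"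
        using C s r0 by (simp add: \<eta>_def field_simps power_numeral_reduce)
      also have "\<dots> \<le> N" unfolding N_def
      proof (rule mult_right_mono)
        have "0 \<le> C ^ 6" using C by simp
        then show "36 * C ^ 5 \<le> 72 * C ^ 6" using C_pow[of 5 6] by linarith
      qed (use s in auto)
      finally show "cmod (snd (\<Phi> \<zeta>)) \<le> N"
        using eta s r0 by (simp only: \<Phi>_def snd_conv norm_mult norm_of_real) simp
    qed
    have sep: "2 \<le> cmod (fst (\<Phi> x) - fst (\<Phi> y)) \<or> 2 \<le> cmod (snd (\<Phi> x) - snd (\<Phi> y))"
      if Q: "x \<in> ?Q" "y \<in> ?Q" and ne: "x \<noteq> y" for x y
    proof (rule ccontr)
      assume "\<not> ?thesis"
      then have lt: "cmod (fst (\<Phi> x) - fst (\<Phi> y)) < 2" "cmod (snd (\<Phi> x) - snd (\<Phi> y)) < 2" by auto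
      have xS: "x \<in> S" "y \<in> S" using Q TS by auto
      have "fst (\<Phi> y) - fst (\<Phi> x) = hpair (g \<zeta>0) (x - y) / of_real (\<eta> * s)"
        unfolding \<Phi>_def P_def by (simp add: hpair_diff_right diff_divide_distrib)
      then have "cmod (hpair (g \<zeta>0) (x - y)) / (\<eta> * s) < 2"
        using lt(1) eta s by (subst (asm) norm_minus_commute) (simp add: norm_divide norm_mult)
      then have h: "cmod (hpair (g \<zeta>0) (x - y)) < 2 * \<eta> * s"
        using eta s by (simp add: divide_less_eq mult.assoc)
      have "snd (\<Phi> x) - snd (\<Phi> y) = (x - y) $ 2 * of_real (sqrt r / (\<eta> * s))"
        unfolding \<Phi>_def by (simp add: algebra_simps)
      then have "cmod ((x - y) $ 2) * (sqrt r / (\<eta> * s)) < 2"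
        using lt(2) eta s r0 by (simp only: norm_mult norm_of_real) simp
      then have h2: "sqrt r * cmod ((x - y) $ 2) < 2 * \<eta> * s"
        using eta s by (simp add: divide_less_eq field_simps)
      have eq: "P x y = hpair (g \<zeta>0) (x - y) + hpair (g x - g \<zeta>0) (x - y)"
        unfolding P_def by (simp add: hpair_diff_left)
      \<comment> \<open>Here the bound \<open>r \<le> 3 * C\<close> is used: it absorbs the factor
        \<open>sqrt r\<close> in front of the first coordinate, which unlike the second was not
        scaled by it.\<close>
      have sr: "sqrt r \<le> 2 * C"
      proof (rule real_le_lsqrt)
        have "C \<le> C\<^sup>2" using C_pow[of 1 2] by simp
        then show "r \<le> (2 * C)\<^sup>2" using r C by (simp add: power_mult_distrib)
      qed (use C in auto)
      have "cmod (hpair (g x - g \<zeta>0) (x - y)) \<le> norm (g x - g \<zeta>0) * norm (x - y)"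
        by (rule norm_hpair_le)
      also have "\<dots> \<le> (C * (2 * (C * sqrt r))) * (C * cmod (hpair (g \<zeta>0) (x - y)) + 2 * C\<^sup>2 * cmod ((x - y) $ 2))"
      proof (intro mult_mono norm_le_coords)
        show "norm (g x - g \<zeta>0) \<le> C * (2 * (C * sqrt r))"
          using lip_g[OF xS(1) z0S] near[OF Q(1)] C by (meson mult_left_mono order_trans zero_le_one)
      qed (use z0S C r0 in auto)
      also have "\<dots> = 2 * C ^ 3 * sqrt r * cmod (hpair (g \<zeta>0) (x - y)) + 4 * C ^ 4 * (sqrt r * cmod ((x - y) $ 2))"
        by (simp add: algebra_simps power_numeral_reduce)
      also have "\<dots> \<le> 2 * C ^ 3 * (2 * C) * (2 * \<eta> * s) + 4 * C ^ 4 * (2 * \<eta> * s)"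
      proof (rule add_mono)
        show "2 * C ^ 3 * sqrt r * cmod (hpair (g \<zeta>0) (x - y)) \<le> 2 * C ^ 3 * (2 * C) * (2 * \<eta> * s)"
          using h sr C r0 by (intro mult_mono) auto
        show "4 * C ^ 4 * (sqrt r * cmod ((x - y) $ 2)) \<le> 4 * C ^ 4 * (2 * \<eta> * s)"
          using h2 C by (intro mult_left_mono) auto
      qed
      also have "\<dots> = 16 * C ^ 4 * (\<eta> * s)" by (simp add: algebra_simps power_numeral_reduce)
      finally have "cmod (P x y) < 2 * (\<eta> * s) + 16 * C ^ 4 * (\<eta> * s)"
        using h unfolding eq
        using norm_triangle_ineq[of "hpair (g \<zeta>0) (x - y)" "hpair (g x - g \<zeta>0) (x - y)"] by linarith
      also have "\<dots> \<le> 2 * C ^ 4 * (\<eta> * s) + 16 * C ^ 4 * (\<eta> * s)"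
        using C_pow[of 0 4] eta s by simp
      also have "\<dots> = s" using C by (simp add: \<eta>_def field_simps)
      finally have "cmod (P x y) < s" .
      moreover have "s \<le> cmod (P x y)" using T Q ne by (auto simp: separated_def)
      ultimately show False by simp
    qed
    have card: "finite ?Q" "real (card ?Q) \<le> (2 * N + 3) ^ 4"
      using card_separated_le[of N ?Q \<Phi>, OF N0 bound sep] by auto
    \<comment> \<open>As \<open>C ^ 6 * (r / s)\<close> is at least 1, the summand 3 is absorbed,
      and 147 is 2 * 72 + 3.\<close>
    have "1 * 1 \<le> C ^ 6 * (r / s)" using C_pow[of 0 6] s C by (intro mult_mono) auto
    then have "(2 * N + 3) ^ 4 \<le> (147 * C ^ 6 * (r / s)) ^ 4"
      using N0 by (intro power_mono) (auto simp: N_def)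
    then show ?thesis using card by linarith
  qed
  then show "finite ?Q" "real (card ?Q) \<le> (147 * C ^ 6 * (r / s)) ^ 4" by auto
qed

lemma separated_finite:
  assumes "separated s T" "0 < s" "s \<le> 1" 
  shows "finite T" and "real (card T) \<le> (147 * C ^ 6 * (3 * C / s)) ^ 4"
proof -
  have "finite T \<and> real (card T) \<le> (147 * C ^ 6 * (3 * C / s)) ^ 4"
  proof (cases "T = {}")
    case False
    then obtain z where z: "z \<in> T" by auto
    have TS: "T \<subseteq> S" using assms by (simp add: separated_def)
    have "cmod (P \<zeta> z) \<le> 3 * C" if "\<zeta> \<in> T" for \<zeta>
      using P_le[of \<zeta> z] z TS that C by force
    then have "{\<zeta>\<in>T. cmod (P \<zeta> z) \<le> 3 * C} = T" by auto
    then show ?thesis using packing[OF assms(1,2), of "3 * C" z] z TS C assms by auto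
  qed simp
  then show "finite T" "real (card T) \<le> (147 * C ^ 6 * (3 * C / s)) ^ 4" by auto
qed

text \<open>Packing bounds the cardinality of separated sets, so one of largest cardinality exists,
  and an uncovered point could be adjoined to it. Separation is required in both orders of the
  arguments, hence the factor from \<open>P_sym\<close> in the covering radius.\<close>

lemma maximal_separated:
  assumes s: "0 < s" "s \<le> 1"
  obtains T where "separated s T" "finite T"
    "\<And>w. w \<in> S \<Longrightarrow> \<exists>\<zeta>\<in>T. cmod (P \<zeta> w) \<le> (1 + C\<^sup>2) * s"
proof -
  obtain N :: nat where N: "(147 * C ^ 6 * (3 * C / s)) ^ 4 \<le> real N"
    using real_arch_simple by blast
  have le: "card T < Suc N" if "separated s T" for T
    using separated_finite(2)[OF that s] N by linarith
  obtain T where T: "separated s T" and max: "\<And>T'. separated s T' \<Longrightarrow> card T' \<le> card T"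
    using ex_has_greatest_nat[of "separated s" "{}" card "Suc N"] le
    by (auto simp: separated_def)
  have fin: "finite T" using separated_finite[OF T s] by simp
  have "\<exists>\<zeta>\<in>T. cmod (P \<zeta> w) \<le> (1 + C\<^sup>2) * s" if w: "w \<in> S" for w
  proof (rule ccontr)
    assume "\<not> ?thesis"
    then have far: "(1 + C\<^sup>2) * s < cmod (P \<zeta> w)" if "\<zeta> \<in> T" for \<zeta> using that by force
    have TS: "T \<subseteq> S" using T by (simp add: separated_def)
    have far2: "s \<le> cmod (P \<zeta> w) \<and> s \<le> cmod (P w \<zeta>)" if z: "\<zeta> \<in> T" for \<zeta>
    proof
      have C1: "0 < 1 + C\<^sup>2" "s \<le> (1 + C\<^sup>2) * s" using C s by (auto simp: add_pos_nonneg algebra_simps)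
      show "s \<le> cmod (P \<zeta> w)" using far[OF z] C1 by linarith
      have "(1 + C\<^sup>2) * s < (1 + C\<^sup>2) * cmod (P w \<zeta>)"
        using far[OF z] P_sym[of \<zeta> w] z TS w by force
      then show "s \<le> cmod (P w \<zeta>)" using C1 by (simp add: mult_less_cancel_left_pos)
    qed
    have "cmod (P w w) = 0" by (simp add: P_def hpair_def)
    then have "w \<notin> T" using far2[of w] s by auto
    moreover have "separated s (insert w T)"
      using T far2 w by (auto simp: separated_def)
    ultimately show False using max[of "insert w T"] fin by simp
  qed
  then show ?thesis using that T fin by blast
qed

end

section \<open>Holomorphic functions of two variables\<close>

lemma holomorphic_c2_const: "holomorphic_c2 (\<lambda>z. k) A"
  unfolding holomorphic_c2_def by (intro ballI exI[of _ "\<lambda>v. 0"]) auto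

lemma holomorphic_c2_compose:
  assumes f: "holomorphic_c2 f A" and \<phi>: "\<phi> holomorphic_on D" and D: "open D" "f ` A \<subseteq> D"
  shows "holomorphic_c2 (\<lambda>z. \<phi> (f z)) A"
  unfolding holomorphic_c2_def
proof
  fix z assume z: "z \<in> A"
  obtain f' where f': "(f has_derivative f') (at z)" "\<And>c v. f' (c *s v) = c * f' v"
    using f z unfolding holomorphic_c2_def by blast
  have "f z \<in> D" using z D by auto
  then have "(\<phi> has_field_derivative deriv \<phi> (f z)) (at (f z))"
    using \<phi> D(1) holomorphic_derivI by blast
  then have "((\<lambda>z. \<phi> (f z)) has_derivative (\<lambda>v. deriv \<phi> (f z) * f' v)) (at z)"
    unfolding has_field_derivative_def using has_derivative_compose[OF f'(1)] by fastforce
  then show "\<exists>h. ((\<lambda>z. \<phi> (f z)) has_derivative h) (at z) \<and> (\<forall>c v. h (c *s v) = c * h v)"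
    using f'(2) by (intro exI[of _ "\<lambda>v. deriv \<phi> (f z) * f' v"]) (auto simp: algebra_simps)
qed

lemma holomorphic_c2_add:
  assumes "holomorphic_c2 f A" "holomorphic_c2 h A"
  shows "holomorphic_c2 (\<lambda>z. f z + h z) A"
  unfolding holomorphic_c2_def
proof
  fix z assume z: "z \<in> A"
  obtain f' where f': "(f has_derivative f') (at z)" "\<And>c v. f' (c *s v) = c * f' v"
    using assms(1) z unfolding holomorphic_c2_def by blast
  obtain h' where h': "(h has_derivative h') (at z)" "\<And>c v. h' (c *s v) = c * h' v"
    using assms(2) z unfolding holomorphic_c2_def by blast
  show "\<exists>k. ((\<lambda>z. f z + h z) has_derivative k) (at z) \<and> (\<forall>c v. k (c *s v) = c * k v)"
    using has_derivative_add[OF f'(1) h'(1)] f'(2) h'(2)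
    by (intro exI[of _ "\<lambda>v. f' v + h' v"]) (auto simp: algebra_simps)
qed

lemma holomorphic_c2_mult:
  assumes "holomorphic_c2 f A" "holomorphic_c2 h A"
  shows "holomorphic_c2 (\<lambda>z. f z * h z) A"
  unfolding holomorphic_c2_def
proof
  fix z assume z: "z \<in> A"
  obtain f' where f': "(f has_derivative f') (at z)" "\<And>c v. f' (c *s v) = c * f' v"
    using assms(1) z unfolding holomorphic_c2_def by blast
  obtain h' where h': "(h has_derivative h') (at z)" "\<And>c v. h' (c *s v) = c * h' v"
    using assms(2) z unfolding holomorphic_c2_def by blast
  show "\<exists>k. ((\<lambda>z. f z * h z) has_derivative k) (at z) \<and> (\<forall>c v. k (c *s v) = c * k v)"
    using has_derivative_mult[OF f'(1) h'(1)] f'(2) h'(2)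
    by (intro exI[of _ "\<lambda>v. f z * h' v + f' v * h z"]) (auto simp: algebra_simps)
qed

lemma holomorphic_c2_sum:
  assumes "\<And>i. i \<in> I \<Longrightarrow> holomorphic_c2 (f i) A"
  shows "holomorphic_c2 (\<lambda>z. \<Sum>i\<in>I. f i z) A"
  using assms by (induction I rule: infinite_finite_induct)
    (auto intro: holomorphic_c2_const holomorphic_c2_add)

lemma bounded_linear_hpair: "bounded_linear (hpair u)"
proof (rule bounded_linear_intro[of _ "norm u"])
  show "hpair u (r *\<^sub>R x) = r *\<^sub>R hpair u x" for r x
    unfolding hpair_scaleR_right by (rule scaleR_conv_of_real[symmetric])
  show "norm (hpair u x) \<le> norm x * norm u" for x
    using norm_hpair_le[of u x] by (simp add: mult.commute)
qed (rule hpair_add_right)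

lemma holomorphic_c2_hpair: "holomorphic_c2 (\<lambda>z. hpair u (p - z)) A"
  unfolding holomorphic_c2_def
proof
  fix z assume "z \<in> A"
  have "((\<lambda>z. hpair u (p - z)) has_derivative (\<lambda>v. hpair u (- v))) (at z)"
    by (rule bounded_linear.has_derivative[OF bounded_linear_hpair]) (auto intro!: derivative_eq_intros)
  moreover have "hpair u (- (c *s v)) = c * hpair u (- v)" for c v
    by (simp add: hpair_def algebra_simps)
  ultimately show "\<exists>f'. ((\<lambda>z. hpair u (p - z)) has_derivative f') (at z) \<and> (\<forall>c v. f' (c *s v) = c * f' v)"
    by blast
qed

text \<open>
  The branch \<open>X = -\<beta> Ln ((1 - u)/2)\<close> maps the disc into a half strip of width \<open>\<beta>\<pi>\<close> around the positive
  real axis, and \<open>X/(1 + X)\<close> maps that half strip into a thin neighbourhood of \<open>[0,1]\<close>.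
\<close>

lemma thin_map_exists:
  assumes k: "0 < \<kappa>"
  obtains \<phi> \<epsilon> where "\<phi> holomorphic_on ball 0 1" "0 < \<epsilon>"
    "\<And>u. u \<in> ball 0 1 \<Longrightarrow> cmod (\<phi> u) + cmod (1 - \<phi> u) \<le> 1 + \<kappa>"
    "\<And>u. u \<in> ball 0 1 \<Longrightarrow> cmod u \<le> \<epsilon> \<Longrightarrow> cmod (\<phi> u) \<le> \<kappa>"
    "\<And>u. u \<in> ball 0 1 \<Longrightarrow> cmod (u - 1) \<le> \<epsilon> \<Longrightarrow> cmod (1 - \<phi> u) \<le> \<kappa>"
proof -
  \<comment> \<open>The imaginary part of \<open>X\<close> is at most \<open>2 * \<beta>\<close> in
    modulus, which is then \<open>\<kappa>\<close>.\<close>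
  define \<beta> where "\<beta> = \<kappa> / 2"
  have b: "0 < \<beta>" "2 * \<beta> = \<kappa>" using k by (auto simp: \<beta>_def)
  define X where "X u = - of_real \<beta> * Ln ((1 - u) / 2)" for u :: complex
  define \<phi> where "\<phi> u = X u / (1 + X u)" for u
  have pos: "0 < Re ((1 - u) / 2)" if "u \<in> ball 0 1" for u :: complex
    using that complex_Re_le_cmod[of u] by simp
  have ReX: "Re (X u) = - \<beta> * ln (cmod (1 - u) / 2)" if "u \<in> ball 0 1" for u
  proof -
    have "(1 - u) / 2 \<noteq> 0" using pos[OF that] by (metis less_irrefl zero_complex.sel(1))
    then have "Re (Ln ((1 - u) / 2)) = ln (cmod ((1 - u) / 2))" by (rule Re_Ln)
    then show ?thesis by (simp add: X_def norm_divide)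
  qed
  have ReX0: "0 \<le> Re (X u)" if "u \<in> ball 0 1" for u
  proof -
    have "cmod (1 - u) \<le> 2" using norm_triangle_ineq4[of 1 u] that by simp
    moreover have "cmod (1 - u) > 0" using that by auto
    ultimately have "ln (cmod (1 - u) / 2) \<le> 0" by simp
    then show ?thesis unfolding ReX[OF that] using b by (simp add: mult_nonneg_nonpos)
  qed
  have ImX: "\<bar>Im (X u)\<bar> \<le> 2 * \<beta>" if "u \<in> ball 0 1" for u
  proof -
    have "\<bar>Im (Ln ((1 - u) / 2))\<bar> < pi / 2"
      using Re_Ln_pos_lt_imp[OF pos[OF that]] by simp
    then have "\<bar>Im (Ln ((1 - u) / 2))\<bar> \<le> 2" using pi_less_4 by linarith
    then have "\<beta> * \<bar>Im (Ln ((1 - u) / 2))\<bar> \<le> \<beta> * 2" using b by (intro mult_left_mono) auto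
    moreover have "\<bar>Im (X u)\<bar> = \<beta> * \<bar>Im (Ln ((1 - u) / 2))\<bar>" using b by (simp add: X_def abs_mult)
    ultimately show ?thesis by linarith
  qed
  have ge: "1 + Re (X u) \<le> cmod (1 + X u)" for u
    using complex_Re_le_cmod[of "1 + X u"] by simp
  have ne: "1 + X u \<noteq> 0" if "u \<in> ball 0 1" for u
    using ReX0[OF that] ge[of u] by (metis add_nonneg_pos not_le norm_zero add.commute zero_less_one)
  \<comment> \<open>Hence the sum of the two moduli is (1 + |X|) / |1 + X|, and
    \<open>1 - \<phi> u\<close> is small where the real part of \<open>X u\<close> is large.\<close>
  have one: "1 - \<phi> u = 1 / (1 + X u)" if "u \<in> ball 0 1" for u
    using ne[OF that] by (simp add: \<phi>_def field_simps)
  have hol: "\<phi> holomorphic_on ball 0 1"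
  proof -
    have "(1 - u) / 2 \<notin> \<real>\<^sub>\<le>\<^sub>0" if "u \<in> ball 0 1" for u :: complex
      using pos[OF that] by (metis complex_nonpos_Reals_iff not_le)
    then have "X holomorphic_on ball 0 1" unfolding X_def by (intro holomorphic_intros) auto
    then show ?thesis unfolding \<phi>_def using ne by (intro holomorphic_intros) auto
  qed
  have "continuous_on (ball 0 1) (\<lambda>u. cmod (\<phi> u))"
    using hol holomorphic_on_imp_continuous_on by (intro continuous_intros) auto
  then have "isCont (\<lambda>u. cmod (\<phi> u)) 0" by (simp add: continuous_on_eq_continuous_at)
  moreover have "cmod (\<phi> 0) < \<kappa>"
  proof -
    have "X 0 = of_real (\<beta> * ln 2)"
      using Ln_of_real[of "1/2"] by (simp add: X_def ln_div)
    then have "\<phi> 0 = of_real (\<beta> * ln 2 / (1 + \<beta> * ln 2))" by (simp add: \<phi>_def)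
    then have "cmod (\<phi> 0) = \<bar>\<beta> * ln 2 / (1 + \<beta> * ln 2)\<bar>" by (simp only: norm_of_real)
    moreover have "0 < \<beta> * ln 2" "\<beta> * ln 2 \<le> \<beta> * 1"
      using b ln_2_less_1 by (auto intro!: mult_left_mono)
    moreover have "\<beta> * ln 2 / (1 + \<beta> * ln 2) \<le> \<beta> * ln 2 / 1"
      using calculation by (intro divide_left_mono) auto
    moreover have "0 \<le> \<beta> * ln 2 / (1 + \<beta> * ln 2)" using calculation by auto
    ultimately show ?thesis using b by linarith
  qed
  ultimately have "\<forall>\<^sub>F u in at 0. cmod (\<phi> u) < \<kappa>"
    by (simp add: isCont_def order_tendstoD)
  then obtain d where d: "0 < d" "\<And>u. u \<noteq> 0 \<Longrightarrow> cmod u < d \<Longrightarrow> cmod (\<phi> u) < \<kappa>"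
    by (auto simp: eventually_at dist_norm)
  have d0: "cmod (\<phi> u) \<le> \<kappa>" if "cmod u < d" for u
    using d(2)[of u] that \<open>cmod (\<phi> 0) < \<kappa>\<close> by (cases "u = 0") auto
  \<comment> \<open>The first entry comes from continuity at 0, where \<open>\<phi>\<close> is
    already smaller than \<open>\<kappa>\<close>; the second makes the real part of
    \<open>X u\<close> at least \<open>1 / \<kappa>\<close> when \<open>u\<close> is within
    \<open>\<epsilon>\<close> of 1.\<close>
  define \<epsilon> where "\<epsilon> = min (d / 2) (2 * exp (- (1 / (\<beta> * \<kappa>))))"
  show ?thesis
  proof
    show "\<phi> holomorphic_on ball 0 1" by (rule hol)
    show "0 < \<epsilon>" using d by (simp add: \<epsilon>_def)
    fix u :: complex assume u: "u \<in> ball 0 1"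
    have R: "0 < 1 + Re (X u)" using ReX0[OF u] by linarith
    have "cmod (X u) \<le> Re (X u) + \<kappa>"
      using cmod_le[of "X u"] ImX[OF u] ReX0[OF u] b by linarith
    then have "1 + cmod (X u) \<le> (1 + \<kappa>) * (1 + Re (X u))"
    proof -
      have "0 \<le> \<kappa> * Re (X u)" using ReX0[OF u] k by simp
      moreover have "(1 + \<kappa>) * (1 + Re (X u)) = 1 + \<kappa> + Re (X u) + \<kappa> * Re (X u)"
        by (simp add: algebra_simps)
      ultimately show ?thesis using \<open>cmod (X u) \<le> Re (X u) + \<kappa>\<close> by linarith
    qed
    also have "\<dots> \<le> (1 + \<kappa>) * cmod (1 + X u)" using ge k by (intro mult_left_mono) auto
    finally have "1 + cmod (X u) \<le> (1 + \<kappa>) * cmod (1 + X u)" .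
    moreover have "0 < cmod (1 + X u)" using R ge[of u] by linarith
    ultimately have "(1 + cmod (X u)) / cmod (1 + X u) \<le> 1 + \<kappa>" by (simp add: divide_le_eq)
    then show "cmod (\<phi> u) + cmod (1 - \<phi> u) \<le> 1 + \<kappa>"
      unfolding one[OF u] by (simp add: \<phi>_def norm_divide add_divide_distrib)
    show "cmod (\<phi> u) \<le> \<kappa>" if "cmod u \<le> \<epsilon>" using d0[of u] that d by (simp add: \<epsilon>_def)
    show "cmod (1 - \<phi> u) \<le> \<kappa>" if e: "cmod (u - 1) \<le> \<epsilon>"
    proof -
      have "cmod (1 - u) / 2 \<le> exp (- (1 / (\<beta> * \<kappa>)))"
        using e by (simp add: \<epsilon>_def norm_minus_commute)
      moreover have "0 < cmod (1 - u)" using u by auto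
      ultimately have "ln (cmod (1 - u) / 2) \<le> ln (exp (- (1 / (\<beta> * \<kappa>))))"
        by (subst ln_le_cancel_iff) auto
      then have "ln (cmod (1 - u) / 2) \<le> - (1 / (\<beta> * \<kappa>))" by simp
      then have "\<beta> * (1 / (\<beta> * \<kappa>)) \<le> \<beta> * - ln (cmod (1 - u) / 2)"
        using b by (intro mult_left_mono) auto
      then have "1 / \<kappa> \<le> Re (X u)" using b by (simp add: ReX[OF u])
      then have "1 / \<kappa> \<le> cmod (1 + X u)" using ge[of u] by linarith
      moreover have "0 < cmod (1 + X u)" using R ge[of u] by linarith
      ultimately have "1 / cmod (1 + X u) \<le> \<kappa>" using k by (simp add: field_simps)
      then show ?thesis unfolding one[OF u] by (simp add: norm_divide)
    qed
  qed
qed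

section \<open>Sums of kernel powers over a separated set\<close>

context convex_patch
begin

text \<open>Sort the points into shells by the integer part of |P| / s. Packing allows a multiple of
  (n+1)^4 points in shell n, each contributing at most a multiple of (n+1)^(-6), so the total is
  controlled by the sum of (n+1)^(-2). The bound \<open>K\<close> is uniform in \<open>s\<close>,
  \<open>T\<close> and \<open>z\<close>.\<close>

lemma far_sum_bound:
  obtains K where "0 \<le> K"
    "\<And>s T z. separated s T \<Longrightarrow> 0 < s \<Longrightarrow> s \<le> 1 \<Longrightarrow> z \<in> \<Omega> \<union> S \<Longrightarrow>
      (\<Sum>\<zeta>\<in>{\<zeta>\<in>T. s \<le> 4 * C\<^sup>2 * cmod (P \<zeta> z)}. (s / cmod (P \<zeta> z)) ^ 6) \<le> K"
proof -
  define B where "B = (147 * C ^ 6) ^ 4 * (8 * C\<^sup>2) ^ 6"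
  define Z :: real where "Z = (\<Sum>k. 1 / (real k + 1)\<^sup>2)"
  have summ: "summable (\<lambda>k. 1 / (real k + 1)\<^sup>2)"
  proof -
    have "summable (\<lambda>n. inverse (real n ^ 2))" by (rule inverse_power_summable) simp
    then have "summable (\<lambda>n. inverse (real (Suc n) ^ 2))" by (subst summable_Suc_iff)
    then show ?thesis by (simp add: inverse_eq_divide add.commute)
  qed
  have B0: "0 \<le> B" using C by (simp add: B_def)
  have C1: "1 \<le> C\<^sup>2" using C by (simp add: one_le_power)
  show ?thesis
  proof
    show "0 \<le> B * Z" unfolding Z_def using B0 summ by (intro mult_nonneg_nonneg suminf_nonneg) auto
    fix s T z assume T: "separated s T" and s: "0 < s" "s \<le> 1" and z: "z \<in> \<Omega> \<union> S"
    define T' where "T' = {\<zeta>\<in>T. s \<le> 4 * C\<^sup>2 * cmod (P \<zeta> z)}"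
    define k where "k \<zeta> = nat \<lfloor>cmod (P \<zeta> z) / s\<rfloor>" for \<zeta>
    have finT: "finite T" using separated_finite[OF T s] by simp
    then have fin: "finite T'" by (simp add: T'_def)
    have k_le: "real (k \<zeta>) \<le> cmod (P \<zeta> z) / s" and k_gt: "cmod (P \<zeta> z) / s < real (k \<zeta>) + 1" for \<zeta>
    proof -
      have "0 \<le> cmod (P \<zeta> z) / s" using s by simp
      then show "real (k \<zeta>) \<le> cmod (P \<zeta> z) / s" "cmod (P \<zeta> z) / s < real (k \<zeta>) + 1"
        unfolding k_def by (auto simp: of_nat_nat)
    qed
    have term_le: "(s / cmod (P \<zeta> z)) ^ 6 \<le> (8 * C\<^sup>2) ^ 6 / (real (k \<zeta>) + 1) ^ 6" if "\<zeta> \<in> T'" for \<zeta>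
    proof -
      define x where "x = cmod (P \<zeta> z) / s"
      have x4: "1 \<le> 4 * C\<^sup>2 * x" using that s by (simp add: T'_def x_def field_simps)
      have "real (k \<zeta>) + 1 \<le> 8 * C\<^sup>2 * x"
      proof (cases "k \<zeta> = 0")
        case True then show ?thesis using x4 by simp
      next
        case False
        then have "1 \<le> real (k \<zeta>)" by simp
        then have "real (k \<zeta>) + 1 \<le> 2 * x" using k_le[of \<zeta>] by (simp add: x_def)
        moreover have "1 * x \<le> C\<^sup>2 * x" using C1 s by (intro mult_right_mono) (auto simp: x_def)
        moreover have "0 \<le> x" using s by (simp add: x_def)
        ultimately show ?thesis by linarith
      qed
      moreover have "0 < x" using x4 s by (cases "x = 0") (auto simp: x_def)
      ultimately have "1 / x \<le> 8 * C\<^sup>2 / (real (k \<zeta>) + 1)" by (simp add: field_simps)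
      then have "(1 / x) ^ 6 \<le> (8 * C\<^sup>2 / (real (k \<zeta>) + 1)) ^ 6"
        using \<open>0 < x\<close> by (intro power_mono) auto
      then show ?thesis by (simp add: x_def power_divide)
    qed
    have "(\<Sum>\<zeta>\<in>T'. (s / cmod (P \<zeta> z)) ^ 6) = (\<Sum>n\<in>k ` T'. \<Sum>\<zeta>\<in>{\<zeta>\<in>T'. k \<zeta> = n}. (s / cmod (P \<zeta> z)) ^ 6)"
      by (rule sum.image_gen[OF fin])
    also have "\<dots> \<le> (\<Sum>n\<in>k ` T'. B * (1 / (real n + 1)\<^sup>2))"
    proof (rule sum_mono)
      fix n assume n: "n \<in> k ` T'"
      let ?A = "{\<zeta>\<in>T'. k \<zeta> = n}" and ?A' = "{\<zeta>\<in>T. cmod (P \<zeta> z) \<le> (real n + 1) * s}"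
      have sub: "?A \<subseteq> ?A'"
      proof
        fix \<zeta> assume "\<zeta> \<in> ?A"
        then show "\<zeta> \<in> ?A'" using k_gt[of \<zeta>] s by (auto simp: T'_def field_simps intro: less_imp_le)
      qed
      obtain \<zeta>1 where z1: "\<zeta>1 \<in> T'" "k \<zeta>1 = n" using n by auto
      have "real n * s \<le> cmod (P \<zeta>1 z)" using k_le[of \<zeta>1] z1 s by (simp add: field_simps)
      also have "\<dots> \<le> 2 * C" using P_le[of \<zeta>1 z] z1 z T by (auto simp: T'_def separated_def)
      \<comment> \<open>A nonempty shell lies within the range \<open>2 * C\<close> of |P|, and
        \<open>s \<le> 1 \<le> C\<close>; this keeps the radius admissible for
        \<open>packing\<close>.\<close>
      finally have r: "(real n + 1) * s \<le> 3 * C" using s C by (simp add: algebra_simps)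
      have "s \<le> (real n + 1) * s" using s by simp
      then have card: "real (card ?A') \<le> (147 * C ^ 6 * ((real n + 1) * s / s)) ^ 4"
        by (rule packing(2)[OF T s(1) _ r z])
      have "card ?A \<le> card ?A'" by (rule card_mono[OF _ sub]) (use finT in auto)
      then have card2: "real (card ?A) \<le> (147 * C ^ 6) ^ 4 * (real n + 1) ^ 4"
        using card s by (simp add: power_mult_distrib)
      have "(\<Sum>\<zeta>\<in>?A. (s / cmod (P \<zeta> z)) ^ 6) \<le> (\<Sum>\<zeta>\<in>?A. (8 * C\<^sup>2) ^ 6 / (real n + 1) ^ 6)"
        by (rule sum_mono) (use term_le in auto)
      also have "\<dots> = real (card ?A) * ((8 * C\<^sup>2) ^ 6 / (real n + 1) ^ 6)" by simp
      also have "\<dots> \<le> ((147 * C ^ 6) ^ 4 * (real n + 1) ^ 4) * ((8 * C\<^sup>2) ^ 6 / (real n + 1) ^ 6)"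
        using card2 C by (intro mult_right_mono) auto
      also have "\<dots> = B * ((real n + 1) ^ 4 / (real n + 1) ^ 6)" by (simp add: B_def)
      also have "(real n + 1) ^ 4 / (real n + 1) ^ 6 = 1 / (real n + 1)\<^sup>2"
        using power_add[of "real n + 1" 4 2] by (simp add: field_simps)
      finally show "(\<Sum>\<zeta>\<in>?A. (s / cmod (P \<zeta> z)) ^ 6) \<le> B * (1 / (real n + 1)\<^sup>2)" .
    qed
    also have "\<dots> = B * (\<Sum>n\<in>k ` T'. 1 / (real n + 1)\<^sup>2)" by (simp add: sum_distrib_left)
    also have "\<dots> \<le> B * Z"
      unfolding Z_def using fin by (intro mult_left_mono sum_le_suminf summ B0) auto
    finally show "(\<Sum>\<zeta>\<in>{\<zeta>\<in>T. s \<le> 4 * C\<^sup>2 * cmod (P \<zeta> z)}. (s / cmod (P \<zeta> z)) ^ 6) \<le> B * Z"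
      by (simp add: T'_def)
  qed
qed

text \<open>The threshold \<open>4 * C ^ 2\<close> dominates the quasi-triangle constant
  \<open>2 + 2 * C ^ 2\<close>. The condition is the negation of the one in
  \<open>far_sum_bound\<close>, so a sum over \<open>T\<close> is a far sum plus at most one
  term.\<close>

lemma near_unique:
  assumes T: "separated s T" and z: "z \<in> \<Omega> \<union> S" and "\<zeta> \<in> T" "\<zeta>' \<in> T"
    and "4 * C\<^sup>2 * cmod (P \<zeta> z) < s" "4 * C\<^sup>2 * cmod (P \<zeta>' z) < s"
  shows "\<zeta> = \<zeta>'"
proof (rule ccontr)
  assume "\<zeta> \<noteq> \<zeta>'"
  then have sep: "s \<le> cmod (P \<zeta> \<zeta>')" using assms by (auto simp: separated_def)
  define r where "r = max (cmod (P \<zeta> z)) (cmod (P \<zeta>' z))"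
  have "cmod (P \<zeta> \<zeta>') \<le> (2 + 2 * C\<^sup>2) * r"
    using assms by (intro P_quasi_triangle[of _ _ z]) (auto simp: r_def separated_def)
  also have "\<dots> \<le> 4 * C\<^sup>2 * r"
    using C by (intro mult_right_mono) (auto simp: r_def one_le_power le_max_iff_disj)
  also have "\<dots> < s" using assms by (auto simp: r_def max_def)
  finally show False using sep by simp
qed

end

section \<open>Functions peaking on a separated set\<close>

context convex_patch
begin

definition spike :: "real \<Rightarrow> c2 \<Rightarrow> c2" where
  "spike \<delta> \<zeta> = \<zeta> - (\<delta> / norm (g \<zeta>)) *\<^sub>R g \<zeta>"

definition away :: "real \<Rightarrow> c2 \<Rightarrow> bool" where
  "away \<eta> z \<longleftrightarrow> (\<forall>\<zeta>\<in>S. \<eta> \<le> norm (\<zeta> - z))"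

text \<open>\<open>K\<close> is a parameter of its own so that it can be fixed before
  \<open>\<eta>\<close> and \<open>\<delta>\<close>. The values at the spikes are claimed
  conditionally, because the locale does not say on which side of \<open>S\<close> the domain
  lies.\<close>

definition peaks :: "real \<Rightarrow> real \<Rightarrow> real \<Rightarrow> real \<Rightarrow> (c2 \<Rightarrow> complex) \<Rightarrow> c2 set \<Rightarrow> bool" where
  "peaks \<epsilon> \<eta> \<delta> K G T \<longleftrightarrow> T \<subseteq> S \<and> finite T \<and> holomorphic_c2 G \<Omega> \<and>
     (\<forall>z\<in>\<Omega>. away \<eta> z \<longrightarrow> cmod (G z) \<le> \<epsilon>) \<and>
     (\<forall>\<zeta>\<in>T. spike \<delta> \<zeta> \<in> \<Omega> \<longrightarrow> cmod (G (spike \<delta> \<zeta>) - 1) \<le> \<epsilon>) \<and>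
     (\<forall>w\<in>S. \<exists>\<zeta>\<in>T. cmod (P \<zeta> w) \<le> K * \<delta>)"

lemma norm_g_pos: "\<zeta> \<in> S \<Longrightarrow> 0 < norm (g \<zeta>)"
  using g1[of \<zeta>] by (auto simp: zero_less_norm_iff)

lemma P_spike:
  assumes "\<zeta> \<in> S"
  shows "P \<zeta> (spike \<delta> \<zeta>) = of_real (\<delta> * norm (g \<zeta>))"
proof -
  have "\<zeta> - spike \<delta> \<zeta> = (\<delta> / norm (g \<zeta>)) *\<^sub>R g \<zeta>" by (simp add: spike_def)
  then have "P \<zeta> (spike \<delta> \<zeta>) = of_real (\<delta> / norm (g \<zeta>) * (norm (g \<zeta>))\<^sup>2)"
    by (simp only: P_def hpair_scaleR_right hpair_self of_real_mult)
  then show ?thesis using norm_g_pos[OF assms] by (simp add: power2_eq_square)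
qed

text \<open>A nonnegative real part of \<open>P \<zeta> z\<close> makes the denominator at least as
  large as both \<open>a\<close> and |P|.\<close>

lemma spike_kernel_bounds:
  assumes "\<zeta> \<in> S" "z \<in> \<Omega> \<union> S" "0 < a"
  shows "cmod (of_real a / (of_real a + P \<zeta> z)) \<le> 1"
    and "P \<zeta> z \<noteq> 0 \<Longrightarrow> cmod (of_real a / (of_real a + P \<zeta> z)) \<le> a / cmod (P \<zeta> z)"
proof -
  have R: "0 \<le> Re (P \<zeta> z)" using Re_P_nonneg assms by simp
  have 1: "a \<le> cmod (of_real a + P \<zeta> z)"
    using complex_Re_le_cmod[of "of_real a + P \<zeta> z"] R by simp
  then show "cmod (of_real a / (of_real a + P \<zeta> z)) \<le> 1"
    using assms by (simp add: norm_divide divide_le_eq)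
  have 2: "cmod (P \<zeta> z) \<le> cmod (of_real a + P \<zeta> z)"
  proof (rule power2_le_imp_le)
    have "(Re (P \<zeta> z))\<^sup>2 \<le> (a + Re (P \<zeta> z))\<^sup>2" using R assms by (intro power_mono) auto
    then show "(cmod (P \<zeta> z))\<^sup>2 \<le> (cmod (of_real a + P \<zeta> z))\<^sup>2" by (simp add: cmod_power2)
  qed simp
  show "cmod (of_real a / (of_real a + P \<zeta> z)) \<le> a / cmod (P \<zeta> z)" if "P \<zeta> z \<noteq> 0"
    unfolding norm_divide norm_of_real using 1 2 assms that by (intro frac_le) auto
qed

text \<open>Three scales: height \<open>\<delta>\<close>, kernel width
  \<open>a = A * \<delta>\<close>, separation \<open>s = A ^ 2 * \<delta>\<close>. At a spike its
  own kernel sees |P| of order \<open>\<delta>\<close>, well below \<open>a\<close>, and is close to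
  1; all other kernels see |P| at least of order \<open>s\<close>, well above \<open>a\<close>. The
  resulting \<open>K\<close> depends on \<open>\<epsilon>\<close> and the patch only, not on
  \<open>\<eta>\<close> or \<open>\<delta>\<close>.\<close>

lemma spike_sum_exists:
  assumes e: "0 < \<epsilon>"
  obtains K where "0 \<le> K"
    "\<And>\<eta>. 0 < \<eta> \<Longrightarrow> \<exists>\<delta>1>0. \<forall>\<delta>. 0 < \<delta> \<and> \<delta> < \<delta>1 \<longrightarrow> (\<exists>G T. peaks \<epsilon> \<eta> \<delta> K G T \<and> (\<forall>z\<in>\<Omega>. cmod (G z) \<le> 1 + \<epsilon>))"
proof -
  obtain K3 where K3: "0 \<le> K3" "\<And>s T z. separated s T \<Longrightarrow> 0 < s \<Longrightarrow> s \<le> 1 \<Longrightarrow> z \<in> \<Omega> \<union> S \<Longrightarrow>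
      (\<Sum>\<zeta>\<in>{\<zeta>\<in>T. s \<le> 4 * C\<^sup>2 * cmod (P \<zeta> z)}. (s / cmod (P \<zeta> z)) ^ 6) \<le> K3"
    using far_sum_bound by blast
  \<comment> \<open>The three entries ensure, in this order, that a spike is near its own base
    point, that its own kernel power differs from 1 by at most \<open>\<epsilon> / 2\<close>, and
    that the far terms add up to at most \<open>\<epsilon> / 2\<close>.\<close>
  define A where "A = max (4 * C ^ 3 + 1) (max (14 * C / \<epsilon>) (2 * K3 / \<epsilon>))"
  have A: "4 * C ^ 3 + 1 \<le> A" "14 * C / \<epsilon> \<le> A" "2 * K3 / \<epsilon> \<le> A"
    unfolding A_def by linarith+
  have C3: "0 < C ^ 3" using C by simp
  then have A1: "1 \<le> A" using A(1) by linarith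
  have A6: "A \<le> A ^ 6" using power_increasing[of 1 6 A] A1 by simp
  show ?thesis
  proof
    show "0 \<le> (1 + C\<^sup>2) * A\<^sup>2" by (simp add: add_nonneg_nonneg)
    fix \<eta> :: real assume eta: "0 < \<eta>"
    \<comment> \<open>The entries give \<open>s \<le> 1\<close>, make every peak far from each point
      that is \<open>\<eta>\<close>-away from \<open>S\<close>, and bound the sum at such points by
      \<open>\<epsilon>\<close>. The use of \<open>K3 + 1\<close> keeps the denominator
      positive.\<close>
    define \<delta>1 where "\<delta>1 = min (1 / A\<^sup>2) (min (4 * C * \<eta>\<^sup>2 / A\<^sup>2) (\<eta>\<^sup>2 * \<epsilon> / (A * C * (K3 + 1))))"
    have d1: "0 < \<delta>1" using A1 C eta e K3 by (simp add: \<delta>1_def)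
    show "\<exists>\<delta>1>0. \<forall>\<delta>. 0 < \<delta> \<and> \<delta> < \<delta>1 \<longrightarrow> (\<exists>G T. peaks \<epsilon> \<eta> \<delta> ((1 + C\<^sup>2) * A\<^sup>2) G T \<and> (\<forall>z\<in>\<Omega>. cmod (G z) \<le> 1 + \<epsilon>))"
    proof (intro exI[of _ \<delta>1] conjI allI impI d1)
      fix \<delta> assume "0 < \<delta> \<and> \<delta> < \<delta>1"
      then have d: "0 < \<delta>" "\<delta> < 1 / A\<^sup>2" "\<delta> < 4 * C * \<eta>\<^sup>2 / A\<^sup>2" "\<delta> < \<eta>\<^sup>2 * \<epsilon> / (A * C * (K3 + 1))"
        by (auto simp: \<delta>1_def)
      define s where "s = A\<^sup>2 * \<delta>"
      define a where "a = A * \<delta>"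
      have s: "0 < s" "s \<le> 1" "s \<le> 4 * C * \<eta>\<^sup>2"
        using d A1 by (auto simp: s_def field_simps)
      have a: "0 < a" using d A1 by (simp add: a_def)
      have as: "a / s = 1 / A" using d A1 by (simp add: a_def s_def power2_eq_square)
      have aeta: "a * C * (K3 + 1) \<le> \<eta>\<^sup>2 * \<epsilon>"
      proof -
        have "0 < A * C * (K3 + 1)" using A1 C K3(1) by simp
        then have "\<delta> * (A * C * (K3 + 1)) < \<eta>\<^sup>2 * \<epsilon>" using d(4) by (simp only: pos_less_divide_eq)
        then show ?thesis by (simp add: a_def mult_ac)
      qed
      obtain T where T: "separated s T" "finite T"
        and cover: "\<And>w. w \<in> S \<Longrightarrow> \<exists>\<zeta>\<in>T. cmod (P \<zeta> w) \<le> (1 + C\<^sup>2) * s"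
        using maximal_separated[OF s(1,2)] by blast
      have TS: "T \<subseteq> S" using T by (simp add: separated_def)
      \<comment> \<open>Six of the seven factors feed \<open>far_sum_bound\<close> and contribute
        the power of \<open>1 / A\<close>. The seventh is bounded by 1 in general, but away from
        \<open>S\<close> it supplies the small factor \<open>a * C / \<eta> ^ 2\<close>.\<close>
      define u where "u \<zeta> z = (of_real a / (of_real a + P \<zeta> z)) ^ 7" for \<zeta> z
      define G where "G z = (\<Sum>\<zeta>\<in>T. u \<zeta> z)" for z
      define far where "far z = {\<zeta>\<in>T. s \<le> 4 * C\<^sup>2 * cmod (P \<zeta> z)}" for z
      have u1: "cmod (u \<zeta> z) \<le> 1" if "\<zeta> \<in> T" "z \<in> \<Omega>" for \<zeta> z
        unfolding u_def norm_power using spike_kernel_bounds(1)[of \<zeta> z a] TS that a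
        by (intro power_le_one) auto
      have u6: "cmod (u \<zeta> z) \<le> cmod (of_real a / (of_real a + P \<zeta> z)) * ((1 / A) ^ 6 * (s / cmod (P \<zeta> z)) ^ 6)"
        if z: "\<zeta> \<in> far z" "z \<in> \<Omega>" for \<zeta> z
      proof -
        let ?x = "cmod (of_real a / (of_real a + P \<zeta> z))"
        have ne: "P \<zeta> z \<noteq> 0" using z s by (auto simp: far_def)
        have x: "?x \<le> a / cmod (P \<zeta> z)" 
          using spike_kernel_bounds[of \<zeta> z a] TS z a ne by (auto simp: far_def)
        have "a / cmod (P \<zeta> z) = 1 / A * (s / cmod (P \<zeta> z))" using as s by (simp add: field_simps)
        then have "?x ^ 6 \<le> (1 / A * (s / cmod (P \<zeta> z))) ^ 6" using x by (intro power_mono) auto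
        then have "?x * ?x ^ 6 \<le> ?x * (1 / A * (s / cmod (P \<zeta> z))) ^ 6" by (intro mult_left_mono) auto
        then show ?thesis unfolding u_def norm_power power_mult_distrib by (simp add: power_numeral_reduce)
      qed
      have far_le: "(\<Sum>\<zeta>\<in>far z. cmod (u \<zeta> z)) \<le> K3 / A ^ 6" if z: "z \<in> \<Omega>" for z
      proof -
        have "(\<Sum>\<zeta>\<in>far z. cmod (u \<zeta> z)) \<le> (\<Sum>\<zeta>\<in>far z. (1 / A) ^ 6 * (s / cmod (P \<zeta> z)) ^ 6)"
        proof (rule sum_mono)
          fix \<zeta> assume f: "\<zeta> \<in> far z"
          have "cmod (of_real a / (of_real a + P \<zeta> z)) * ((1 / A) ^ 6 * (s / cmod (P \<zeta> z)) ^ 6)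
              \<le> 1 * ((1 / A) ^ 6 * (s / cmod (P \<zeta> z)) ^ 6)"
            using spike_kernel_bounds(1)[of \<zeta> z a] f TS z a A1 s
            by (intro mult_right_mono) (auto simp: far_def)
          then show "cmod (u \<zeta> z) \<le> (1 / A) ^ 6 * (s / cmod (P \<zeta> z)) ^ 6" using u6[OF f z] by linarith
        qed
        also have "\<dots> = (1 / A) ^ 6 * (\<Sum>\<zeta>\<in>far z. (s / cmod (P \<zeta> z)) ^ 6)" by (simp add: sum_distrib_left)
        also have "\<dots> \<le> (1 / A) ^ 6 * K3"
          unfolding far_def using K3(2)[OF T(1) s(1,2)] z A1 by (intro mult_left_mono) auto
        finally show ?thesis by (simp add: power_divide)
      qed
      have K3A: "K3 / A ^ 6 \<le> \<epsilon> / 2"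
      proof -
        have "2 * K3 \<le> \<epsilon> * A" using A(3) e by (simp add: field_simps)
        also have "\<dots> \<le> \<epsilon> * A ^ 6" using A6 e by (intro mult_left_mono) auto
        finally show ?thesis using A1 by (simp add: field_simps)
      qed
      have split: "G z = (\<Sum>\<zeta>\<in>far z. u \<zeta> z) + (\<Sum>\<zeta>\<in>T - far z. u \<zeta> z)" for z
        unfolding G_def by (rule sum.subset_diff[THEN trans]) (auto simp: far_def T add.commute)
      have near1: "T - far z \<subseteq> {\<zeta>0}" if z: "\<zeta>0 \<in> T - far z" "z \<in> \<Omega>" for z \<zeta>0
      proof
        fix \<zeta> assume "\<zeta> \<in> T - far z"
        moreover have "z \<in> \<Omega> \<union> S" using z by simp
        ultimately have "\<zeta> = \<zeta>0" using z
          by (intro near_unique[OF T(1), of z]) (simp_all add: far_def not_le)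
        then show "\<zeta> \<in> {\<zeta>0}" by simp
      qed
      have G_le: "cmod (G z) \<le> 1 + \<epsilon>" if z: "z \<in> \<Omega>" for z
      proof -
        have "cmod (\<Sum>\<zeta>\<in>T - far z. u \<zeta> z) \<le> 1"
        proof (cases "T - far z = {}")
          case False
          then obtain \<zeta>0 where z0: "\<zeta>0 \<in> T - far z" by auto
          have "T - far z = {\<zeta>0}" using near1[OF z0 z] z0 by auto
          moreover have "cmod (u \<zeta>0 z) \<le> 1" using z0 z by (intro u1) simp_all
          ultimately show ?thesis by simp
        next
          case True then show ?thesis by (simp only: True) simp
        qed
        moreover have "cmod (\<Sum>\<zeta>\<in>far z. u \<zeta> z) \<le> \<epsilon> / 2"
          using sum_norm_le[of "far z" "\<lambda>\<zeta>. u \<zeta> z" "\<lambda>\<zeta>. cmod (u \<zeta> z)"] far_le[OF z] K3A by linarith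
        ultimately show ?thesis unfolding split[of z]
          using norm_triangle_ineq[of "\<Sum>\<zeta>\<in>far z. u \<zeta> z" "\<Sum>\<zeta>\<in>T - far z. u \<zeta> z"] e by linarith
      qed
      have G_away: "cmod (G z) \<le> \<epsilon>" if z: "z \<in> \<Omega>" and away: "away \<eta> z" for z
      proof -
        have Pge: "\<eta>\<^sup>2 \<le> C * cmod (P \<zeta> z)" if "\<zeta> \<in> T" for \<zeta>
        proof -
          have "\<eta>\<^sup>2 \<le> (norm (\<zeta> - z))\<^sup>2" using away that TS eta unfolding away_def by (intro power_mono) auto
          also have "\<dots> \<le> C * Re (P \<zeta> z)" unfolding P_def using convex that TS z by blast
          also have "\<dots> \<le> C * cmod (P \<zeta> z)" using C complex_Re_le_cmod by (intro mult_left_mono) auto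
          finally show ?thesis .
        qed
        have "T = far z"
        proof -
          have "s \<le> 4 * C\<^sup>2 * cmod (P \<zeta> z)" if "\<zeta> \<in> T" for \<zeta>
          proof -
            have "4 * C * \<eta>\<^sup>2 \<le> 4 * C * (C * cmod (P \<zeta> z))" using Pge[OF that] C by (intro mult_left_mono) auto
            then show ?thesis using s(3) by (simp add: power2_eq_square)
          qed
          then show ?thesis by (auto simp: far_def)
        qed
        have "cmod (G z) \<le> (\<Sum>\<zeta>\<in>far z. cmod (u \<zeta> z))"
          unfolding G_def \<open>T = far z\<close> by (rule norm_sum)
        also have "\<dots> \<le> (\<Sum>\<zeta>\<in>far z. (a * C / \<eta>\<^sup>2) * (s / cmod (P \<zeta> z)) ^ 6)"
        proof (rule sum_mono)
          fix \<zeta> assume f: "\<zeta> \<in> far z"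
          then have fT: "\<zeta> \<in> T" "\<zeta> \<in> S" using TS by (auto simp: far_def)
          have Ppos: "0 < cmod (P \<zeta> z)" using Pge[OF fT(1)] eta C
            by (metis linorder_not_less mult_zero_right norm_le_zero_iff norm_zero zero_less_power)
          have "cmod (of_real a / (of_real a + P \<zeta> z)) \<le> a / cmod (P \<zeta> z)"
            using spike_kernel_bounds(2)[of \<zeta> z a] fT z a Ppos by auto
          also have "\<dots> \<le> a * C / \<eta>\<^sup>2" using Pge[OF fT(1)] eta a Ppos by (simp add: field_simps)
          finally have x: "cmod (of_real a / (of_real a + P \<zeta> z)) \<le> a * C / \<eta>\<^sup>2" .
          have "(1 / A) ^ 6 \<le> 1" using A1 by (intro power_le_one) auto
          then have le: "(1 / A) ^ 6 * (s / cmod (P \<zeta> z)) ^ 6 \<le> 1 * (s / cmod (P \<zeta> z)) ^ 6"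
            using s by (intro mult_right_mono) auto
          have nn: "0 \<le> a * C / \<eta>\<^sup>2" "0 \<le> (1 / A) ^ 6 * (s / cmod (P \<zeta> z)) ^ 6"
            using a C A1 s by simp_all
          have "cmod (of_real a / (of_real a + P \<zeta> z)) * ((1 / A) ^ 6 * (s / cmod (P \<zeta> z)) ^ 6)
              \<le> (a * C / \<eta>\<^sup>2) * (1 * (s / cmod (P \<zeta> z)) ^ 6)"
            by (rule mult_mono[OF x le nn])
          then show "cmod (u \<zeta> z) \<le> (a * C / \<eta>\<^sup>2) * (s / cmod (P \<zeta> z)) ^ 6"
            using u6[OF f z] by linarith
        qed
        also have "\<dots> = (a * C / \<eta>\<^sup>2) * (\<Sum>\<zeta>\<in>far z. (s / cmod (P \<zeta> z)) ^ 6)" by (simp add: sum_distrib_left)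
        also have "\<dots> \<le> (a * C / \<eta>\<^sup>2) * K3"
          unfolding far_def using K3(2)[OF T(1) s(1,2)] z a C by (intro mult_left_mono) auto
        also have "\<dots> \<le> (a * C / \<eta>\<^sup>2) * (K3 + 1)" using a C by (intro mult_left_mono) auto
        also have "\<dots> \<le> \<epsilon>" using aeta eta by (simp add: field_simps)
        finally show ?thesis .
      qed
      have G_spike: "cmod (G (spike \<delta> \<zeta>) - 1) \<le> \<epsilon>" if z: "\<zeta> \<in> T" "spike \<delta> \<zeta> \<in> \<Omega>" for \<zeta>
      proof -
        let ?z = "spike \<delta> \<zeta>"
        have zS: "\<zeta> \<in> S" using z TS by auto
        define x where "x = norm (g \<zeta>) / A"
        have x: "0 \<le> x" using A1 by (simp add: x_def)
        have "4 * C\<^sup>2 * cmod (P \<zeta> ?z) < s"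
        proof -
          have "4 * C\<^sup>2 * (\<delta> * norm (g \<zeta>)) \<le> 4 * C\<^sup>2 * (\<delta> * C)"
            using norm_g[OF zS] d by (intro mult_left_mono) auto
          also have "\<dots> = (4 * C ^ 3) * \<delta>" by (simp add: power_numeral_reduce)
          also have "\<dots> < A * \<delta>" using A(1) d by (intro mult_strict_right_mono) auto
          also have "\<dots> \<le> s" unfolding s_def using power_increasing[of 1 2 A] A1 d by (intro mult_right_mono) auto
          finally show ?thesis unfolding P_spike[OF zS] using d by (simp add: norm_mult)
        qed
        then have near: "\<zeta> \<in> T - far ?z" using z by (auto simp: far_def)
        then have "T - far ?z = {\<zeta>}" using near1[OF near] z by auto
        then have G: "G ?z = (\<Sum>\<zeta>\<in>far ?z. u \<zeta> ?z) + u \<zeta> ?z" using split[of ?z] by simp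
        have "u \<zeta> ?z = of_real ((1 / (1 + x)) ^ 7)"
        proof -
          have "a / (a + \<delta> * norm (g \<zeta>)) = 1 / (1 + x)"
          proof -
            have "a / (a + \<delta> * norm (g \<zeta>)) = (\<delta> * A) / (\<delta> * (A + norm (g \<zeta>)))"
              by (simp add: a_def algebra_simps)
            also have "\<dots> = A / (A + norm (g \<zeta>))" using d(1) by simp
            also have "\<dots> = 1 / (1 + x)" using A1 by (simp add: x_def add_divide_distrib[symmetric] field_simps)
            finally show ?thesis .
          qed
          then have "complex_of_real a / (of_real a + of_real (\<delta> * norm (g \<zeta>))) = of_real (1 / (1 + x))"
            by (metis of_real_add of_real_divide)
          then show ?thesis unfolding u_def P_spike[OF zS] by (metis of_real_power)
        qed
        then have "cmod (u \<zeta> ?z - 1) = \<bar>(1 / (1 + x)) ^ 7 - 1\<bar>"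
          by (metis norm_of_real of_real_1 of_real_diff)
        also have "\<dots> \<le> 7 * x"
        proof -
          have "1 + real 7 * (1 / (1 + x) - 1) \<le> (1 + (1 / (1 + x) - 1)) ^ 7"
            using x by (intro Bernoulli_inequality) (simp add: field_simps)
          moreover have "- x \<le> 1 / (1 + x) - 1"
          proof -
            have "1 - x * x \<le> 1" by simp
            then have "1 - x \<le> 1 / (1 + x)" using x by (subst le_divide_eq) (auto simp: algebra_simps)
            then show ?thesis by simp
          qed
          moreover have "(1 / (1 + x)) ^ 7 \<le> 1" using x by (intro power_le_one) auto
          ultimately show ?thesis by simp
        qed
        also have "\<dots> \<le> \<epsilon> / 2"
        proof -
          have "14 * norm (g \<zeta>) \<le> 14 * C" using norm_g[OF zS] by simp
          also have "\<dots> \<le> \<epsilon> * A" using A(2) e by (simp add: field_simps)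
          finally show ?thesis using A1 by (simp add: x_def field_simps)
        qed
        finally have "cmod (u \<zeta> ?z - 1) \<le> \<epsilon> / 2" .
        moreover have "cmod (\<Sum>\<zeta>\<in>far ?z. u \<zeta> ?z) \<le> \<epsilon> / 2"
          using sum_norm_le[of "far ?z" "\<lambda>\<zeta>. u \<zeta> ?z" "\<lambda>\<zeta>. cmod (u \<zeta> ?z)"] far_le[OF z(2)] K3A by linarith
        ultimately show ?thesis unfolding G
          using norm_triangle_ineq[of "\<Sum>\<zeta>\<in>far ?z. u \<zeta> ?z" "u \<zeta> ?z - 1"]
          by (simp add: algebra_simps)
      qed
      have holG: "holomorphic_c2 G \<Omega>"
        unfolding G_def
      proof (rule holomorphic_c2_sum)
        fix \<zeta> assume z: "\<zeta> \<in> T"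
        show "holomorphic_c2 (u \<zeta>) \<Omega>" unfolding u_def
        proof (rule holomorphic_c2_compose[where \<phi> = "\<lambda>p. (of_real a / (of_real a + p)) ^ 7" and D = "{p. Re p > - a}"])
          show "holomorphic_c2 (P \<zeta>) \<Omega>" unfolding P_def by (rule holomorphic_c2_hpair)
          show "open {p. Re p > - a}" by (rule open_halfspace_Re_gt)
          have "of_real a + p \<noteq> 0" if "- a < Re p" for p using that by (auto simp: complex_eq_iff)
          then show "(\<lambda>p. (of_real a / (of_real a + p)) ^ 7) holomorphic_on {p. Re p > - a}"
            by (intro holomorphic_intros) auto
          show "P \<zeta> ` \<Omega> \<subseteq> {p. Re p > - a}" using Re_P_nonneg[of \<zeta>] z TS a by force
        qed
      qed
      have cover': "\<exists>\<zeta>\<in>T. cmod (P \<zeta> w) \<le> (1 + C\<^sup>2) * A\<^sup>2 * \<delta>" if "w \<in> S" for w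
        using cover[OF that] by (simp add: s_def mult.assoc)
      show "\<exists>G T. peaks \<epsilon> \<eta> \<delta> ((1 + C\<^sup>2) * A\<^sup>2) G T \<and> (\<forall>z\<in>\<Omega>. cmod (G z) \<le> 1 + \<epsilon>)"
        unfolding peaks_def by (intro exI[of _ G] exI[of _ T] conjI ballI impI)
          (fact TS T(2) holG G_le G_away G_spike cover')+
    qed
  qed
qed

text \<open>The sum \<open>G\<close> may slightly exceed modulus 1, whereas \<open>\<phi>\<close>
  lives on the open disc. Division by \<open>1 + 2 * \<epsilon>'\<close> brings \<open>G\<close>
  into the disc and shifts values near 1 by at most \<open>2 * \<epsilon>'\<close>; the total
  deviation \<open>3 * \<epsilon>'\<close> is still within the tolerance \<open>\<epsilon>\<close>
  of the map.\<close>

lemma spike_function_exists: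
  assumes k: "0 < \<kappa>"
  obtains K where "0 \<le> K"
    "\<And>\<eta>. 0 < \<eta> \<Longrightarrow> \<exists>\<delta>1>0. \<forall>\<delta>. 0 < \<delta> \<and> \<delta> < \<delta>1 \<longrightarrow> (\<exists>F T. peaks \<kappa> \<eta> \<delta> K F T \<and> (\<forall>z\<in>\<Omega>. cmod (F z) + cmod (1 - F z) \<le> 1 + \<kappa>))"
proof -
  obtain \<phi> \<epsilon> where hol: "\<phi> holomorphic_on ball 0 1" and e: "0 < \<epsilon>"
    and \<phi>1: "\<And>u. u \<in> ball 0 1 \<Longrightarrow> cmod (\<phi> u) + cmod (1 - \<phi> u) \<le> 1 + \<kappa>"
    and \<phi>2: "\<And>u. u \<in> ball 0 1 \<Longrightarrow> cmod u \<le> \<epsilon> \<Longrightarrow> cmod (\<phi> u) \<le> \<kappa>"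
    and \<phi>3: "\<And>u. u \<in> ball 0 1 \<Longrightarrow> cmod (u - 1) \<le> \<epsilon> \<Longrightarrow> cmod (1 - \<phi> u) \<le> \<kappa>"
    using thin_map_exists[OF k] by blast
  define \<epsilon>' where "\<epsilon>' = \<epsilon> / 4"
  have e': "0 < \<epsilon>'" using e by (simp add: \<epsilon>'_def)
  obtain K where K: "0 \<le> K"
    "\<And>\<eta>. 0 < \<eta> \<Longrightarrow> \<exists>\<delta>1>0. \<forall>\<delta>. 0 < \<delta> \<and> \<delta> < \<delta>1 \<longrightarrow> (\<exists>G T. peaks \<epsilon>' \<eta> \<delta> K G T \<and> (\<forall>z\<in>\<Omega>. cmod (G z) \<le> 1 + \<epsilon>'))"
    using spike_sum_exists[OF e'] by blast
  define q where "q = 1 + 2 * \<epsilon>'"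
  have q: "1 < q" using e' by (simp add: q_def)
  show ?thesis
  proof (rule that[OF K(1)])
    fix \<eta> :: real assume "0 < \<eta>"
    then obtain \<delta>1 where d1: "\<delta>1 > 0" and ex: "\<And>\<delta>. 0 < \<delta> \<and> \<delta> < \<delta>1 \<Longrightarrow> \<exists>G T. peaks \<epsilon>' \<eta> \<delta> K G T \<and> (\<forall>z\<in>\<Omega>. cmod (G z) \<le> 1 + \<epsilon>')"
      using K(2)[of \<eta>] by blast
    have "\<exists>F T. peaks \<kappa> \<eta> \<delta> K F T \<and> (\<forall>z\<in>\<Omega>. cmod (F z) + cmod (1 - F z) \<le> 1 + \<kappa>)" if d: "0 < \<delta> \<and> \<delta> < \<delta>1" for \<delta>
    proof -
      obtain G T where T: "T \<subseteq> S" "finite T" and G: "holomorphic_c2 G \<Omega>"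
        and G1: "\<And>z. z \<in> \<Omega> \<Longrightarrow> cmod (G z) \<le> 1 + \<epsilon>'"
        and G2: "\<And>z. z \<in> \<Omega> \<Longrightarrow> away \<eta> z \<Longrightarrow> cmod (G z) \<le> \<epsilon>'"
        and G3: "\<And>\<zeta>. \<zeta> \<in> T \<Longrightarrow> spike \<delta> \<zeta> \<in> \<Omega> \<Longrightarrow> cmod (G (spike \<delta> \<zeta>) - 1) \<le> \<epsilon>'"
        and cover: "\<forall>w\<in>S. \<exists>\<zeta>\<in>T. cmod (P \<zeta> w) \<le> K * \<delta>"
        using ex[OF d] unfolding peaks_def by blast
      define v where "v z = G z / of_real q" for z
      have cv: "cmod (v z) = cmod (G z) / q" for z using q by (simp add: v_def norm_divide)
      have v: "v z \<in> ball 0 1" if "z \<in> \<Omega>" for z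
        using G1[OF that] q e' by (simp add: cv q_def)
      have holF: "holomorphic_c2 (\<lambda>z. \<phi> (v z)) \<Omega>"
      proof (rule holomorphic_c2_compose[where f = v and \<phi> = \<phi> and D = "ball 0 1"])
        show "holomorphic_c2 v \<Omega>" unfolding v_def
          by (rule holomorphic_c2_compose[OF G, where \<phi> = "\<lambda>w. w / of_real q" and D = UNIV])
            (use q in \<open>auto intro!: holomorphic_intros\<close>)
      qed (use v hol in auto)
      have c2: "cmod (\<phi> (v z)) \<le> \<kappa>" if z: "z \<in> \<Omega>" "away \<eta> z" for z
      proof (rule \<phi>2[OF v[OF z(1)]])
        have "cmod (G z) / q \<le> cmod (G z) / 1" using q by (intro divide_left_mono) auto
        then show "cmod (v z) \<le> \<epsilon>" using G2[OF z] e by (simp add: cv \<epsilon>'_def)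
      qed
      have c3: "cmod (\<phi> (v (spike \<delta> \<zeta>)) - 1) \<le> \<kappa>" if z: "\<zeta> \<in> T" "spike \<delta> \<zeta> \<in> \<Omega>" for \<zeta>
      proof (subst norm_minus_commute, rule \<phi>3[OF v[OF z(2)]])
        let ?w = "G (spike \<delta> \<zeta>)"
        have "v (spike \<delta> \<zeta>) - 1 = (?w - 1 - of_real (2 * \<epsilon>')) / of_real q"
        proof -
          have "?w - 1 - of_real (2 * \<epsilon>') = ?w - of_real q" by (simp add: q_def)
          moreover have "complex_of_real q \<noteq> 0" using q by simp
          ultimately show ?thesis unfolding v_def by (metis diff_divide_distrib divide_self)
        qed
        then have "cmod (v (spike \<delta> \<zeta>) - 1) = cmod (?w - 1 - of_real (2 * \<epsilon>')) / q"
          using q by (simp add: norm_divide)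
        also have "\<dots> \<le> cmod (?w - 1 - of_real (2 * \<epsilon>')) / 1" using q by (intro divide_left_mono) auto
        also have "\<dots> \<le> cmod (?w - 1) + cmod (of_real (2 * \<epsilon>'))"
          using norm_triangle_ineq4[of "?w - 1" "of_real (2 * \<epsilon>')"] by simp
        also have "cmod (complex_of_real (2 * \<epsilon>')) = 2 * \<epsilon>'" unfolding norm_of_real using e' by simp
        also have "cmod (?w - 1) + 2 * \<epsilon>' \<le> \<epsilon>" using G3[OF z] e by (simp add: \<epsilon>'_def)
        finally show "cmod (v (spike \<delta> \<zeta>) - 1) \<le> \<epsilon>" .
      qed
      show ?thesis
        unfolding peaks_def
      proof (intro exI[of _ "\<lambda>z. \<phi> (v z)"] exI[of _ T] conjI ballI impI)
        show "cmod (\<phi> (v z)) + cmod (1 - \<phi> (v z)) \<le> 1 + \<kappa>" if "z \<in> \<Omega>" for z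
          by (rule \<phi>1[OF v[OF that]])
        show "\<exists>\<zeta>\<in>T. cmod (P \<zeta> w) \<le> K * \<delta>" if "w \<in> S" for w using cover that by (rule bspec)
      qed (fact T holF c2 c3)+
    qed
    then show "\<exists>\<delta>1>0. \<forall>\<delta>. 0 < \<delta> \<and> \<delta> < \<delta>1 \<longrightarrow> (\<exists>F T. peaks \<kappa> \<eta> \<delta> K F T \<and> (\<forall>z\<in>\<Omega>. cmod (F z) + cmod (1 - F z) \<le> 1 + \<kappa>))"
      using d1 by blast
  qed
qed

end

section \<open>Cauchy estimates and locally uniform limits in two variables\<close>

lemma norm_vector_mult_c2: "norm (t *s v) = cmod t * norm v" for v :: c2
  by (rule power2_eq_imp_eq) (simp_all add: power_mult_distrib norm_c2 norm_mult algebra_simps)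

text \<open>Cauchy's inequality in one variable, applied to the slice
  \<open>t \<mapsto> f (z + t *s v)\<close> on the disc of radius \<open>r / norm v\<close>.\<close>

lemma holomorphic_c2_derivative_bound:
  assumes f: "holomorphic_c2 f A" and r: "0 < r" "cball z r \<subseteq> A"
    and B: "\<And>x. x \<in> cball z r \<Longrightarrow> cmod (f x) \<le> B"
    and f': "(f has_derivative f') (at z)"
  shows "cmod (f' v) \<le> B / r * norm v"
proof (cases "v = 0")
  case True
  then show ?thesis using has_derivative_bounded_linear[OF f'] by (simp add: bounded_linear.linear linear_0)
next
  case False
  define q where "q = r / norm v"
  have q: "0 < q" "q * norm v = r" using False r by (auto simp: q_def)
  define \<phi> where "\<phi> t = f (z + t *s v)" for t
  have mem: "z + t *s v \<in> cball z r" if "cmod t \<le> q" for t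
    using mult_right_mono[OF that, of "norm v"] q by (simp add: dist_norm norm_vector_mult_c2)
  have bl: "bounded_linear (\<lambda>t. t *s v)"
    by (rule bounded_linear_intro[of _ "norm v"])
      (simp_all add: vector_sadd_rdistrib norm_vector_mult_c2 vec_eq_iff)
  have line: "((\<lambda>t. z + t *s v) has_derivative (\<lambda>t. t *s v)) (at t)" for t
    using bounded_linear.has_derivative[OF bl has_derivative_ident, of "at t"]
    by (auto intro!: derivative_eq_intros)
  have der: "\<exists>D. (\<phi> has_field_derivative D v) (at t) \<and> (f has_derivative D) (at (z + t *s v))"
    if t: "cmod t \<le> q" for t
  proof -
    have "z + t *s v \<in> A" using mem[OF t] r by auto
    then obtain D where D: "(f has_derivative D) (at (z + t *s v))" "\<And>c v. D (c *s v) = c * D v"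
      using f unfolding holomorphic_c2_def by blast
    have "(\<phi> has_derivative (\<lambda>s. D (s *s v))) (at t)"
      unfolding \<phi>_def using has_derivative_compose[OF line D(1)] by simp
    then have "(\<phi> has_field_derivative D v) (at t)"
      unfolding has_field_derivative_def by (simp add: D(2) mult.commute[of _ "D v"])
    then show ?thesis using D(1) by blast
  qed
  have hol: "\<phi> holomorphic_on cball 0 q"
    unfolding holomorphic_on_def field_differentiable_def
    using der by (meson DERIV_subset mem_cball_0 top_greatest)
  obtain D where D: "(\<phi> has_field_derivative D v) (at 0)" "(f has_derivative D) (at z)"
    using der[of 0] q by auto
  have "D = f'" using has_derivative_unique[OF D(2) f'] .
  have "cmod ((deriv ^^ 1) \<phi> 0) \<le> fact 1 * B / q ^ 1"
  proof (rule Cauchy_inequality)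
    show "\<phi> holomorphic_on ball 0 q" using hol by (rule holomorphic_on_subset) auto
    show "continuous_on (cball 0 q) \<phi>" using hol by (rule holomorphic_on_imp_continuous_on)
    show "cmod (\<phi> t) \<le> B" if "cmod (0 - t) = q" for t
      unfolding \<phi>_def by (rule B, rule mem) (use that in simp)
  qed (rule q)
  then have "cmod (f' v) \<le> B / q" using DERIV_imp_deriv[OF D(1)] \<open>D = f'\<close> by simp
  then show ?thesis by (simp add: q_def)
qed

text \<open>By Cauchy's estimate on balls of half the radius, the uniform Cauchy property passes to
  the derivatives, uniformly in the direction. The theorem on sequences of differentiable functions
  then gives differentiability, and complex linearity survives the pointwise limit of the
  derivatives.\<close>

lemma holomorphic_c2_limit:
  assumes hol: "\<And>n. holomorphic_c2 (f n) A"
    and lim: "\<And>z. z \<in> A \<Longrightarrow> (\<lambda>n. f n z) \<longlonglongrightarrow> F z"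
    and cauchy: "\<And>z. z \<in> A \<Longrightarrow> \<exists>r>0. cball z r \<subseteq> A \<and>
      (\<forall>e>0. \<exists>N. \<forall>m\<ge>N. \<forall>n\<ge>N. \<forall>x\<in>cball z r. cmod (f m x - f n x) \<le> e)"
  shows "holomorphic_c2 F A"
  unfolding holomorphic_c2_def
proof
  fix z assume z: "z \<in> A"
  obtain r where r: "0 < r" "cball z r \<subseteq> A"
    and c: "\<And>e. e > 0 \<Longrightarrow> \<exists>N. \<forall>m\<ge>N. \<forall>n\<ge>N. \<forall>x\<in>cball z r. cmod (f m x - f n x) \<le> e"
    using cauchy[OF z] by blast
  have "\<exists>D. \<forall>n x. x \<in> A \<longrightarrow> (f n has_derivative D n x) (at x) \<and> (\<forall>c v. D n x (c *s v) = c * D n x v)"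
    using hol unfolding holomorphic_c2_def by metis
  then obtain D where D: "\<And>n x. x \<in> A \<Longrightarrow> (f n has_derivative D n x) (at x)"
    and D_lin: "\<And>n x c v. x \<in> A \<Longrightarrow> D n x (c *s v) = c * D n x v" by blast
  define S where "S = ball z (r / 2)"
  have sub: "cball x (r / 2) \<subseteq> cball z r" if "x \<in> S" for x
  proof
    fix y assume "y \<in> cball x (r / 2)"
    then show "y \<in> cball z r" using that dist_triangle[of z y x] by (simp add: S_def)
  qed
  have SA: "x \<in> A" if "x \<in> S" for x
  proof -
    have "x \<in> cball x (r / 2)" using r by simp
    then show ?thesis using sub[OF that] r by blast
  qed
  have Dd: "\<exists>N. \<forall>m\<ge>N. \<forall>n\<ge>N. \<forall>x\<in>S. \<forall>h. cmod (D m x h - D n x h) \<le> e * norm h" if e: "e > 0" for e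
  proof -
    obtain N where N: "\<And>m n x. m \<ge> N \<Longrightarrow> n \<ge> N \<Longrightarrow> x \<in> cball z r \<Longrightarrow> cmod (f m x - f n x) \<le> e * (r / 2)"
    proof -
      have "0 < e * (r / 2)" using e r by simp
      from c[OF this] show ?thesis using that by blast
    qed
    have "cmod (D m x h - D n x h) \<le> e * norm h" if mn: "m \<ge> N" "n \<ge> N" and x: "x \<in> S" for m n x h
    proof -
      have h: "holomorphic_c2 (\<lambda>x. f m x + (- 1) * f n x) A"
        by (intro holomorphic_c2_add holomorphic_c2_mult holomorphic_c2_const hol)
      have d: "((\<lambda>x. f m x + (- 1) * f n x) has_derivative (\<lambda>v. D m x v - D n x v)) (at x)"
        using has_derivative_diff[OF D[OF SA[OF x], of m] D[OF SA[OF x], of n]] by simp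
      have "cmod (D m x h - D n x h) \<le> (e * (r / 2)) / (r / 2) * norm h"
      proof (rule holomorphic_c2_derivative_bound[OF h _ _ _ d])
        show "cball x (r / 2) \<subseteq> A" using sub[OF x] r by blast
        show "cmod (f m y + (- 1) * f n y) \<le> e * (r / 2)" if "y \<in> cball x (r / 2)" for y
        proof -
          have "y \<in> cball z r" using sub[OF x] that by blast
          then show ?thesis using N[OF mn] by simp
        qed
      qed (use r in simp)
      then show ?thesis using r by simp
    qed
    then show ?thesis by blast
  qed
  define D' where "D' x h = lim (\<lambda>n. D n x h)" for x h
  have D'_lim: "(\<lambda>n. D n x h) \<longlonglongrightarrow> D' x h" if x: "x \<in> S" for x h
  proof -
    have "Cauchy (\<lambda>n. D n x h)"
    proof (rule CauchyI)
      fix e :: real assume e: "0 < e"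
      then have e': "0 < e / (norm h + 1)" by (simp add: add_nonneg_pos)
      obtain N where N: "\<And>m n. m \<ge> N \<Longrightarrow> n \<ge> N \<Longrightarrow> cmod (D m x h - D n x h) \<le> e / (norm h + 1) * norm h"
        using Dd[OF e'] x by blast
      have "e / (norm h + 1) * norm h < e"
      proof -
        have p: "0 < norm h + 1" by (simp add: add_nonneg_pos)
        have "e * norm h < e * (norm h + 1)" using e by simp
        then have "e * norm h / (norm h + 1) < e" by (simp only: pos_divide_less_eq[OF p])
        then show ?thesis by simp
      qed
      then show "\<exists>M. \<forall>m\<ge>M. \<forall>n\<ge>M. norm (D m x h - D n x h) < e" using N by (meson le_less_trans)
    qed
    then show ?thesis unfolding D'_def by (simp add: Cauchy_convergent convergent_LIMSEQ_iff[symmetric])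
  qed
  have unif: "\<forall>\<^sub>F n in sequentially. \<forall>x\<in>S. \<forall>h. norm (D n x h - D' x h) \<le> e * norm h" if e: "e > 0" for e
  proof -
    obtain N where N: "\<And>m n x h. m \<ge> N \<Longrightarrow> n \<ge> N \<Longrightarrow> x \<in> S \<Longrightarrow> cmod (D m x h - D n x h) \<le> e * norm h"
      using Dd[OF e] by blast
    have "norm (D n x h - D' x h) \<le> e * norm h" if "n \<ge> N" "x \<in> S" for n x h
    proof (rule tendsto_upperbound)
      show "(\<lambda>m. cmod (D n x h - D m x h)) \<longlonglongrightarrow> norm (D n x h - D' x h)"
        by (intro tendsto_intros D'_lim that)
      show "\<forall>\<^sub>F m in sequentially. cmod (D n x h - D m x h) \<le> e * norm h"
        unfolding eventually_sequentially using N that by blast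
    qed simp
    then show ?thesis unfolding eventually_sequentially by blast
  qed
  have zS: "z \<in> S" using r by (simp add: S_def)
  have "\<exists>g. \<forall>x\<in>S. (\<lambda>n. f n x) \<longlonglongrightarrow> g x \<and> (g has_derivative D' x) (at x within S)"
  proof (rule has_derivative_sequence[where f = f and f' = D, OF _ _ _ zS lim[OF z]])
    show "\<forall>\<^sub>F n in sequentially. \<forall>x\<in>S. \<forall>h. norm (D n x h - D' x h) \<le> e * norm h" if "e > 0" for e
      by (rule unif[OF that])
    show "convex S" by (simp add: S_def)
    show "(f n has_derivative D n x) (at x within S)" if "x \<in> S" for n x
      using D[OF SA[OF that]] by (rule has_derivative_at_withinI)
  qed
  then obtain g where g: "\<And>x. x \<in> S \<Longrightarrow> (\<lambda>n. f n x) \<longlonglongrightarrow> g x"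
    "\<And>x. x \<in> S \<Longrightarrow> (g has_derivative D' x) (at x within S)" by blast
  have gF: "g x = F x" if "x \<in> S" for x
    using LIMSEQ_unique[OF g(1)[OF that] lim[OF SA[OF that]]] .
  have openS: "open S" by (simp add: S_def)
  have "(g has_derivative D' z) (at z)" using g(2)[OF zS] at_within_open[OF zS openS] by simp
  then have "(F has_derivative D' z) (at z)"
    by (rule has_derivative_transform_within_open[OF _ openS zS]) (use gF in auto)
  moreover have "D' z (c *s v) = c * D' z v" for c v
  proof (rule LIMSEQ_unique[OF D'_lim[OF zS]])
    show "(\<lambda>n. D n z (c *s v)) \<longlonglongrightarrow> c * D' z v"
      unfolding D_lin[OF z] by (intro tendsto_intros D'_lim zS)
  qed
  ultimately show "\<exists>f'. (F has_derivative f') (at z) \<and> (\<forall>c v. f' (c *s v) = c * f' v)" by blast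
qed

section \<open>The gliding hump\<close>

context convex_patch
begin

lemma away_mono: "away \<eta> z \<Longrightarrow> \<eta>' \<le> \<eta> \<Longrightarrow> away \<eta>' z"
  by (force simp: away_def)

text \<open>Applied to the finitely many spikes of one stage: the distance \<open>\<eta>\<close>
  obtained here protects the values at them from all later stages.\<close>

lemma finite_away:
  assumes "finite A" "A \<subseteq> \<Omega>"
  obtains \<eta> where "0 < \<eta>" "\<And>z. z \<in> A \<Longrightarrow> away \<eta> z"
proof -
  have "\<exists>\<eta>>0. \<forall>z\<in>A. away \<eta> z" using assms
  proof (induction A)
    case empty
    then show ?case by (auto intro: exI[of _ 1])
  next
    case (insert z A)
    then obtain \<eta> where e: "0 < \<eta>" "\<And>z. z \<in> A \<Longrightarrow> away \<eta> z" by auto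
    obtain r where r: "0 < r" "ball z r \<subseteq> \<Omega>" using insert open_\<Omega> openE by blast
    have "away r z" unfolding away_def
    proof
      fix \<zeta> assume "\<zeta> \<in> S"
      then have "\<zeta> \<notin> ball z r" using r disj by auto
      then show "r \<le> norm (\<zeta> - z)" by (simp add: dist_norm norm_minus_commute)
    qed
    then have "away (min r \<eta>) z" by (rule away_mono) simp
    moreover have "away (min r \<eta>) x" if "x \<in> A" for x using away_mono[OF e(2)[OF that]] by simp
    ultimately show ?case using r e by (intro exI[of _ "min r \<eta>"]) auto
  qed
  then show ?thesis using that by blast
qed

text \<open>A gliding hump. Each stage prescribes 0 or 1 at new spikes so close to \<open>S\<close>
  that the function barely changes on points that are \<open>\<eta>\<close>-away from it; then
  \<open>\<eta>\<close> is lowered until the new spikes are away as well. Since \<open>K\<close> is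
  known before \<open>\<delta>\<close> is picked, \<open>\<delta>\<close> can be taken so small that
  \<open>K \<le> k \<delta>\<close>.\<close>

lemma oscillating_function_exists:
  fixes k :: "real \<Rightarrow> real"
  assumes k: "filterlim k at_top (at_right 0)"
    and \<delta>0: "0 < \<delta>0" "\<And>\<delta> \<zeta>. 0 < \<delta> \<Longrightarrow> \<delta> < \<delta>0 \<Longrightarrow> \<zeta> \<in> S \<Longrightarrow> spike \<delta> \<zeta> \<in> \<Omega>"
  obtains f where "holomorphic_c2 f \<Omega>" "bounded (f ` \<Omega>)"
    "\<And>w n. w \<in> S \<Longrightarrow> \<exists>\<delta> \<zeta>. 0 < \<delta> \<and> \<delta> < (1/2) ^ n \<and> \<delta> < \<delta>0 \<and> \<zeta> \<in> S \<and> cmod (P \<zeta> w) \<le> k \<delta> * \<delta> \<and>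
       cmod (f (spike \<delta> \<zeta>) - of_bool (odd n)) \<le> 2 * (1/2) ^ n"
proof -
  \<comment> \<open>A state consists of the current function, its safety distance, and the height
    and base points of the spikes used to reach it. The bound \<open>2 - (1/2) ^ n\<close> keeps
    just enough room for all later growth.\<close>
  define Pr where "Pr n = (\<lambda>(f :: c2 \<Rightarrow> complex, \<eta> :: real, \<delta> :: real, T :: c2 set).
    holomorphic_c2 f \<Omega> \<and> (\<forall>z\<in>\<Omega>. cmod (f z) \<le> 2 - (1/2) ^ n) \<and> 0 < \<eta> \<and> \<eta> \<le> (1/2) ^ n)" for n :: nat
  define Qr where "Qr n = (\<lambda>(f :: c2 \<Rightarrow> complex, \<eta> :: real, \<delta> :: real, T :: c2 set) (f' :: c2 \<Rightarrow> complex, \<eta>' :: real, \<delta>' :: real, T' :: c2 set).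
    \<eta>' \<le> \<eta> \<and> 0 < \<delta>' \<and> \<delta>' < (1/2) ^ n \<and> \<delta>' < \<delta>0 \<and> T' \<subseteq> S \<and>
    (\<forall>w\<in>S. \<exists>\<zeta>\<in>T'. cmod (P \<zeta> w) \<le> k \<delta>' * \<delta>') \<and>
    (\<forall>z\<in>\<Omega>. away \<eta> z \<longrightarrow> cmod (f' z - f z) \<le> (1/2) ^ n) \<and>
    (\<forall>\<zeta>\<in>T'. cmod (f' (spike \<delta>' \<zeta>) - of_bool (odd n)) \<le> (1/2) ^ n \<and> away \<eta>' (spike \<delta>' \<zeta>)))" for n :: nat
  have "\<exists>s. \<forall>n. Pr n (s n) \<and> Qr n (s n) (s (Suc n))"
  proof (rule dependent_nat_choice)
    show "\<exists>x. Pr 0 x"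
      by (rule exI[of _ "(\<lambda>z. 0, 1, 1, {})"]) (simp add: Pr_def holomorphic_c2_const)
  next
    fix x n assume Px: "Pr n x"
    obtain f \<eta> d0 T0 where x: "x = (f, \<eta>, d0, T0)" by (cases x)
    have f: "holomorphic_c2 f \<Omega>" and fB: "\<And>z. z \<in> \<Omega> \<Longrightarrow> cmod (f z) \<le> 2 - (1/2) ^ n"
      and eta: "0 < \<eta>" "\<eta> \<le> (1/2) ^ n"
      using Px unfolding Pr_def x by auto
    \<comment> \<open>A quarter of \<open>(1/2) ^ n\<close>. Values move by at most
      \<open>3 * \<kappa>\<close>, since \<open>c - f z\<close> has modulus at most 3, and the sup
      bound grows by at most \<open>2 * \<kappa>\<close>, which is exactly the room set aside for
      this stage.\<close>
    define \<kappa> :: real where "\<kappa> = (1/2) ^ (n + 2)"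
    define c :: complex where "c = of_bool (odd n)"
    have kap: "0 < \<kappa>" "4 * \<kappa> = (1/2) ^ n" by (auto simp: \<kappa>_def)
    have c1: "cmod c \<le> 1" by (simp add: c_def)
    obtain K where K: "0 \<le> K"
      "\<exists>\<delta>1>0. \<forall>\<delta>. 0 < \<delta> \<and> \<delta> < \<delta>1 \<longrightarrow> (\<exists>F T. peaks \<kappa> \<eta> \<delta> K F T \<and> (\<forall>z\<in>\<Omega>. cmod (F z) + cmod (1 - F z) \<le> 1 + \<kappa>))"
      using spike_function_exists[OF kap(1)] eta(1) by metis
    obtain \<delta>1 where d1: "0 < \<delta>1" and ex: "\<And>\<delta>. 0 < \<delta> \<Longrightarrow> \<delta> < \<delta>1 \<Longrightarrow> \<exists>F T. peaks \<kappa> \<eta> \<delta> K F T \<and> (\<forall>z\<in>\<Omega>. cmod (F z) + cmod (1 - F z) \<le> 1 + \<kappa>)" using K(2) by blast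
    have "\<forall>\<^sub>F \<delta> in at_right 0. K \<le> k \<delta>" using k unfolding filterlim_at_top by blast
    then obtain b where b: "0 < b" "\<And>\<delta>. 0 < \<delta> \<Longrightarrow> \<delta> < b \<Longrightarrow> K \<le> k \<delta>"
      unfolding eventually_at_right_field by blast
    define \<delta> where "\<delta> = min (min \<delta>1 b) (min \<delta>0 ((1/2) ^ n)) / 2"
    have "0 < min (min \<delta>1 b) (min \<delta>0 ((1/2) ^ n))" using d1 b \<delta>0 by simp
    then have d: "0 < \<delta>" "\<delta> < \<delta>1" "\<delta> < b" "\<delta> < \<delta>0" "\<delta> < (1/2) ^ n"
      unfolding \<delta>_def by linarith+
    obtain F T where T: "T \<subseteq> S" "finite T" and F: "holomorphic_c2 F \<Omega>"
       and F1: "\<And>z. z \<in> \<Omega> \<Longrightarrow> cmod (F z) + cmod (1 - F z) \<le> 1 + \<kappa>"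
       and F2: "\<And>z. z \<in> \<Omega> \<Longrightarrow> away \<eta> z \<Longrightarrow> cmod (F z) \<le> \<kappa>"
       and F3: "\<And>\<zeta>. \<zeta> \<in> T \<Longrightarrow> spike \<delta> \<zeta> \<in> \<Omega> \<Longrightarrow> cmod (F (spike \<delta> \<zeta>) - 1) \<le> \<kappa>"
       and cover: "\<And>w. w \<in> S \<Longrightarrow> \<exists>\<zeta>\<in>T. cmod (P \<zeta> w) \<le> K * \<delta>"
      using ex[OF d(1,2)] unfolding peaks_def by blast
    have sp: "spike \<delta> \<zeta> \<in> \<Omega>" if "\<zeta> \<in> T" for \<zeta> using \<delta>0(2)[OF d(1,4)] that T by auto
    obtain \<eta>1 where e1: "0 < \<eta>1" "\<And>z. z \<in> spike \<delta> ` T \<Longrightarrow> away \<eta>1 z"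
      using finite_away[of "spike \<delta> ` T"] T sp by auto
    \<comment> \<open>Halving drives the safety distances to 0, so that every point of the domain is
      eventually away from \<open>S\<close> in the sense of all later stages.\<close>
    define \<eta>' where "\<eta>' = min \<eta>1 (\<eta> / 2)"
    define f' where "f' z = (1 + (- 1) * F z) * f z + F z * c" for z
    have hol: "holomorphic_c2 f' \<Omega>" unfolding f'_def
      by (intro holomorphic_c2_add holomorphic_c2_mult holomorphic_c2_const F f)
    have B: "2 - (1/2) ^ n \<ge> (1::real)" using power_le_one[of "1/2::real" n] by simp
    have diff: "cmod (c - f z) \<le> 3" if "z \<in> \<Omega>" for z
    proof -
      have "(0::real) \<le> (1/2) ^ n" by simp
      then show ?thesis using norm_triangle_ineq4[of c "f z"] fB[OF that] c1 by linarith
    qed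
    have "Pr (Suc n) (f', \<eta>', \<delta>, T)"
      unfolding Pr_def
    proof (simp only: split_conv, intro conjI ballI hol)
      show "0 < \<eta>'" using e1 eta by (simp add: \<eta>'_def)
      show "\<eta>' \<le> (1/2) ^ Suc n" using eta by (simp add: \<eta>'_def)
      fix z assume z: "z \<in> \<Omega>"
      let ?b = "2 - (1/2) ^ n :: real"
      have "cmod (f' z) \<le> cmod (1 - F z) * cmod (f z) + cmod (F z) * cmod c"
        unfolding f'_def by (rule order_trans[OF norm_triangle_ineq]) (simp add: norm_mult)
      also have "\<dots> \<le> cmod (1 - F z) * ?b + cmod (F z) * ?b"
        using fB[OF z] c1 B by (intro add_mono mult_left_mono) auto
      also have "\<dots> = (cmod (F z) + cmod (1 - F z)) * ?b" by (simp add: algebra_simps)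
      also have "\<dots> \<le> (1 + \<kappa>) * ?b" using F1[OF z] B by (intro mult_right_mono) auto
      also have "\<dots> = ?b + \<kappa> * ?b" by (simp add: algebra_simps)
      also have "\<dots> \<le> ?b + \<kappa> * 2" using kap by (intro add_left_mono mult_left_mono) auto
      also have "\<dots> = 2 - (1/2) ^ Suc n" by (simp add: \<kappa>_def)
      finally show "cmod (f' z) \<le> 2 - (1/2) ^ Suc n" .
    qed
    moreover have "Qr n x (f', \<eta>', \<delta>, T)"
      unfolding Qr_def x
    proof (simp only: split_conv, intro conjI ballI impI)
      show "\<eta>' \<le> \<eta>" using eta by (simp add: \<eta>'_def)
      show "\<exists>\<zeta>\<in>T. cmod (P \<zeta> w) \<le> k \<delta> * \<delta>" if "w \<in> S" for w
        using cover[OF that] mult_right_mono[OF b(2)[OF d(1,3)], of \<delta>] d(1) by (meson less_imp_le order_trans)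
      show "cmod (f' z - f z) \<le> (1/2) ^ n" if z: "z \<in> \<Omega>" "away \<eta> z" for z
      proof -
        have "f' z - f z = F z * (c - f z)" by (simp add: f'_def algebra_simps)
        then have "cmod (f' z - f z) \<le> \<kappa> * 3"
          unfolding norm_mult using F2[OF z] diff[OF z(1)] kap by (simp only: norm_mult) (intro mult_mono, auto)
        then show ?thesis using kap by linarith
      qed
      fix \<zeta> assume zT: "\<zeta> \<in> T"
      let ?z = "spike \<delta> \<zeta>"
      have "f' ?z - c = (F ?z - 1) * (c - f ?z)" by (simp add: f'_def algebra_simps)
      then have "cmod (f' ?z - c) \<le> \<kappa> * 3"
        using F3[OF zT sp[OF zT]] diff[OF sp[OF zT]] kap
        by (simp only: norm_mult) (intro mult_mono, auto)
      then show "cmod (f' ?z - of_bool (odd n)) \<le> (1/2) ^ n" using kap unfolding c_def by linarith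
      show "away \<eta>' ?z" using e1(2)[of ?z] zT by (auto intro: away_mono simp: \<eta>'_def)
    qed (use d T in auto)
    ultimately show "\<exists>y. Pr (Suc n) y \<and> Qr n x y" by blast
  qed
  then obtain s where s: "\<And>n. Pr n (s n)" "\<And>n. Qr n (s n) (s (Suc n))" by blast
  define f where "f n = fst (s n)" for n
  define \<eta> where "\<eta> n = fst (snd (s n))" for n
  define \<delta> where "\<delta> n = fst (snd (snd (s n)))" for n
  define T where "T n = snd (snd (snd (s n)))" for n
  have Pn: "holomorphic_c2 (f n) \<Omega> \<and> (\<forall>z\<in>\<Omega>. cmod (f n z) \<le> 2 - (1/2) ^ n) \<and> 0 < \<eta> n \<and> \<eta> n \<le> (1/2) ^ n" for n
    using s(1)[of n] unfolding Pr_def f_def \<eta>_def by (simp add: case_prod_beta)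
  have Qn: "\<eta> (Suc n) \<le> \<eta> n" "0 < \<delta> (Suc n)" "\<delta> (Suc n) < (1/2) ^ n" "\<delta> (Suc n) < \<delta>0" "T (Suc n) \<subseteq> S"
    "\<And>w. w \<in> S \<Longrightarrow> \<exists>\<zeta>\<in>T (Suc n). cmod (P \<zeta> w) \<le> k (\<delta> (Suc n)) * \<delta> (Suc n)"
    "\<And>z. z \<in> \<Omega> \<Longrightarrow> away (\<eta> n) z \<Longrightarrow> cmod (f (Suc n) z - f n z) \<le> (1/2) ^ n"
    "\<And>\<zeta>. \<zeta> \<in> T (Suc n) \<Longrightarrow> cmod (f (Suc n) (spike (\<delta> (Suc n)) \<zeta>) - of_bool (odd n)) \<le> (1/2) ^ n"
    "\<And>\<zeta>. \<zeta> \<in> T (Suc n) \<Longrightarrow> away (\<eta> (Suc n)) (spike (\<delta> (Suc n)) \<zeta>)" for n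
    using s(2)[of n] unfolding Qr_def f_def \<eta>_def \<delta>_def T_def by (simp_all add: case_prod_beta)
  have eta_mono: "\<eta> m \<le> \<eta> n" if "n \<le> m" for n m
    using that by (rule lift_Suc_antimono_le[of \<eta>, OF Qn(1)])
  have tail: "cmod (f m z - f n z) \<le> 2 * (1/2) ^ n - 2 * (1/2) ^ m"
    if "n \<le> m" and z: "z \<in> \<Omega>" "away (\<eta> n) z" for m n z
    using \<open>n \<le> m\<close>
  proof (induction m rule: dec_induct)
    case (step m)
    have "cmod (f (Suc m) z - f m z) \<le> (1/2) ^ m"
      using Qn(7)[OF z(1) away_mono[OF z(2) eta_mono[OF step(1)]]] .
    then show ?case using norm_triangle_ineq[of "f (Suc m) z - f m z" "f m z - f n z"] step by simp
  qed simp
  have tail2: "cmod (f m z - f n z) \<le> 4 * (1/2) ^ N"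
    if "N \<le> m" "N \<le> n" and z: "z \<in> \<Omega>" "away (\<eta> N) z" for m n N z
  proof -
    have "(0::real) \<le> (1/2) ^ m" "(0::real) \<le> (1/2) ^ n" by simp_all
    moreover have "cmod (f m z - f n z) \<le> cmod (f m z - f N z) + cmod (f n z - f N z)"
      using norm_triangle_ineq4[of "f m z - f N z" "f n z - f N z"] by simp
    ultimately show ?thesis using tail[OF that(1) z] tail[OF that(2) z] by linarith
  qed
  have small: "\<exists>N. 4 * (1/2) ^ N < e" if "e > 0" for e :: real
    using real_arch_pow_inv[of "e / 4" "1/2"] that by (auto simp: field_simps)
  \<comment> \<open>A small closed ball in the domain keeps a positive distance from
    \<open>S\<close>, and the safety distances drop below it. This gives locally uniform convergence
    on the whole domain.\<close>
  have ev_away: "\<exists>r>0. cball z r \<subseteq> \<Omega> \<and> (\<exists>N. \<forall>x\<in>cball z r. \<forall>n\<ge>N. away (\<eta> n) x)" if z: "z \<in> \<Omega>" for z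
  proof -
    obtain r where r: "0 < r" "cball z r \<subseteq> \<Omega>" using z open_\<Omega> open_contains_cball by blast
    obtain N where N: "4 * (1/2) ^ N < r / 2" using small[of "r / 2"] r by auto
    have "away (\<eta> n) x" if x: "x \<in> cball z (r / 2)" and n: "n \<ge> N" for x n
      unfolding away_def
    proof
      fix \<zeta> assume "\<zeta> \<in> S"
      then have "\<zeta> \<notin> cball z r" using r disj by auto
      then have "r < dist z \<zeta>" by simp
      moreover have "dist z \<zeta> \<le> dist z x + dist x \<zeta>" by (rule dist_triangle)
      ultimately have "r / 2 \<le> dist x \<zeta>" using x by simp
      moreover have "\<eta> n \<le> (1/2) ^ N" using eta_mono[OF n] Pn[of N] by linarith
      moreover have "(0::real) \<le> (1/2) ^ N" by simp
      ultimately have "\<eta> n \<le> dist x \<zeta>" using N by linarith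
      then show "\<eta> n \<le> norm (\<zeta> - x)" by (simp add: dist_norm norm_minus_commute)
    qed
    moreover have "cball z (r / 2) \<subseteq> \<Omega>" using r subset_cball[of "r / 2" r z] by auto
    moreover have "0 < r / 2" using r by simp
    ultimately show ?thesis by blast
  qed
  have unif: "\<exists>r>0. cball z r \<subseteq> \<Omega> \<and>
      (\<forall>e>0. \<exists>N. \<forall>m\<ge>N. \<forall>n\<ge>N. \<forall>x\<in>cball z r. cmod (f m x - f n x) \<le> e)" if z: "z \<in> \<Omega>" for z
  proof -
    obtain r N where r: "0 < r" "cball z r \<subseteq> \<Omega>" and N: "\<And>x n. x \<in> cball z r \<Longrightarrow> n \<ge> N \<Longrightarrow> away (\<eta> n) x"
      using ev_away[OF z] by blast
    have "\<exists>N. \<forall>m\<ge>N. \<forall>n\<ge>N. \<forall>x\<in>cball z r. cmod (f m x - f n x) \<le> e" if e: "e > 0" for e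
    proof -
      obtain M where M: "4 * (1/2) ^ M < e" using small[OF e] by blast
      have "cmod (f m x - f n x) \<le> e" if "max M N \<le> m" "max M N \<le> n" "x \<in> cball z r" for m n x
      proof -
        have "cmod (f m x - f n x) \<le> 4 * (1/2) ^ max M N"
          using tail2[OF that(1,2)] N[OF that(3)] that r by auto
        also have "\<dots> \<le> 4 * (1/2) ^ M" by (simp add: power_decreasing)
        finally show ?thesis using M by linarith
      qed
      then show ?thesis by blast
    qed
    then show ?thesis using r by blast
  qed
  define F where "F z = lim (\<lambda>n. f n z)" for z
  have F: "(\<lambda>n. f n z) \<longlonglongrightarrow> F z" if z: "z \<in> \<Omega>" for z
  proof -
    have "Cauchy (\<lambda>n. f n z)"
    proof (rule CauchyI)
      fix e :: real assume e: "0 < e"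
      then have "0 < e / 2" by simp
      then obtain N where N: "\<And>m n. m \<ge> N \<Longrightarrow> n \<ge> N \<Longrightarrow> cmod (f m z - f n z) \<le> e / 2"
        using unif[OF z] by (metis centre_in_cball less_imp_le)
      then have "\<And>m n. m \<ge> N \<Longrightarrow> n \<ge> N \<Longrightarrow> cmod (f m z - f n z) < e" using e by fastforce
      then show "\<exists>M. \<forall>m\<ge>M. \<forall>n\<ge>M. norm (f m z - f n z) < e" by blast
    qed
    then show ?thesis unfolding F_def by (simp add: Cauchy_convergent convergent_LIMSEQ_iff[symmetric])
  qed
  show ?thesis
  proof
    show "holomorphic_c2 F \<Omega>" by (rule holomorphic_c2_limit[OF _ F unif]) (use Pn in auto)
    have "cmod (F z) \<le> 2" if z: "z \<in> \<Omega>" for z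
    proof (rule tendsto_upperbound[OF tendsto_norm[OF F[OF z]]])
      have "cmod (f n z) \<le> 2" for n
      proof -
        have "(0::real) \<le> (1/2) ^ n" by simp
        moreover have "cmod (f n z) \<le> 2 - (1/2) ^ n" using Pn z by blast
        ultimately show ?thesis by linarith
      qed
      then show "\<forall>\<^sub>F n in sequentially. cmod (f n z) \<le> 2" by simp
    qed simp
    then show "bounded (F ` \<Omega>)" by (auto simp: bounded_iff)
    fix w n assume w: "w \<in> S"
    obtain \<zeta> where z: "\<zeta> \<in> T (Suc n)" "cmod (P \<zeta> w) \<le> k (\<delta> (Suc n)) * \<delta> (Suc n)" using Qn(6)[OF w] by blast
    let ?z = "spike (\<delta> (Suc n)) \<zeta>"
    have zS: "\<zeta> \<in> S" using z Qn(5) by auto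
    have mem: "?z \<in> \<Omega>" by (rule \<delta>0(2)[OF Qn(2) Qn(4) zS])
    \<comment> \<open>The spikes of stage \<open>n\<close> are away with respect to
      \<open>\<eta> (Suc n)\<close>, so the tail starts at index \<open>Suc n\<close> and
      contributes \<open>2 * (1/2) ^ Suc n\<close>, that is \<open>(1/2) ^ n\<close>.\<close>
    have "cmod (F ?z - f (Suc n) ?z) \<le> (1/2) ^ n"
    proof (rule tendsto_upperbound)
      show "(\<lambda>m. cmod (f m ?z - f (Suc n) ?z)) \<longlonglongrightarrow> cmod (F ?z - f (Suc n) ?z)"
        by (intro tendsto_intros F mem)
      have "cmod (f m ?z - f (Suc n) ?z) \<le> (1/2) ^ n" if "m \<ge> Suc n" for m
      proof -
        have "(0::real) \<le> (1/2) ^ m" by simp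
        moreover have "cmod (f m ?z - f (Suc n) ?z) \<le> 2 * (1/2) ^ Suc n - 2 * (1/2) ^ m"
          by (rule tail[OF that mem Qn(9)[OF z(1)]])
        moreover have "2 * (1/2) ^ Suc n = ((1/2) ^ n :: real)" by simp
        ultimately show ?thesis by linarith
      qed
      then show "\<forall>\<^sub>F m in sequentially. cmod (f m ?z - f (Suc n) ?z) \<le> (1/2) ^ n"
        unfolding eventually_sequentially by blast
    qed simp
    then have "cmod (F ?z - of_bool (odd n)) \<le> 2 * (1/2) ^ n"
      using Qn(8)[OF z(1)] norm_triangle_ineq[of "F ?z - f (Suc n) ?z" "f (Suc n) ?z - of_bool (odd n)"] by simp
    then show "\<exists>\<delta> \<zeta>. 0 < \<delta> \<and> \<delta> < (1/2) ^ n \<and> \<delta> < \<delta>0 \<and> \<zeta> \<in> S \<and> cmod (P \<zeta> w) \<le> k \<delta> * \<delta> \<and>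
       cmod (F (spike \<delta> \<zeta>) - of_bool (odd n)) \<le> 2 * (1/2) ^ n"
      using Qn(2,3,4)[of n] zS z(2) by blast
  qed
qed

end

section \<open>Second derivatives\<close>

lemma frechet_derivative_cong_open:
  assumes "open S" "x \<in> S" "\<And>y. y \<in> S \<Longrightarrow> f y = g y"
  shows "frechet_derivative f (at x) = frechet_derivative g (at x)"
    and "f differentiable (at x) \<longleftrightarrow> g differentiable (at x)"
proof -
  have eq: "(f has_derivative D) (at x) \<longleftrightarrow> (g has_derivative D) (at x)" for D
    using has_derivative_transform_within_open[OF _ assms(1,2)] assms(3) by metis
  then show "frechet_derivative f (at x) = frechet_derivative g (at x)"
    by (simp add: frechet_derivative_def)
  show "f differentiable (at x) \<longleftrightarrow> g differentiable (at x)"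
    by (simp add: differentiable_def eq)
qed

lemma has_derivative_imp_frechet: "(f has_derivative D) (at x) \<Longrightarrow> frechet_derivative f (at x) = D"
  using frechet_derivative_at by metis

lemma Ck_on_cong:
  assumes "open S" "\<And>y. y \<in> S \<Longrightarrow> f y = g y"
  shows "Ck_on k S f \<longleftrightarrow> Ck_on k S g"
  using assms(2)
proof (induction k arbitrary: f g)
  case 0
  then show ?case by simp
next
  case (Suc k)
  have "Ck_on k S (\<lambda>x. frechet_derivative f (at x) v) \<longleftrightarrow> Ck_on k S (\<lambda>x. frechet_derivative g (at x) v)" for v
    by (rule Suc.IH) (metis frechet_derivative_cong_open(1)[OF assms(1)] Suc.prems)
  moreover have "f differentiable (at x) \<longleftrightarrow> g differentiable (at x)" if "x \<in> S" for x
    using frechet_derivative_cong_open(2)[OF assms(1) that] Suc.prems by metis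
  ultimately show ?case by simp
qed

lemma Ck_on_Suc_imp: "Ck_on (Suc k) S f \<Longrightarrow> Ck_on k S f"
proof (induction k arbitrary: f)
  case 0
  then show ?case
    by (simp add: differentiable_imp_continuous_on differentiable_at_imp_differentiable_on)
next
  case (Suc k)
  then show ?case by (metis Ck_on.simps(2))
qed

lemma Ck_on_const: "Ck_on k S (\<lambda>x. c)"
  by (induction k arbitrary: c) simp_all

lemma Ck_on_bounded_linear:
  assumes "open S" "bounded_linear h" "Ck_on k S f"
  shows "Ck_on k S (\<lambda>x. h (f x))"
  using assms(3)
proof (induction k arbitrary: f)
  case 0
  then show ?case using bounded_linear.continuous_on[OF assms(2)] by simp
next
  case (Suc k)
  have d: "((\<lambda>x. h (f x)) has_derivative (\<lambda>v. h (frechet_derivative f (at x) v))) (at x)" if "x \<in> S" for x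
    using Suc.prems that
    by (intro bounded_linear.has_derivative[OF assms(2)]) (simp add: frechet_derivative_works[symmetric])
  have "Ck_on k S (\<lambda>x. frechet_derivative (\<lambda>x. h (f x)) (at x) v)" for v
    by (subst Ck_on_cong[OF assms(1), where g = "\<lambda>x. h (frechet_derivative f (at x) v)"])
      (use has_derivative_imp_frechet[OF d] Suc in auto)
  then show ?case using d by (auto simp: differentiable_def)
qed

lemma Ck_on_add:
  assumes "open S" "Ck_on k S f" "Ck_on k S g"
  shows "Ck_on k S (\<lambda>x. f x + g x)"
  using assms(2,3)
proof (induction k arbitrary: f g)
  case 0
  then show ?case by (simp add: continuous_on_add)
next
  case (Suc k)
  have d: "((\<lambda>x. f x + g x) has_derivative (\<lambda>v. frechet_derivative f (at x) v + frechet_derivative g (at x) v)) (at x)"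
    if "x \<in> S" for x
    using Suc.prems that by (intro has_derivative_add) (auto simp: frechet_derivative_works[symmetric])
  have "Ck_on k S (\<lambda>x. frechet_derivative (\<lambda>x. f x + g x) (at x) v)" for v
    by (subst Ck_on_cong[OF assms(1), where g = "\<lambda>x. frechet_derivative f (at x) v + frechet_derivative g (at x) v"])
      (use has_derivative_imp_frechet[OF d] Suc in auto)
  then show ?case using d by (auto simp: differentiable_def)
qed

lemma Ck_on_mult:
  fixes f g :: "'a::real_normed_vector \<Rightarrow> 'b::real_normed_algebra"
  assumes "open S" "Ck_on k S f" "Ck_on k S g"
  shows "Ck_on k S (\<lambda>x. f x * g x)"
  using assms(2,3)
proof (induction k arbitrary: f g)
  case 0
  then show ?case by (simp add: continuous_on_mult)
next
  case (Suc k)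
  let ?D = "\<lambda>x v. f x * frechet_derivative g (at x) v + frechet_derivative f (at x) v * g x"
  have d: "((\<lambda>x. f x * g x) has_derivative ?D x) (at x)" if "x \<in> S" for x
    using Suc.prems that by (intro has_derivative_mult) (auto simp: frechet_derivative_works[symmetric])
  have "Ck_on k S (\<lambda>x. ?D x v)" for v
    using Suc.prems by (intro Ck_on_add Suc.IH assms(1)) (auto intro: Ck_on_Suc_imp)
  then have "Ck_on k S (\<lambda>x. frechet_derivative (\<lambda>x. f x * g x) (at x) v)" for v
    by (subst Ck_on_cong[OF assms(1), where g = "\<lambda>x. ?D x v"])
      (use has_derivative_imp_frechet[OF d] in auto)
  then show ?case using d by (auto simp: differentiable_def)
qed

text \<open>The second direction \<open>w\<close> is the one differentiated last.
  \<open>Ck_on\<close> controls derivatives only for one fixed choice of directions, so bilinearity,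
  symmetry and continuity uniform in the directions are derived below.\<close>

definition hess :: "('a::real_normed_vector \<Rightarrow> 'b::real_normed_vector) \<Rightarrow> 'a \<Rightarrow> 'a \<Rightarrow> 'a \<Rightarrow> 'b" where
  "hess f x v w = frechet_derivative (\<lambda>y. frechet_derivative f (at y) v) (at x) w"

lemma C2_derivatives:
  assumes "Ck_on 2 S f" "x \<in> S"
  shows "(f has_derivative frechet_derivative f (at x)) (at x)"
    and "((\<lambda>y. frechet_derivative f (at y) v) has_derivative hess f x v) (at x)"
    and "continuous_on S (\<lambda>x. hess f x v w)"
  using assms unfolding hess_def numeral_2_eq_2 by (auto simp: frechet_derivative_works[symmetric])

text \<open>Linearity in \<open>w\<close> is that of a derivative. Linearity in \<open>v\<close>
  comes from differentiating the expansion of the first derivative in basis directions, which holds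
  on all of the open set \<open>S\<close>.\<close>

lemma hess_expand:
  fixes f :: "'a::euclidean_space \<Rightarrow> 'b::real_normed_vector"
  assumes S: "open S" and f: "Ck_on 2 S f" and x: "x \<in> S"
  shows "hess f x v w = (\<Sum>b\<in>Basis. \<Sum>b'\<in>Basis. ((v \<bullet> b) * (w \<bullet> b')) *\<^sub>R hess f x b b')"
proof -
  have lin: "linear (hess f x u)" for u
    using C2_derivatives(2)[OF f x] has_derivative_linear by blast
  have lin1: "frechet_derivative f (at y) v = (\<Sum>b\<in>Basis. (v \<bullet> b) *\<^sub>R frechet_derivative f (at y) b)"
    if y: "y \<in> S" for y
  proof -
    have l: "linear (frechet_derivative f (at y))"
      using C2_derivatives(1)[OF f y] has_derivative_linear by blast
    have "frechet_derivative f (at y) (\<Sum>b\<in>Basis. (v \<bullet> b) *\<^sub>R b)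
        = (\<Sum>b\<in>Basis. (v \<bullet> b) *\<^sub>R frechet_derivative f (at y) b)"
      by (simp only: linear_sum[OF l] linear_scale[OF l])
    then show ?thesis by (simp only: euclidean_representation)
  qed
  have "((\<lambda>y. frechet_derivative f (at y) v) has_derivative (\<lambda>w. \<Sum>b\<in>Basis. (v \<bullet> b) *\<^sub>R hess f x b w)) (at x)"
  proof (rule has_derivative_transform_within_open[OF _ S x])
    show "((\<lambda>y. \<Sum>b\<in>Basis. (v \<bullet> b) *\<^sub>R frechet_derivative f (at y) b) has_derivative
        (\<lambda>w. \<Sum>b\<in>Basis. (v \<bullet> b) *\<^sub>R hess f x b w)) (at x)"
      by (intro has_derivative_sum has_derivative_scaleR_right C2_derivatives(2)[OF f x])
  qed (simp add: lin1)
  then have "hess f x v w = (\<Sum>b\<in>Basis. (v \<bullet> b) *\<^sub>R hess f x b w)"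
    using has_derivative_unique[OF C2_derivatives(2)[OF f x]] by metis
  also have "\<dots> = (\<Sum>b\<in>Basis. (v \<bullet> b) *\<^sub>R (\<Sum>b'\<in>Basis. (w \<bullet> b') *\<^sub>R hess f x b b'))"
  proof (intro sum.cong refl)
    fix b
    have "hess f x b (\<Sum>b'\<in>Basis. (w \<bullet> b') *\<^sub>R b') = (\<Sum>b'\<in>Basis. (w \<bullet> b') *\<^sub>R hess f x b b')"
      by (simp only: linear_sum[OF lin] linear_scale[OF lin])
    then show "(v \<bullet> b) *\<^sub>R hess f x b w = (v \<bullet> b) *\<^sub>R (\<Sum>b'\<in>Basis. (w \<bullet> b') *\<^sub>R hess f x b b')"
      by (simp only: euclidean_representation)
  qed
  finally show ?thesis by (simp add: scaleR_sum_right)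
qed

lemma sum_basis_le:
  fixes v w :: "'a::euclidean_space" and a :: "'a \<Rightarrow> 'a \<Rightarrow> 'b::real_normed_vector"
  assumes "\<And>b b'. b \<in> Basis \<Longrightarrow> b' \<in> Basis \<Longrightarrow> norm (a b b') \<le> e" "0 \<le> e"
  shows "norm (\<Sum>b\<in>Basis. \<Sum>b'\<in>Basis. ((v \<bullet> b) * (w \<bullet> b')) *\<^sub>R a b b')
    \<le> real (DIM('a)) ^ 2 * e * norm v * norm w"
proof -
  have "norm (\<Sum>b\<in>Basis. \<Sum>b'\<in>Basis. ((v \<bullet> b) * (w \<bullet> b')) *\<^sub>R a b b')
    \<le> (\<Sum>b\<in>(Basis::'a set). \<Sum>b'\<in>(Basis::'a set). norm v * norm w * e)"
  proof (intro sum_norm_le)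
    fix b b' :: 'a assume b: "b \<in> Basis" "b' \<in> Basis"
    have "\<bar>v \<bullet> b\<bar> * \<bar>w \<bullet> b'\<bar> * norm (a b b') \<le> norm v * norm w * e"
      using assms b by (intro mult_mono Basis_le_norm) auto
    then show "norm (((v \<bullet> b) * (w \<bullet> b')) *\<^sub>R a b b') \<le> norm v * norm w * e" by (simp add: abs_mult)
  qed
  then show ?thesis by (simp add: power2_eq_square mult_ac)
qed

text \<open>Continuity is known for the finitely many entries on basis vectors; one radius serves
  all of them, and the expansion costs the squared dimension.\<close>

lemma hess_continuous:
  fixes f :: "'a::euclidean_space \<Rightarrow> 'b::real_normed_vector"
  assumes S: "open S" and f: "Ck_on 2 S f" and p: "p \<in> S" and e: "0 < e"
  obtains r where "0 < r" "ball p r \<subseteq> S"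
    "\<And>x v w. x \<in> ball p r \<Longrightarrow> norm (hess f x v w - hess f p v w) \<le> e * norm v * norm w"
proof -
  define e' where "e' = e / real (DIM('a)) ^ 2"
  have e': "0 < e'" using e by (simp add: e'_def)
  have "\<forall>\<^sub>F x in nhds p. x \<in> S \<and> (\<forall>b\<in>Basis. \<forall>b'\<in>Basis. norm (hess f x b b' - hess f p b b') < e')"
  proof (intro eventually_conj eventually_ball_finite ballI finite_Basis)
    show "\<forall>\<^sub>F x in nhds p. x \<in> S" using S p by (rule eventually_nhds_in_open)
    fix b b' :: 'a
    have "isCont (\<lambda>x. hess f x b b') p"
      using C2_derivatives(3)[OF f p] S p continuous_on_eq_continuous_at by blast
    then have "((\<lambda>x. hess f x b b') \<longlongrightarrow> hess f p b b') (nhds p)"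
      by (simp add: isCont_def tendsto_at_iff_tendsto_nhds[of "\<lambda>x. hess f x b b'"])
    then show "\<forall>\<^sub>F x in nhds p. norm (hess f x b b' - hess f p b b') < e'"
      using e' by (auto simp: tendsto_iff dist_norm)
  qed
  then obtain r where r: "0 < r" "\<And>x. dist x p < r \<Longrightarrow> x \<in> S"
    "\<And>x b b'. dist x p < r \<Longrightarrow> b \<in> Basis \<Longrightarrow> b' \<in> Basis \<Longrightarrow> norm (hess f x b b' - hess f p b b') < e'"
    unfolding eventually_nhds_metric by blast
  show ?thesis
  proof
    show "0 < r" by fact
    show "ball p r \<subseteq> S" using r(2) by (auto simp: dist_commute)
    fix x v w assume x: "x \<in> ball p r"
    then have xS: "x \<in> S" using r by (simp add: dist_commute)
    have "hess f x v w - hess f p v w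
      = (\<Sum>b\<in>Basis. \<Sum>b'\<in>Basis. ((v \<bullet> b) * (w \<bullet> b')) *\<^sub>R (hess f x b b' - hess f p b b'))"
      unfolding hess_expand[OF S f xS, of v w] hess_expand[OF S f p, of v w]
      by (simp add: sum_subtractf scaleR_diff_right)
    also have "norm \<dots> \<le> real (DIM('a)) ^ 2 * e' * norm v * norm w"
      using r(3)[of x] x e' by (intro sum_basis_le) (auto simp: dist_commute intro: less_imp_le)
    finally show "norm (hess f x v w - hess f p v w) \<le> e * norm v * norm w" by (simp add: e'_def)
  qed
qed

lemma hess_bounded:
  fixes f :: "'a::euclidean_space \<Rightarrow> 'b::real_normed_vector"
  assumes S: "open S" and f: "Ck_on 2 S f" and p: "p \<in> S"
  obtains B where "0 \<le> B" "\<And>v w. norm (hess f p v w) \<le> B * norm v * norm w"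
proof -
  define M where "M = (\<Sum>b\<in>Basis. \<Sum>b'\<in>Basis. norm (hess f p b b'))"
  have M0: "0 \<le> M" unfolding M_def by (intro sum_nonneg) auto
  have M: "norm (hess f p b b') \<le> M" if "b \<in> Basis" "b' \<in> Basis" for b b'
  proof -
    have "norm (hess f p b b') \<le> (\<Sum>b'\<in>Basis. norm (hess f p b b'))"
      by (rule member_le_sum[OF that(2)]) auto
    also have "\<dots> \<le> M" unfolding M_def by (rule member_le_sum[OF that(1)]) (auto intro: sum_nonneg)
    finally show ?thesis .
  qed
  show ?thesis
  proof
    show "0 \<le> real (DIM('a)) ^ 2 * M" using M0 by simp
    show "norm (hess f p v w) \<le> real (DIM('a)) ^ 2 * M * norm v * norm w" for v w
      unfolding hess_expand[OF S f p, of v w] by (rule sum_basis_le) (use M M0 in auto)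
  qed
qed

text \<open>Stated for vector-valued \<open>f\<close> because it serves both the defining function
  and the complex-valued polarization on the product space.\<close>

lemma C2_local_bounds:
  fixes f :: "'a::euclidean_space \<Rightarrow> 'b::real_normed_vector"
  assumes S: "open S" and f: "Ck_on 2 S f" and p: "p \<in> S"
  obtains r B where "0 < r" "0 \<le> B" "ball p r \<subseteq> S"
    "\<And>x y v. x \<in> ball p r \<Longrightarrow> y \<in> ball p r \<Longrightarrow>
      norm (frechet_derivative f (at y) v - frechet_derivative f (at x) v) \<le> B * norm (y - x) * norm v"
    "\<And>x y. x \<in> ball p r \<Longrightarrow> y \<in> ball p r \<Longrightarrow>
      norm (f y - f x - frechet_derivative f (at x) (y - x)) \<le> B * (norm (y - x))\<^sup>2"
proof -
  let ?D = "\<lambda>x. frechet_derivative f (at x)"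
  obtain r where r: "0 < r" "ball p r \<subseteq> S"
    "\<And>x v w. x \<in> ball p r \<Longrightarrow> norm (hess f x v w - hess f p v w) \<le> 1 * norm v * norm w"
    using hess_continuous[OF S f p, of 1] by auto
  obtain B0 where B0: "0 \<le> B0" "\<And>v w. norm (hess f p v w) \<le> B0 * norm v * norm w"
    using hess_bounded[OF S f p] by blast
  define B where "B = B0 + 1"
  have B: "norm (hess f x v w) \<le> B * norm v * norm w" if "x \<in> ball p r" for x v w
    using r(3)[OF that, of v w] B0(2)[of v w] norm_triangle_sub[of "hess f x v w" "hess f p v w"]
    by (simp add: B_def algebra_simps)
  have b1: "norm (?D y v - ?D x v) \<le> B * norm (y - x) * norm v" if "x \<in> ball p r" "y \<in> ball p r" for x y v
  proof -
    have "norm (?D y v - ?D x v) \<le> (B * norm v) * norm (y - x)"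
    proof (rule differentiable_bound[where S = "ball p r" and f' = "\<lambda>z. hess f z v"])
      fix z assume z: "z \<in> ball p r"
      then have zS: "z \<in> S" using r by auto
      show "((\<lambda>y. ?D y v) has_derivative hess f z v) (at z within ball p r)"
        using C2_derivatives(2)[OF f zS] by (rule has_derivative_at_withinI)
      show "onorm (hess f z v) \<le> B * norm v" by (rule onorm_le) (use B[OF z] in simp)
    qed (use that in auto)
    then show ?thesis by (simp add: mult_ac)
  qed
  show ?thesis
  proof
    show "0 < r" "ball p r \<subseteq> S" by fact+
    show "0 \<le> B" using B0 by (simp add: B_def)
    show "norm (?D y v - ?D x v) \<le> B * norm (y - x) * norm v" if "x \<in> ball p r" "y \<in> ball p r" for x y v
      by (rule b1[OF that])
    fix x y assume xy: "x \<in> ball p r" "y \<in> ball p r"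
    have seg: "closed_segment x y \<subseteq> ball p r" using xy by (simp add: closed_segment_subset)
    have xS: "x \<in> S" using xy r by auto
    have lin: "bounded_linear (?D x)" using C2_derivatives(1)[OF f xS] by (rule has_derivative_bounded_linear)
    have "norm ((f y - ?D x y) - (f x - ?D x x)) \<le> (B * norm (y - x)) * norm (y - x)"
    proof (rule differentiable_bound[where S = "closed_segment x y" and f' = "\<lambda>z v. ?D z v - ?D x v"])
      fix z assume z: "z \<in> closed_segment x y"
      then have zb: "z \<in> ball p r" and zS: "z \<in> S" using seg r by auto
      show "((\<lambda>z. f z - ?D x z) has_derivative (\<lambda>v. ?D z v - ?D x v)) (at z within closed_segment x y)"
        by (rule has_derivative_at_withinI)
          (rule has_derivative_diff[OF C2_derivatives(1)[OF f zS] bounded_linear_imp_has_derivative[OF lin]])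
      have zx: "norm (z - x) \<le> norm (y - x)" using segment_bound1[OF z] by (simp add: norm_minus_commute)
      show "onorm (\<lambda>v. ?D z v - ?D x v) \<le> B * norm (y - x)"
      proof (rule onorm_le)
        fix v
        have "norm (?D z v - ?D x v) \<le> B * norm (z - x) * norm v" by (rule b1[OF xy(1) zb])
        also have "\<dots> \<le> B * norm (y - x) * norm v"
          using zx B0 by (intro mult_right_mono mult_left_mono) (auto simp: B_def)
        finally show "norm (?D z v - ?D x v) \<le> B * norm (y - x) * norm v" .
      qed
    qed auto
    then show "norm (f y - f x - ?D x (y - x)) \<le> B * (norm (y - x))\<^sup>2"
      by (simp add: linear_diff[OF bounded_linear.linear[OF lin]] power2_eq_square algebra_simps)
  qed
qed

text \<open>The mean value theorem twice, first along \<open>v\<close> and then along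
  \<open>w\<close>. The left-hand side is symmetric in \<open>v\<close> and \<open>w\<close>, so
  comparing the two orders as \<open>h\<close> shrinks with the radius yields symmetry of the
  Hessian.\<close>

lemma second_difference:
  fixes f :: "'a::euclidean_space \<Rightarrow> real"
  assumes S: "open S" and f: "Ck_on 2 S f" and r: "ball p r \<subseteq> S" and h: "0 < h" "h * (norm v + norm w) < r"
  shows "\<exists>q\<in>ball p r. f (p + h *\<^sub>R v + h *\<^sub>R w) - f (p + h *\<^sub>R v) - f (p + h *\<^sub>R w) + f p = h\<^sup>2 * hess f q v w"
proof -
  let ?D = "\<lambda>x. frechet_derivative f (at x)"
  have mem: "p + s *\<^sub>R v + t *\<^sub>R w \<in> ball p r" if "0 \<le> s" "s \<le> h" "0 \<le> t" "t \<le> h" for s t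
  proof -
    have "norm (s *\<^sub>R v + t *\<^sub>R w) \<le> s * norm v + t * norm w"
      using norm_triangle_ineq[of "s *\<^sub>R v" "t *\<^sub>R w"] that by simp
    also have "\<dots> \<le> h * norm v + h * norm w" using that by (intro add_mono mult_right_mono) auto
    also have "\<dots> < r" using h by (simp add: algebra_simps)
    finally have "norm (- (s *\<^sub>R v + t *\<^sub>R w)) < r" by (simp only: norm_minus_cancel)
    moreover have "p - (p + s *\<^sub>R v + t *\<^sub>R w) = - (s *\<^sub>R v + t *\<^sub>R w)" by simp
    ultimately show ?thesis by (simp only: mem_ball dist_norm)
  qed
  have memS: "p + s *\<^sub>R v + t *\<^sub>R w \<in> S" if "0 \<le> s" "s \<le> h" "0 \<le> t" "t \<le> h" for s t
    using mem[OF that] r by auto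
  define \<phi> where "\<phi> s = f (p + s *\<^sub>R v + h *\<^sub>R w) - f (p + s *\<^sub>R v + 0 *\<^sub>R w)" for s
  have line: "((\<lambda>s. f (p + s *\<^sub>R v + t *\<^sub>R w)) has_real_derivative ?D (p + s *\<^sub>R v + t *\<^sub>R w) v) (at s)"
    if "0 \<le> s" "s \<le> h" "0 \<le> t" "t \<le> h" for s t
  proof -
    have d: "((\<lambda>s. p + s *\<^sub>R v + t *\<^sub>R w) has_derivative (\<lambda>s. s *\<^sub>R v)) (at s)"
      by (auto intro!: derivative_eq_intros)
    have "((\<lambda>s. f (p + s *\<^sub>R v + t *\<^sub>R w)) has_derivative (\<lambda>x. ?D (p + s *\<^sub>R v + t *\<^sub>R w) (x *\<^sub>R v))) (at s)"
      using has_derivative_compose[OF d C2_derivatives(1)[OF f memS[OF that]]] by simp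
    moreover have "linear (?D (p + s *\<^sub>R v + t *\<^sub>R w))"
      using C2_derivatives(1)[OF f memS[OF that]] has_derivative_linear by blast
    ultimately show ?thesis unfolding has_field_derivative_def
      by (simp add: linear_scale mult.commute[of _ "?D (p + s *\<^sub>R v + t *\<^sub>R w) v"])
  qed
  have "\<exists>s>0. s < h \<and> \<phi> h - \<phi> 0 = (h - 0) * (?D (p + s *\<^sub>R v + h *\<^sub>R w) v - ?D (p + s *\<^sub>R v + 0 *\<^sub>R w) v)"
    unfolding \<phi>_def using h by (intro MVT2 DERIV_diff line) auto
  then obtain s where s: "0 < s" "s < h" "\<phi> h - \<phi> 0 = h * (?D (p + s *\<^sub>R v + h *\<^sub>R w) v - ?D (p + s *\<^sub>R v + 0 *\<^sub>R w) v)"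
    by auto
  have "\<exists>t>0. t < h \<and> ?D (p + s *\<^sub>R v + h *\<^sub>R w) v - ?D (p + s *\<^sub>R v + 0 *\<^sub>R w) v = (h - 0) * hess f (p + s *\<^sub>R v + t *\<^sub>R w) v w"
  proof (rule MVT2[OF h(1)])
    fix t assume t: "0 \<le> t" "t \<le> h"
    have m: "p + s *\<^sub>R v + t *\<^sub>R w \<in> S" using memS[of s t] s t by auto
    have d: "((\<lambda>t. p + s *\<^sub>R v + t *\<^sub>R w) has_derivative (\<lambda>t. t *\<^sub>R w)) (at t)"
      by (auto intro!: derivative_eq_intros)
    have "((\<lambda>t. ?D (p + s *\<^sub>R v + t *\<^sub>R w) v) has_derivative (\<lambda>x. hess f (p + s *\<^sub>R v + t *\<^sub>R w) v (x *\<^sub>R w))) (at t)"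
      using has_derivative_compose[OF d C2_derivatives(2)[OF f m]] by simp
    moreover have "linear (hess f (p + s *\<^sub>R v + t *\<^sub>R w) v)"
      using C2_derivatives(2)[OF f m] has_derivative_linear by blast
    ultimately show "((\<lambda>t. ?D (p + s *\<^sub>R v + t *\<^sub>R w) v) has_real_derivative hess f (p + s *\<^sub>R v + t *\<^sub>R w) v w) (at t)"
      unfolding has_field_derivative_def
      by (simp add: linear_scale mult.commute[of _ "hess f (p + s *\<^sub>R v + t *\<^sub>R w) v w"])
  qed
  then obtain t where t: "0 < t" "t < h"
    "?D (p + s *\<^sub>R v + h *\<^sub>R w) v - ?D (p + s *\<^sub>R v + 0 *\<^sub>R w) v = h * hess f (p + s *\<^sub>R v + t *\<^sub>R w) v w"
    by auto
  have "f (p + h *\<^sub>R v + h *\<^sub>R w) - f (p + h *\<^sub>R v) - f (p + h *\<^sub>R w) + f p = \<phi> h - \<phi> 0"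
    by (simp add: \<phi>_def)
  also have "\<dots> = h\<^sup>2 * hess f (p + s *\<^sub>R v + t *\<^sub>R w) v w"
    unfolding s(3) t(3) by (simp add: power2_eq_square)
  finally show ?thesis using mem[of s t] s t by auto
qed

lemma hess_symmetric:
  fixes f :: "'a::euclidean_space \<Rightarrow> real"
  assumes S: "open S" and f: "Ck_on 2 S f" and p: "p \<in> S"
  shows "hess f p v w = hess f p w v"
proof -
  have "\<bar>hess f p v w - hess f p w v\<bar> \<le> 0 + e" if e: "0 < e" for e
  proof -
    define N where "N = 2 * (norm v * norm w + 1)"
    have N: "0 < N" unfolding N_def by (simp add: add_nonneg_pos)
    have eN: "0 < e / N" using e N by simp
    obtain r where r: "0 < r" "ball p r \<subseteq> S"
      and c: "\<And>x v w. x \<in> ball p r \<Longrightarrow> norm (hess f x v w - hess f p v w) \<le> e / N * norm v * norm w"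
      using hess_continuous[OF S f p eN] by blast
    define h where "h = r / (norm v + norm w + 1)"
    have pos: "0 < norm v + norm w + 1" by (simp add: add_nonneg_pos)
    have h: "0 < h" using r pos by (simp add: h_def)
    have "h * (norm v + norm w) < h * (norm v + norm w + 1)" using h by simp
    then have h2: "h * (norm v + norm w) < r" using pos by (simp add: h_def)
    obtain q where q: "q \<in> ball p r"
      "f (p + h *\<^sub>R v + h *\<^sub>R w) - f (p + h *\<^sub>R v) - f (p + h *\<^sub>R w) + f p = h\<^sup>2 * hess f q v w"
      using second_difference[OF S f r(2) h h2] by blast
    have h3: "h * (norm w + norm v) < r" using h2 by (simp add: add.commute)
    obtain q' where q': "q' \<in> ball p r"
      "f (p + h *\<^sub>R w + h *\<^sub>R v) - f (p + h *\<^sub>R w) - f (p + h *\<^sub>R v) + f p = h\<^sup>2 * hess f q' w v"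
      using second_difference[OF S f r(2) h h3] by blast
    have comm: "p + h *\<^sub>R w + h *\<^sub>R v = p + h *\<^sub>R v + h *\<^sub>R w" by (simp add: add_ac)
    have "h\<^sup>2 * hess f q v w = h\<^sup>2 * hess f q' w v"
      unfolding q(2)[symmetric] q'(2)[symmetric] comm by simp
    then have "hess f q v w = hess f q' w v" using h by simp
    then have "\<bar>hess f p v w - hess f p w v\<bar> \<le> 2 * (e / N * norm v * norm w)"
    proof -
      have "\<bar>hess f q' w v - hess f p w v\<bar> \<le> e / N * norm v * norm w"
        using c[OF q'(1), of w v] by (simp add: mult_ac)
      moreover have "\<bar>hess f q v w - hess f p v w\<bar> \<le> e / N * norm v * norm w"
        using c[OF q(1), of v w] by simp
      ultimately show ?thesis using \<open>hess f q v w = hess f q' w v\<close> by linarith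
    qed
    also have "\<dots> \<le> e / N * N" 
    proof -
      have "2 * (a * m * n) \<le> a * (2 * (m * n + 1))" if "0 < a" for a m n :: real
        using that by (simp add: algebra_simps)
      from this[OF eN, of "norm v" "norm w"] show ?thesis unfolding N_def[symmetric] .
    qed
    also have "\<dots> = e" using N by simp
    finally show ?thesis by simp
  qed
  then have "\<bar>hess f p v w - hess f p w v\<bar> \<le> 0" by (rule field_le_epsilon)
  then show ?thesis by simp
qed

lemma taylor_hess:
  fixes f :: "'a::euclidean_space \<Rightarrow> real"
  assumes f: "Ck_on 2 S f" and seg: "closed_segment x y \<subseteq> S"
  obtains z where "z \<in> closed_segment x y"
    "f y = f x + frechet_derivative f (at x) (y - x) + hess f z (y - x) (y - x) / 2"
proof -
  let ?D = "\<lambda>x. frechet_derivative f (at x)"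
  define v where "v = y - x"
  define diff where "diff m t = (if m = 0 then f (x + t *\<^sub>R v) else if m = 1 then ?D (x + t *\<^sub>R v) v
    else hess f (x + t *\<^sub>R v) v v)" for m :: nat and t :: real
  have mem: "x + t *\<^sub>R v \<in> closed_segment x y" if "0 \<le> t" "t \<le> 1" for t
    using that unfolding closed_segment_def v_def by (intro CollectI exI[of _ t]) (auto simp: algebra_simps)
  have "\<exists>t>0. t < 1 \<and> diff 0 1 = (\<Sum>m<2. diff m 0 / fact m * 1 ^ m) + diff 2 t / fact 2 * 1 ^ 2"
  proof (rule Maclaurin)
    show "\<forall>m t. m < 2 \<and> 0 \<le> t \<and> t \<le> 1 \<longrightarrow> DERIV (diff m) t :> diff (Suc m) t"
    proof (intro allI impI)
      fix m :: nat and t :: real assume mt: "m < 2 \<and> 0 \<le> t \<and> t \<le> 1"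
      then have m: "x + t *\<^sub>R v \<in> S" using mem[of t] seg by auto
      have d: "((\<lambda>t. x + t *\<^sub>R v) has_derivative (\<lambda>t. t *\<^sub>R v)) (at t)"
        by (auto intro!: derivative_eq_intros)
      have "((\<lambda>t. ?D (x + t *\<^sub>R v) v) has_derivative (\<lambda>s. hess f (x + t *\<^sub>R v) v (s *\<^sub>R v))) (at t)"
        using has_derivative_compose[OF d C2_derivatives(2)[OF f m]] by simp
      moreover have "linear (hess f (x + t *\<^sub>R v) v)"
        using C2_derivatives(2)[OF f m] has_derivative_linear by blast
      ultimately have 2: "((\<lambda>t. ?D (x + t *\<^sub>R v) v) has_real_derivative hess f (x + t *\<^sub>R v) v v) (at t)"
        unfolding has_field_derivative_def
        by (simp add: linear_scale mult.commute[of _ "hess f (x + t *\<^sub>R v) v v"])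
      have "((\<lambda>t. f (x + t *\<^sub>R v)) has_derivative (\<lambda>s. ?D (x + t *\<^sub>R v) (s *\<^sub>R v))) (at t)"
        using has_derivative_compose[OF d C2_derivatives(1)[OF f m]] by simp
      moreover have "linear (?D (x + t *\<^sub>R v))"
        using C2_derivatives(1)[OF f m] has_derivative_linear by blast
      ultimately have 1: "((\<lambda>t. f (x + t *\<^sub>R v)) has_real_derivative ?D (x + t *\<^sub>R v) v) (at t)"
        unfolding has_field_derivative_def
        by (simp add: linear_scale mult.commute[of _ "?D (x + t *\<^sub>R v) v"])
      from mt consider "m = 0" | "m = 1" by linarith
      then show "DERIV (diff m) t :> diff (Suc m) t"
        by cases (use 1 2 in \<open>simp_all add: diff_def[abs_def]\<close>)
    qed
  qed auto
  moreover have "(\<Sum>m<2. diff m 0 / fact m * 1 ^ m) = diff 0 0 + diff 1 0"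
    by (simp add: numeral_2_eq_2)
  ultimately obtain t where "0 < t" "t < 1" "diff 0 1 = diff 0 0 + diff 1 0 + diff 2 t / 2"
    by auto
  then show ?thesis using that[of "x + t *\<^sub>R v"] mem[of t] by (simp add: diff_def v_def)
qed

section \<open>Domains touching the unit sphere\<close>

definition grad :: "('a::euclidean_space \<Rightarrow> real) \<Rightarrow> 'a \<Rightarrow> 'a" where
  "grad f x = (\<Sum>b\<in>Basis. frechet_derivative f (at x) b *\<^sub>R b)"

lemma grad_inner:
  assumes "(f has_derivative frechet_derivative f (at x)) (at x)"
  shows "frechet_derivative f (at x) v = grad f x \<bullet> v"
proof -
  have l: "linear (frechet_derivative f (at x))" using assms has_derivative_linear by blast
  have "frechet_derivative f (at x) (\<Sum>b\<in>Basis. (v \<bullet> b) *\<^sub>R b) = (\<Sum>b\<in>Basis. (v \<bullet> b) * frechet_derivative f (at x) b)"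
    by (simp only: linear_sum[OF l] linear_scale[OF l] real_scaleR_def)
  then have "frechet_derivative f (at x) v = (\<Sum>b\<in>Basis. (v \<bullet> b) * frechet_derivative f (at x) b)"
    by (simp only: euclidean_representation)
  then show ?thesis by (simp add: grad_def inner_sum_left inner_commute[of v] mult.commute)
qed

lemma hess_linear:
  fixes f :: "'a::euclidean_space \<Rightarrow> real"
  assumes "open S" "Ck_on 2 S f" "x \<in> S"
  shows "hess f x v (a *\<^sub>R w + b *\<^sub>R w') = a * hess f x v w + b * hess f x v w'"
    and "hess f x (a *\<^sub>R w + b *\<^sub>R w') v = a * hess f x w v + b * hess f x w' v"
proof -
  have l: "linear (hess f x u)" for u
    using C2_derivatives(2)[OF assms(2,3)] has_derivative_linear by blast
  show 1: "hess f x v (a *\<^sub>R w + b *\<^sub>R w') = a * hess f x v w + b * hess f x v w'" for v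
    by (simp add: linear_add[OF l] linear_scale[OF l])
  show "hess f x (a *\<^sub>R w + b *\<^sub>R w') v = a * hess f x w v + b * hess f x w' v"
    using 1[of v] hess_symmetric[OF assms, of "a *\<^sub>R w + b *\<^sub>R w'" v]
      hess_symmetric[OF assms, of w v] hess_symmetric[OF assms, of w' v] by simp
qed

locale touching_domain =
  fixes \<Omega> U :: "c2 set" and \<rho> :: "c2 \<Rightarrow> real" and p :: c2 and c :: real
  assumes open_\<Omega>: "open \<Omega>"
    and def_fun: "defining_function \<rho> U \<Omega>"
    and norm_le_1: "z \<in> \<Omega> \<Longrightarrow> norm z \<le> 1"
    and p_frontier: "p \<in> frontier \<Omega>"
    and norm_p: "norm p = 1"
    and c: "0 < c"
    and normal: "frechet_derivative \<rho> (at p) = (\<lambda>v. c * (p \<bullet> v))"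
begin

lemma U: "open U" "frontier \<Omega> \<subseteq> U" "p \<in> U" and C2: "Ck_on 2 U \<rho>" and \<Omega>_iff: "z \<in> U \<Longrightarrow> z \<in> \<Omega> \<longleftrightarrow> \<rho> z < 0"
  using def_fun p_frontier by (auto simp: defining_function_def smooth_on_def)

lemma deriv_\<rho>: "z \<in> U \<Longrightarrow> (\<rho> has_derivative frechet_derivative \<rho> (at z)) (at z)"
  using C2_derivatives(1)[OF C2] .

lemma deriv_grad: "z \<in> U \<Longrightarrow> frechet_derivative \<rho> (at z) v = grad \<rho> z \<bullet> v"
  by (rule grad_inner[OF deriv_\<rho>])

lemma norm_frontier: "z \<in> frontier \<Omega> \<Longrightarrow> norm z \<le> 1"
proof -
  assume "z \<in> frontier \<Omega>"
  then have "z \<in> closure \<Omega>" by (simp add: frontier_def)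
  moreover have "closure \<Omega> \<subseteq> cball 0 1" using norm_le_1 by (intro closure_minimal) auto
  ultimately show ?thesis by auto
qed

lemma frontier_disjoint: "z \<in> frontier \<Omega> \<Longrightarrow> z \<notin> \<Omega>"
  using open_\<Omega> by (simp add: frontier_def interior_open)

lemma \<rho>_frontier: "z \<in> frontier \<Omega> \<Longrightarrow> \<rho> z = 0"
proof (rule ccontr)
  assume z: "z \<in> frontier \<Omega>" and ne: "\<rho> z \<noteq> 0"
  have zU: "z \<in> U" using z U by auto
  have "\<not> \<rho> z < 0" using frontier_disjoint[OF z] \<Omega>_iff[OF zU] by simp
  then have pos: "0 < \<rho> z" using ne by simp
  have cont: "continuous (at z) \<rho>" using deriv_\<rho>[OF zU] has_derivative_continuous by blast
  have "\<forall>\<^sub>F x in nhds z. 0 < \<rho> x"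
    using order_tendstoD(1)[OF _ pos, of \<rho> "nhds z"] cont
    by (simp add: isCont_def tendsto_at_iff_tendsto_nhds[of \<rho>])
  moreover have "\<forall>\<^sub>F x in nhds z. x \<in> U" using U(1) zU by (rule eventually_nhds_in_open)
  ultimately have "\<forall>\<^sub>F x in nhds z. x \<notin> \<Omega>"
    by eventually_elim (use \<Omega>_iff in force)
  then obtain W where W: "open W" "z \<in> W" "W \<inter> \<Omega> = {}" unfolding eventually_nhds by blast
  have "z \<in> closure \<Omega>" using z by (simp add: frontier_def)
  then show False using open_Int_closure_eq_empty[OF W(1), of \<Omega>] W by blast
qed

text \<open>Comparison with the sphere: c (|z|^2 - 1) / 2 has the same gradient at \<open>p\<close>,
  and its Hessian form is \<open>c\<close> times the squared norm. If the inequality failed, the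
  parabola \<open>p + t *\<^sub>R v - (s * t ^ 2) *\<^sub>R p\<close> would for small
  \<open>t\<close> lie in the domain and yet outside the unit ball.\<close>

lemma hess_tangent:
  assumes v: "p \<bullet> v = 0"
  shows "c * (norm v)\<^sup>2 \<le> hess \<rho> p v v"
proof (rule ccontr)
  assume "\<not> ?thesis"
  then have lt: "hess \<rho> p v v < c * (norm v)\<^sup>2" by simp
  \<comment> \<open>Thus \<open>2 * s\<close> is the mean of \<open>hess \<rho> p v v / c\<close>
    and the squared norm of \<open>v\<close>, strictly between the two; the parabola bends inwards
    more than the boundary and less than the sphere.\<close>
  define s where "s = (hess \<rho> p v v / c + (norm v)\<^sup>2) / 4"
  define m where "m = c * s"
  have s: "2 * s < (norm v)\<^sup>2" "hess \<rho> p v v < 2 * m"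
    using lt c by (auto simp: s_def m_def field_simps)
  define \<epsilon> where "\<epsilon> = (2 * m - hess \<rho> p v v) / 4"
  have eps: "0 < \<epsilon>" using s by (simp add: \<epsilon>_def)
  obtain B where B: "0 \<le> B" "\<And>v w. norm (hess \<rho> p v w) \<le> B * norm v * norm w"
    using hess_bounded[OF U(1) C2 U(3)] by blast
  define N where "N = (norm v + \<bar>s\<bar>)\<^sup>2 + 1"
  have N: "0 < N" by (simp add: N_def add_nonneg_pos)
  obtain r where r: "0 < r" "ball p r \<subseteq> U"
    and near: "\<And>x v w. x \<in> ball p r \<Longrightarrow> norm (hess \<rho> x v w - hess \<rho> p v w) \<le> \<epsilon> / N * norm v * norm w"
    using hess_continuous[OF U(1) C2 U(3), of "\<epsilon> / N"] eps N by auto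
  \<comment> \<open>For \<open>t \<le> 1\<close>, \<open>t * K\<close> bounds the change of the
    Hessian form at \<open>p\<close> when \<open>v\<close> is replaced by the tilted direction
    \<open>w\<close>.\<close>
  define K where "K = 2 * \<bar>s\<bar> * B * norm v + s\<^sup>2 * B + 1"
  have K: "0 < K" using B by (simp add: K_def add_nonneg_pos)
  define t where "t = min 1 (min (r / (norm v + \<bar>s\<bar> + 1) / 2) (\<epsilon> / K))"
  have nv: "0 < norm v + \<bar>s\<bar> + 1" by (simp add: add_nonneg_pos)
  have t: "0 < t" "t \<le> 1" "t * (norm v + \<bar>s\<bar> + 1) < r" "t * K \<le> \<epsilon>"
  proof -
    show "0 < t" using r eps K nv by (simp add: t_def)
    show "t \<le> 1" by (simp add: t_def)
    have "t \<le> r / (norm v + \<bar>s\<bar> + 1) / 2" by (simp add: t_def)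
    then have "t * (norm v + \<bar>s\<bar> + 1) \<le> r / 2" using nv by (simp add: field_simps)
    then show "t * (norm v + \<bar>s\<bar> + 1) < r" using r by linarith
    have "t \<le> \<epsilon> / K" by (simp add: t_def)
    then show "t * K \<le> \<epsilon>" using K by (simp add: field_simps)
  qed
  define w where "w = v - (s * t) *\<^sub>R p"
  define x where "x = p + t *\<^sub>R w"
  have st: "\<bar>s * t\<bar> \<le> \<bar>s\<bar>" using t mult_left_mono[of t 1 "\<bar>s\<bar>"] by (simp add: abs_mult)
  have w: "norm w \<le> norm v + \<bar>s\<bar>"
    using norm_triangle_ineq4[of v "(s * t) *\<^sub>R p"] st by (simp add: w_def norm_p)
  have xb: "norm (x - p) < r"
  proof -
    have "t * norm w \<le> t * (norm v + \<bar>s\<bar> + 1)" using w t by (intro mult_left_mono) auto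
    moreover have "norm (x - p) = t * norm w" using t by (simp add: x_def)
    ultimately show ?thesis using t by linarith
  qed
  have seg: "closed_segment p x \<subseteq> ball p r"
    using xb r by (intro closed_segment_subset) (auto simp: dist_norm norm_minus_commute)
  obtain z where z: "z \<in> closed_segment p x"
    "\<rho> x = \<rho> p + frechet_derivative \<rho> (at p) (x - p) + hess \<rho> z (x - p) (x - p) / 2"
    using taylor_hess[OF C2, of p x] seg r by blast
  have zb: "z \<in> ball p r" "z \<in> U" using z seg r by auto
  have hz: "hess \<rho> z (x - p) (x - p) = t\<^sup>2 * hess \<rho> z w w"
  proof -
    have "hess \<rho> z (t *\<^sub>R w + 0 *\<^sub>R w) (t *\<^sub>R w + 0 *\<^sub>R w) = t\<^sup>2 * hess \<rho> z w w"
      unfolding hess_linear[OF U(1) C2 zb(2)] by (simp add: power2_eq_square)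
    then show ?thesis by (simp add: x_def)
  qed
  have "hess \<rho> z w w \<le> hess \<rho> p w w + \<epsilon> / N * norm w * norm w"
    using near[OF zb(1), of w w] by (simp add: abs_le_iff)
  also have "\<epsilon> / N * norm w * norm w \<le> \<epsilon>"
  proof -
    have "(norm w)\<^sup>2 \<le> (norm v + \<bar>s\<bar>)\<^sup>2" by (rule power_mono[OF w]) simp
    then have "(norm w)\<^sup>2 \<le> N" unfolding N_def by linarith
    then have "\<epsilon> / N * (norm w)\<^sup>2 \<le> \<epsilon> / N * N" using eps N by (intro mult_left_mono) auto
    then show ?thesis using N by (simp add: power2_eq_square mult.assoc)
  qed
  also have "hess \<rho> p w w \<le> hess \<rho> p v v + t * K"
  proof -
    have weq: "w = 1 *\<^sub>R v + (- (s * t)) *\<^sub>R p" by (simp add: w_def)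
    have "hess \<rho> p w w = hess \<rho> p v v - (s * t) * hess \<rho> p v p - (s * t) * hess \<rho> p p v + (s * t)\<^sup>2 * hess \<rho> p p p"
      unfolding weq hess_linear[OF U(1) C2 U(3)] by (simp add: algebra_simps power2_eq_square)
    moreover have "\<bar>(s * t) * hess \<rho> p v p\<bar> \<le> (\<bar>s\<bar> * t) * (B * norm v)"
      unfolding abs_mult using t B(2)[of v p] norm_p by (intro mult_mono) auto
    moreover have "\<bar>(s * t) * hess \<rho> p p v\<bar> \<le> (\<bar>s\<bar> * t) * (B * norm v)"
      unfolding abs_mult using t B(2)[of p v] norm_p by (intro mult_mono) auto
    moreover have "(s * t)\<^sup>2 * hess \<rho> p p p \<le> (s\<^sup>2 * t) * B"
    proof -
      have "t\<^sup>2 \<le> t" using t by (simp add: power2_eq_square mult_left_le)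
      then have "(s * t)\<^sup>2 \<le> s\<^sup>2 * t" by (simp add: power_mult_distrib mult_left_mono)
      moreover have "hess \<rho> p p p \<le> B" using B(2)[of p p] norm_p by simp
      ultimately have "(s * t)\<^sup>2 * hess \<rho> p p p \<le> (s * t)\<^sup>2 * B" "(s * t)\<^sup>2 * B \<le> (s\<^sup>2 * t) * B"
        using B by (auto intro: mult_left_mono mult_right_mono)
      then show ?thesis by linarith
    qed
    ultimately have "hess \<rho> p w w \<le> hess \<rho> p v v + 2 * ((\<bar>s\<bar> * t) * (B * norm v)) + (s\<^sup>2 * t) * B" by linarith
    also have "\<dots> \<le> hess \<rho> p v v + t * K" using t by (simp add: K_def algebra_simps)
    finally show ?thesis .
  qed
  finally have hess_le: "hess \<rho> z w w \<le> hess \<rho> p v v + 2 * \<epsilon>" using t by linarith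
  have "frechet_derivative \<rho> (at p) (x - p) = - (c * s * t\<^sup>2)"
  proof -
    have "p \<bullet> (x - p) = t * (p \<bullet> v - (s * t) * (p \<bullet> p))" by (simp add: x_def w_def inner_diff_right)
    also have "p \<bullet> p = 1" by (simp add: dot_square_norm norm_p)
    finally show ?thesis using v by (simp add: normal power2_eq_square)
  qed
  then have "\<rho> x = t\<^sup>2 * (hess \<rho> z w w / 2 - c * s)"
    using z(2) \<rho>_frontier[OF p_frontier] hz by (simp add: algebra_simps)
  also have "\<dots> < 0"
  proof (rule mult_pos_neg)
    have "2 * \<epsilon> = m - hess \<rho> p v v / 2" by (simp add: \<epsilon>_def)
    then show "hess \<rho> z w w / 2 - c * s < 0" using hess_le s(2) unfolding m_def[symmetric] by linarith
  qed (use t in simp)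
  finally have neg: "\<rho> x < 0" .
  have "x \<in> ball p r" using xb by (simp add: dist_norm norm_minus_commute)
  then have "x \<in> U" using r by blast
  then have "x \<in> \<Omega>" using \<Omega>_iff neg by simp
  then have "norm x \<le> 1" by (rule norm_le_1)
  then have "(norm x)\<^sup>2 \<le> 1" by (simp add: power_le_one)
  moreover have "(norm x)\<^sup>2 = (1 - s * t\<^sup>2)\<^sup>2 + t\<^sup>2 * (norm v)\<^sup>2"
  proof -
    have "x = (1 - s * t\<^sup>2) *\<^sub>R p + t *\<^sub>R v"
      by (simp add: x_def w_def algebra_simps power2_eq_square)
    moreover have "(a *\<^sub>R p + b *\<^sub>R v) \<bullet> (a *\<^sub>R p + b *\<^sub>R v) = a\<^sup>2 * (p \<bullet> p) + b\<^sup>2 * (v \<bullet> v)" for a b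
      using v by (simp add: inner_add_left inner_add_right inner_commute[of v p] power2_eq_square)
    moreover have "p \<bullet> p = 1" by (simp add: dot_square_norm norm_p)
    ultimately show ?thesis by (simp only: power2_norm_eq_inner)
  qed
  moreover have "(1 - s * t\<^sup>2)\<^sup>2 + t\<^sup>2 * (norm v)\<^sup>2 = 1 + t\<^sup>2 * ((norm v)\<^sup>2 - 2 * s) + (s * t\<^sup>2)\<^sup>2"
    by (simp add: power2_eq_square algebra_simps)
  moreover have "0 < t\<^sup>2 * ((norm v)\<^sup>2 - 2 * s)" using s t by simp
  ultimately show False using zero_le_power2[of "s * t\<^sup>2"] by linarith
qed

text \<open>A form that is positive on the hyperplane orthogonal to \<open>p\<close> becomes
  positive definite after adding a multiple of the squared normal component. Half of the tangential
  bound pays for the cross terms through 2xy \<le> x^2 + y^2, which is the origin of the first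
  summand of \<open>M\<close>.\<close>

lemma hess_convexified:
  obtains M where "0 \<le> M" "\<And>y. c / 2 * (norm y)\<^sup>2 \<le> hess \<rho> p y y + M * (p \<bullet> y)\<^sup>2"
proof -
  obtain B where B: "0 \<le> B" "\<And>v w. norm (hess \<rho> p v w) \<le> B * norm v * norm w"
    using hess_bounded[OF U(1) C2 U(3)] by blast
  define M where "M = 2 * B\<^sup>2 / c + B + c / 2"
  show ?thesis
  proof
    show "0 \<le> M" using B c by (simp add: M_def)
    fix y
    define \<tau> where "\<tau> = p \<bullet> y"
    define v where "v = y - \<tau> *\<^sub>R p"
    have pp: "p \<bullet> p = 1" using norm_p by (simp add: dot_square_norm)
    have v0: "p \<bullet> v = 0" by (simp add: v_def \<tau>_def inner_diff_right pp)
    have yeq: "y = 1 *\<^sub>R v + \<tau> *\<^sub>R p" by (simp add: v_def)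
    have ny: "(norm y)\<^sup>2 = (norm v)\<^sup>2 + \<tau>\<^sup>2"
      unfolding yeq power2_norm_eq_inner
      by (simp add: inner_add_left inner_add_right inner_commute[of v p] v0 pp power2_eq_square)
    have "hess \<rho> p y y = hess \<rho> p v v + \<tau> * hess \<rho> p v p + \<tau> * hess \<rho> p p v + \<tau>\<^sup>2 * hess \<rho> p p p"
      unfolding yeq hess_linear[OF U(1) C2 U(3)] by (simp add: algebra_simps power2_eq_square)
    moreover have "\<bar>\<tau> * hess \<rho> p v p\<bar> \<le> \<bar>\<tau>\<bar> * (B * norm v)" "\<bar>\<tau> * hess \<rho> p p v\<bar> \<le> \<bar>\<tau>\<bar> * (B * norm v)"
      unfolding abs_mult using B(2)[of v p] B(2)[of p v] norm_p by (auto intro!: mult_left_mono)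
    moreover have "\<bar>\<tau>\<^sup>2 * hess \<rho> p p p\<bar> \<le> \<tau>\<^sup>2 * B"
      unfolding abs_mult using B(2)[of p p] norm_p by (auto intro!: mult_left_mono)
    moreover have "2 * (\<bar>\<tau>\<bar> * (B * norm v)) \<le> c / 2 * (norm v)\<^sup>2 + 2 * B\<^sup>2 / c * \<tau>\<^sup>2"
    proof -
      have "0 \<le> (c * norm v - 2 * B * \<bar>\<tau>\<bar>)\<^sup>2" by simp
      then have "4 * c * B * \<bar>\<tau>\<bar> * norm v \<le> c\<^sup>2 * (norm v)\<^sup>2 + 4 * B\<^sup>2 * \<tau>\<^sup>2"
        by (simp add: power2_diff power_mult_distrib mult_ac)
      then have "(4 * c * B * \<bar>\<tau>\<bar> * norm v) / (2 * c) \<le> (c\<^sup>2 * (norm v)\<^sup>2 + 4 * B\<^sup>2 * \<tau>\<^sup>2) / (2 * c)"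
        using c by (intro divide_right_mono) auto
      then show ?thesis using c by (simp add: add_divide_distrib power2_eq_square mult_ac)
    qed
    ultimately have "c * (norm v)\<^sup>2 - (c / 2 * (norm v)\<^sup>2 + 2 * B\<^sup>2 / c * \<tau>\<^sup>2) - \<tau>\<^sup>2 * B \<le> hess \<rho> p y y"
      using hess_tangent[OF v0] by linarith
    then show "c / 2 * (norm y)\<^sup>2 \<le> hess \<rho> p y y + M * (p \<bullet> y)\<^sup>2"
      unfolding ny \<tau>_def[symmetric] by (simp add: M_def algebra_simps)
  qed
qed

lemma grad_p: "grad \<rho> p = c *\<^sub>R p"
proof (rule vector_eq_rdot[THEN iffD1], rule allI)
  fix v
  show "grad \<rho> p \<bullet> v = (c *\<^sub>R p) \<bullet> v" using deriv_grad[OF U(3), of v] by (simp add: normal)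
qed

lemma grad_bounds:
  obtains r B where "0 < r" "1 \<le> B" "ball p r \<subseteq> U"
    "\<And>x y. x \<in> ball p r \<Longrightarrow> y \<in> ball p r \<Longrightarrow> norm (grad \<rho> y - grad \<rho> x) \<le> B * norm (y - x)"
    "\<And>x y. x \<in> ball p r \<Longrightarrow> y \<in> ball p r \<Longrightarrow> \<bar>\<rho> y - \<rho> x - grad \<rho> x \<bullet> (y - x)\<bar> \<le> B * (norm (y - x))\<^sup>2"
    "\<And>x. x \<in> ball p r \<Longrightarrow> norm (grad \<rho> x) \<le> B"
    "\<And>x. x \<in> ball p r \<Longrightarrow> c / 2 \<le> norm (grad \<rho> x)"
    "\<And>x. x \<in> ball p r \<Longrightarrow> c / 2 \<le> p \<bullet> grad \<rho> x"
proof -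
  obtain r0 B0 where r0: "0 < r0" "0 \<le> B0" "ball p r0 \<subseteq> U"
    and b1: "\<And>x y v. x \<in> ball p r0 \<Longrightarrow> y \<in> ball p r0 \<Longrightarrow>
      norm (frechet_derivative \<rho> (at y) v - frechet_derivative \<rho> (at x) v) \<le> B0 * norm (y - x) * norm v"
    and b2: "\<And>x y. x \<in> ball p r0 \<Longrightarrow> y \<in> ball p r0 \<Longrightarrow>
      norm (\<rho> y - \<rho> x - frechet_derivative \<rho> (at x) (y - x)) \<le> B0 * (norm (y - x))\<^sup>2"
    using C2_local_bounds[OF U(1) C2 U(3)] by blast
  define r where "r = min r0 (min 1 (c / (2 * (B0 + 1))))"
  have r: "0 < r" "r \<le> r0" "r \<le> 1" "B0 * r \<le> c / 2"
  proof -
    show "0 < r" "r \<le> r0" "r \<le> 1" using r0 c by (auto simp: r_def)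
    have "r \<le> c / (2 * (B0 + 1))" by (simp add: r_def)
    then have "r * (2 * (B0 + 1)) \<le> c" using r0 by (simp add: pos_le_divide_eq)
    then show "B0 * r \<le> c / 2" using \<open>0 < r\<close> by (simp add: algebra_simps)
  qed
  have sub: "ball p r \<subseteq> ball p r0" using r by auto
  have lip: "norm (grad \<rho> y - grad \<rho> x) \<le> B0 * norm (y - x)" if xy: "x \<in> ball p r" "y \<in> ball p r" for x y
  proof -
    let ?u = "grad \<rho> y - grad \<rho> x"
    have xy0: "x \<in> ball p r0" "y \<in> ball p r0" using xy sub by auto
    then have xyU: "x \<in> U" "y \<in> U" using r0 by auto
    have "norm ?u * norm ?u = ?u \<bullet> ?u" by (simp add: dot_square_norm power2_eq_square)
    also have "\<dots> = frechet_derivative \<rho> (at y) ?u - frechet_derivative \<rho> (at x) ?u"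
      by (simp add: deriv_grad[OF xyU(1)] deriv_grad[OF xyU(2)] inner_diff_left)
    also have "\<dots> \<le> (B0 * norm (y - x)) * norm ?u"
      using b1[OF xy0, of ?u] by simp
    finally have le: "norm ?u * norm ?u \<le> (B0 * norm (y - x)) * norm ?u" .
    show ?thesis
    proof (cases "0 < norm ?u")
      case True
      show ?thesis by (rule mult_right_le_imp_le[OF le True])
    next
      case False
      then have "norm ?u = 0" by simp
      moreover have "0 \<le> B0 * norm (y - x)" using r0 by simp
      ultimately show ?thesis by linarith
    qed
  qed
  have gp: "norm (grad \<rho> p) = c" using grad_p c norm_p by simp
  have pb: "p \<in> ball p r" using r by simp
  have close: "norm (grad \<rho> x - grad \<rho> p) \<le> c / 2" if "x \<in> ball p r" for x
  proof -
    have "norm (grad \<rho> x - grad \<rho> p) \<le> B0 * norm (x - p)" by (rule lip[OF pb that])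
    also have "\<dots> \<le> B0 * r" using that r0 by (intro mult_left_mono) (auto simp: dist_norm norm_minus_commute)
    finally show ?thesis using r by linarith
  qed
  show ?thesis
  proof
    show "0 < r" "1 \<le> B0 + 2 * c + 1" "ball p r \<subseteq> U" using r r0 c sub by auto
    fix x assume x: "x \<in> ball p r"
    have xU: "x \<in> U" using x sub r0 by auto
    show "norm (grad \<rho> x) \<le> B0 + 2 * c + 1"
      using close[OF x] gp norm_triangle_sub[of "grad \<rho> x" "grad \<rho> p"] r0 c by linarith
    show "c / 2 \<le> norm (grad \<rho> x)"
      using close[OF x] gp norm_triangle_sub[of "grad \<rho> p" "grad \<rho> x"] by (simp add: norm_minus_commute)
    have "p \<bullet> grad \<rho> x = c + p \<bullet> (grad \<rho> x - grad \<rho> p)"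
      by (simp add: inner_diff_right grad_p dot_square_norm norm_p)
    moreover have "\<bar>p \<bullet> (grad \<rho> x - grad \<rho> p)\<bar> \<le> norm p * norm (grad \<rho> x - grad \<rho> p)" by (rule Cauchy_Schwarz_ineq2)
    ultimately show "c / 2 \<le> p \<bullet> grad \<rho> x" using close[OF x] norm_p by (simp add: abs_le_iff)
    fix y assume y: "y \<in> ball p r"
    have "B0 * norm (y - x) \<le> (B0 + 2 * c + 1) * norm (y - x)" using c by (intro mult_right_mono) auto
    then show "norm (grad \<rho> y - grad \<rho> x) \<le> (B0 + 2 * c + 1) * norm (y - x)" using lip[OF x y] by linarith
    have "B0 * (norm (y - x))\<^sup>2 \<le> (B0 + 2 * c + 1) * (norm (y - x))\<^sup>2" using c by (intro mult_right_mono) auto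
    then show "\<bar>\<rho> y - \<rho> x - grad \<rho> x \<bullet> (y - x)\<bar> \<le> (B0 + 2 * c + 1) * (norm (y - x))\<^sup>2"
    proof -
      have "x \<in> ball p r0" "y \<in> ball p r0" using x y sub by blast+
      from b2[OF this] have "\<bar>\<rho> y - \<rho> x - grad \<rho> x \<bullet> (y - x)\<bar> \<le> B0 * (norm (y - x))\<^sup>2"
        by (simp only: deriv_grad[OF xU] real_norm_def)
      then show ?thesis
        using \<open>B0 * (norm (y - x))\<^sup>2 \<le> (B0 + 2 * c + 1) * (norm (y - x))\<^sup>2\<close> by (rule order_trans)
    qed
  qed
qed

lemma p_inner_self: "p \<bullet> p = 1"
  by (simp add: dot_square_norm norm_p)

text \<open>For \<open>z\<close> near \<open>p\<close>, Taylor's formula and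
  \<open>\<rho> z < 0 = \<rho> \<zeta>\<close> bound
  \<open>u = grad \<rho> \<zeta> \<bullet> (\<zeta> - z)\<close> below by half the Hessian form; the
  normal component of \<open>z - \<zeta>\<close> is itself controlled by \<open>u\<close>, so
  \<open>hess_convexified\<close> applies up to a multiple of \<open>u ^ 2\<close>. For
  \<open>z\<close> away from \<open>p\<close>, the unit ball keeps \<open>z\<close> at a fixed depth
  below the tangent plane at \<open>p\<close>, and moving \<open>p\<close> to a nearby
  \<open>\<zeta>\<close> costs at most half of that depth.\<close>

lemma strong_convexity:
  obtains r a where "0 < r" "0 < a"
    "\<And>\<zeta> z. \<zeta> \<in> frontier \<Omega> \<Longrightarrow> \<zeta> \<in> ball p r \<Longrightarrow> z \<in> \<Omega> \<Longrightarrow> a * (norm (\<zeta> - z))\<^sup>2 \<le> grad \<rho> \<zeta> \<bullet> (\<zeta> - z)"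
proof -
  obtain r1 B where r1: "0 < r1" "1 \<le> B" "ball p r1 \<subseteq> U"
    and lip: "\<And>x y. x \<in> ball p r1 \<Longrightarrow> y \<in> ball p r1 \<Longrightarrow> norm (grad \<rho> y - grad \<rho> x) \<le> B * norm (y - x)"
    and gB: "\<And>x. x \<in> ball p r1 \<Longrightarrow> norm (grad \<rho> x) \<le> B"
    using grad_bounds by metis
  obtain M where M: "0 \<le> M" "\<And>y. c / 2 * (norm y)\<^sup>2 \<le> hess \<rho> p y y + M * (p \<bullet> y)\<^sup>2"
    using hess_convexified by blast
  have "0 < c / 4" using c by simp
  then obtain r2 where r2: "0 < r2" "ball p r2 \<subseteq> U"
    and hc: "\<And>x v w. x \<in> ball p r2 \<Longrightarrow> norm (hess \<rho> x v w - hess \<rho> p v w) \<le> c / 4 * norm v * norm w"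
    using hess_continuous[OF U(1) C2 U(3)] by blast
  define M' where "M' = 2 * M / c\<^sup>2"
  have M': "0 \<le> M'" using M c by (simp add: M'_def)
  have pos1: "0 < 8 * (M' * B\<^sup>2 + 1)" and pos2: "0 < 2 * M' * B + 1"
    using M' r1 by (simp_all add: add_nonneg_pos)
  \<comment> \<open>The last two entries make the error from turning the gradient from
    \<open>p\<close> to \<open>\<zeta>\<close> at most \<open>c / 8\<close>, and make
    \<open>M' * \<bar>u\<bar>\<close> at most 1.\<close>
  define R where "R = min (min r1 r2) (min 1 (min (c / (8 * (M' * B\<^sup>2 + 1))) (1 / (2 * M' * B + 1))))"
  have R: "0 < R" "R \<le> r1" "R \<le> r2" "R \<le> 1"
    using r1 r2 c pos1 pos2 by (auto simp: R_def)
  have R2: "M' * B\<^sup>2 * R\<^sup>2 \<le> c / 8"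
  proof -
    have "R \<le> c / (8 * (M' * B\<^sup>2 + 1))" by (simp add: R_def)
    then have "R * (8 * (M' * B\<^sup>2 + 1)) \<le> c" using pos1 by (simp only: pos_le_divide_eq)
    then have "M' * B\<^sup>2 * R \<le> c / 8" using R by (simp add: algebra_simps)
    moreover have "M' * B\<^sup>2 * R\<^sup>2 \<le> M' * B\<^sup>2 * R"
      using R M' by (intro mult_left_mono) (auto simp: power2_eq_square mult_left_le)
    ultimately show ?thesis by linarith
  qed
  have R3: "M' * (2 * B * R) \<le> 1"
  proof -
    have "R \<le> 1 / (2 * M' * B + 1)" by (simp add: R_def)
    then have "R * (2 * M' * B + 1) \<le> 1" using pos2 by (simp only: pos_le_divide_eq)
    then show ?thesis using R by (simp add: algebra_simps)
  qed
  have subR: "ball p R \<subseteq> ball p r1" "ball p R \<subseteq> ball p r2" using R by auto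
  have pR: "p \<in> ball p r1" using r1 by simp
  have local: "c / 24 * (norm (\<zeta> - z))\<^sup>2 \<le> grad \<rho> \<zeta> \<bullet> (\<zeta> - z)"
    if \<zeta>: "\<zeta> \<in> frontier \<Omega>" "\<zeta> \<in> ball p R" and z: "z \<in> \<Omega>" "z \<in> ball p R" for \<zeta> z
  proof -
    define y where "y = z - \<zeta>"
    define u where "u = grad \<rho> \<zeta> \<bullet> (\<zeta> - z)"
    have \<zeta>1: "\<zeta> \<in> ball p r1" using \<zeta> subR by blast
    have zU: "z \<in> U" "\<zeta> \<in> U" using z \<zeta> subR r1 by blast+
    have seg: "closed_segment \<zeta> z \<subseteq> ball p R" using \<zeta> z by (intro closed_segment_subset) auto
    then have "closed_segment \<zeta> z \<subseteq> U" using subR r1 by blast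
    then obtain x where x: "x \<in> closed_segment \<zeta> z"
      "\<rho> z = \<rho> \<zeta> + frechet_derivative \<rho> (at \<zeta>) (z - \<zeta>) + hess \<rho> x (z - \<zeta>) (z - \<zeta>) / 2"
      using taylor_hess[OF C2] by blast
    have uy: "grad \<rho> \<zeta> \<bullet> y = - u" by (simp add: u_def y_def inner_diff_right)
    have "\<rho> z < 0" using \<Omega>_iff[OF zU(1)] z by simp
    then have u_gt: "hess \<rho> x y y / 2 < u"
      using x(2) \<rho>_frontier[OF \<zeta>(1)] uy deriv_grad[OF zU(2), of "z - \<zeta>"] by (simp add: y_def)
    have "x \<in> ball p r2" using x(1) seg subR by blast
    from hc[OF this, of y y] have "\<bar>hess \<rho> x y y - hess \<rho> p y y\<bar> \<le> c / 4 * (norm y)\<^sup>2"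
      by (simp only: real_norm_def power2_eq_square mult.assoc)
    then have h1: "c / 4 * (norm y)\<^sup>2 - M * (p \<bullet> y)\<^sup>2 \<le> hess \<rho> x y y"
      using M(2)[of y] by linarith
    have "M * (p \<bullet> y)\<^sup>2 \<le> M' * u\<^sup>2 + c / 8 * (norm y)\<^sup>2"
    proof -
      define d where "d = (grad \<rho> p - grad \<rho> \<zeta>) \<bullet> y"
      have "\<bar>d\<bar> \<le> norm (grad \<rho> p - grad \<rho> \<zeta>) * norm y" unfolding d_def by (rule Cauchy_Schwarz_ineq2)
      also have "\<dots> \<le> (B * R) * norm y"
      proof (rule mult_right_mono)
        have "norm (grad \<rho> p - grad \<rho> \<zeta>) \<le> B * norm (p - \<zeta>)" by (rule lip[OF \<zeta>1 pR])
        also have "\<dots> \<le> B * R" using \<zeta>(2) r1 by (intro mult_left_mono) (auto simp: dist_norm)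
        finally show "norm (grad \<rho> p - grad \<rho> \<zeta>) \<le> B * R" .
      qed simp
      finally have "\<bar>d\<bar> \<le> B * R * norm y" .
      then have "\<bar>d\<bar>\<^sup>2 \<le> (B * R * norm y)\<^sup>2" by (intro power_mono) auto
      then have d2: "d\<^sup>2 \<le> B\<^sup>2 * R\<^sup>2 * (norm y)\<^sup>2" by (simp add: power_mult_distrib)
      have "c * (p \<bullet> y) = d - u" unfolding d_def inner_diff_left uy by (simp add: grad_p)
      then have "c\<^sup>2 * (p \<bullet> y)\<^sup>2 = (d - u)\<^sup>2" by (metis power_mult_distrib)
      also have "\<dots> \<le> 2 * u\<^sup>2 + 2 * d\<^sup>2"
        using zero_le_power2[of "d + u"] by (simp add: power2_sum power2_diff)
      finally have "M / c\<^sup>2 * (c\<^sup>2 * (p \<bullet> y)\<^sup>2) \<le> M / c\<^sup>2 * (2 * u\<^sup>2 + 2 * d\<^sup>2)"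
        using M by (intro mult_left_mono) auto
      then have "M * (p \<bullet> y)\<^sup>2 \<le> M' * u\<^sup>2 + M' * d\<^sup>2" using c by (simp add: M'_def algebra_simps)
      also have "M' * d\<^sup>2 \<le> M' * (B\<^sup>2 * R\<^sup>2 * (norm y)\<^sup>2)" by (rule mult_left_mono[OF d2 M'])
      also have "\<dots> = (M' * B\<^sup>2 * R\<^sup>2) * (norm y)\<^sup>2" by (simp add: mult_ac)
      also have "\<dots> \<le> c / 8 * (norm y)\<^sup>2" by (rule mult_right_mono[OF R2]) simp
      finally show ?thesis by simp
    qed
    then have h2: "c / 8 * (norm y)\<^sup>2 - M' * u\<^sup>2 \<le> hess \<rho> x y y" using h1 by linarith
    have "\<bar>u\<bar> \<le> norm (grad \<rho> \<zeta>) * norm (\<zeta> - z)" unfolding u_def by (rule Cauchy_Schwarz_ineq2)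
    also have "\<dots> \<le> B * (2 * R)"
    proof (rule mult_mono)
      have "dist \<zeta> z \<le> dist p \<zeta> + dist p z" by (metis dist_commute dist_triangle)
      then show "norm (\<zeta> - z) \<le> 2 * R" using \<zeta> z by (simp add: dist_norm)
    qed (use gB[OF \<zeta>1] r1 in auto)
    finally have "M' * \<bar>u\<bar> \<le> M' * (B * (2 * R))" using M' by (intro mult_left_mono) auto
    then have "M' * \<bar>u\<bar> \<le> 1" using R3 by (simp add: mult_ac)
    then have "M' * \<bar>u\<bar> * \<bar>u\<bar> \<le> 1 * \<bar>u\<bar>" by (intro mult_right_mono) auto
    then have "M' * u\<^sup>2 \<le> \<bar>u\<bar>" by (simp add: power2_eq_square mult.assoc)
    \<comment> \<open>For negative \<open>u\<close> this is impossible. For \<open>u \<ge> 0\<close>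
      it bounds \<open>c / 16\<close> times the squared norm of \<open>y\<close> by
      \<open>3 / 2 * u\<close>, which explains \<open>c / 24\<close>.\<close>
    then have fin: "c / 16 * (norm y)\<^sup>2 - \<bar>u\<bar> / 2 < u" using h2 u_gt by linarith
    have ny: "0 \<le> c / 16 * (norm y)\<^sup>2" using c by simp
    have "0 \<le> u"
    proof (rule ccontr)
      assume "\<not> 0 \<le> u"
      then show False using fin ny by linarith
    qed
    then have "c / 24 * (norm y)\<^sup>2 \<le> u" using fin by simp
    then show ?thesis by (simp add: u_def y_def norm_minus_commute)
  qed
  define r where "r = min R (c * R\<^sup>2 / (4 * (2 * B + c)))"
  have posB: "0 < 4 * (2 * B + c)" using r1 c by simp
  have r: "0 < r" "r \<le> R" using R c posB by (auto simp: r_def)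
  have r_small: "B * r * 2 + c * r \<le> c * R\<^sup>2 / 4"
  proof -
    have "r \<le> c * R\<^sup>2 / (4 * (2 * B + c))" by (simp add: r_def)
    then have "r * (4 * (2 * B + c)) \<le> c * R\<^sup>2" using posB by (simp only: pos_le_divide_eq)
    then show ?thesis by (simp add: algebra_simps)
  qed
  define a where "a = min (c / 24) (c * R\<^sup>2 / 16)"
  show ?thesis
  proof
    show "0 < r" by fact
    show "0 < a" using c R by (simp add: a_def)
    fix \<zeta> z assume \<zeta>: "\<zeta> \<in> frontier \<Omega>" "\<zeta> \<in> ball p r" and z: "z \<in> \<Omega>"
    have \<zeta>R: "\<zeta> \<in> ball p R" using \<zeta>(2) r by simp
    show "a * (norm (\<zeta> - z))\<^sup>2 \<le> grad \<rho> \<zeta> \<bullet> (\<zeta> - z)"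
    proof (cases "z \<in> ball p R")
      case True
      have "a * (norm (\<zeta> - z))\<^sup>2 \<le> c / 24 * (norm (\<zeta> - z))\<^sup>2" by (intro mult_right_mono) (auto simp: a_def)
      then show ?thesis using local[OF \<zeta>(1) \<zeta>R z True] by linarith
    next
      case False
      have \<zeta>1: "\<zeta> \<in> ball p r1" using \<zeta>R subR by blast
      have far: "R \<le> norm (p - z)" using False by (simp add: dist_norm)
      have nz: "norm z \<le> 1" "norm \<zeta> \<le> 1" using norm_le_1 norm_frontier z \<zeta> by auto
      have d2: "norm (\<zeta> - z) \<le> 2" using norm_triangle_ineq4[of \<zeta> z] nz by linarith
      have "(norm (p - z))\<^sup>2 = 1 - 2 * (p \<bullet> z) + (norm z)\<^sup>2"
        by (simp add: power2_norm_eq_inner inner_diff_left inner_diff_right p_inner_self inner_commute[of z p])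
      moreover have "(norm z)\<^sup>2 \<le> 1" using nz by (simp add: power_le_one)
      moreover have "R\<^sup>2 \<le> (norm (p - z))\<^sup>2" using far R by (intro power_mono) auto
      ultimately have "R\<^sup>2 / 2 \<le> 1 - p \<bullet> z" by linarith
      then have "c * (R\<^sup>2 / 2) \<le> c * (1 - p \<bullet> z)" using c by (intro mult_left_mono) auto
      moreover have "grad \<rho> p \<bullet> (p - z) = c * (1 - p \<bullet> z)"
        by (simp add: grad_p inner_diff_right p_inner_self right_diff_distrib)
      moreover have "grad \<rho> p \<bullet> (p - z) = grad \<rho> \<zeta> \<bullet> (\<zeta> - z) - ((grad \<rho> \<zeta> - grad \<rho> p) \<bullet> (\<zeta> - z) + grad \<rho> p \<bullet> (\<zeta> - p))"
        by (simp only: inner_diff_left inner_diff_right)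
      ultimately have main: "c * (R\<^sup>2 / 2) \<le> grad \<rho> \<zeta> \<bullet> (\<zeta> - z) - ((grad \<rho> \<zeta> - grad \<rho> p) \<bullet> (\<zeta> - z) + grad \<rho> p \<bullet> (\<zeta> - p))"
        by linarith
      have \<zeta>p: "norm (\<zeta> - p) \<le> r" using \<zeta>(2) by (simp add: dist_norm norm_minus_commute)
      have "\<bar>(grad \<rho> \<zeta> - grad \<rho> p) \<bullet> (\<zeta> - z)\<bar> \<le> norm (grad \<rho> \<zeta> - grad \<rho> p) * norm (\<zeta> - z)"
        by (rule Cauchy_Schwarz_ineq2)
      also have "\<dots> \<le> (B * r) * 2"
      proof (rule mult_mono[OF _ d2])
        have "norm (grad \<rho> \<zeta> - grad \<rho> p) \<le> B * norm (\<zeta> - p)" by (rule lip[OF pR \<zeta>1])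
        also have "\<dots> \<le> B * r" using \<zeta>p r1 by (intro mult_left_mono) auto
        finally show "norm (grad \<rho> \<zeta> - grad \<rho> p) \<le> B * r" .
      qed (use r1 r in auto)
      finally have e1: "\<bar>(grad \<rho> \<zeta> - grad \<rho> p) \<bullet> (\<zeta> - z)\<bar> \<le> B * r * 2" .
      have "\<bar>grad \<rho> p \<bullet> (\<zeta> - p)\<bar> \<le> norm (grad \<rho> p) * norm (\<zeta> - p)" by (rule Cauchy_Schwarz_ineq2)
      also have "\<dots> \<le> c * r" using \<zeta>p c norm_p by (simp add: grad_p)
      finally have e2: "\<bar>grad \<rho> p \<bullet> (\<zeta> - p)\<bar> \<le> c * r" .
      have "c * (R\<^sup>2 / 2) = c * R\<^sup>2 / 4 + c * R\<^sup>2 / 4" by simp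
      then have ge: "c * R\<^sup>2 / 4 \<le> grad \<rho> \<zeta> \<bullet> (\<zeta> - z)" using main e1 e2 r_small by linarith
      have "(norm (\<zeta> - z))\<^sup>2 \<le> 2\<^sup>2" using d2 by (intro power_mono) auto
      then have "a * (norm (\<zeta> - z))\<^sup>2 \<le> (c * R\<^sup>2 / 16) * 4"
        using c by (intro mult_mono) (auto simp: a_def)
      then show ?thesis using ge by simp
    qed
  qed
qed

text \<open>An interior ball condition. Every boundary point \<open>y\<close> satisfies
  \<open>(\<zeta> - y) \<bullet> \<nu> \<le> K * norm (\<zeta> - y) ^ 2\<close>, near
  \<open>\<zeta>\<close> by Taylor's formula with \<open>\<rho>\<close> zero at both ends, and far
  from it trivially. For \<open>2 * \<delta> * K < 1\<close>, expanding the square puts every other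
  boundary point at distance more than \<open>\<delta>\<close> from \<open>z\<close>. Strictness
  matters: \<open>closest_point\<close> is a choice, and uniqueness pins it down.\<close>

lemma spike_geometry:
  assumes V: "open V" "p \<in> V"
  obtains r \<delta>0 where "0 < r" "0 < \<delta>0" "ball p r \<subseteq> V"
    "\<And>\<zeta> \<delta> z. \<zeta> \<in> frontier \<Omega> \<Longrightarrow> \<zeta> \<in> ball p r \<Longrightarrow> 0 < \<delta> \<Longrightarrow> \<delta> < \<delta>0 \<Longrightarrow>
       z = \<zeta> - (\<delta> / norm (grad \<rho> \<zeta>)) *\<^sub>R grad \<rho> \<zeta> \<Longrightarrow>
       z \<in> \<Omega> \<and> z \<in> V \<and> bproj \<Omega> z = \<zeta> \<and> norm (z - \<zeta>) = \<delta>"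
proof -
  obtain r1 B where r1: "0 < r1" "1 \<le> B" "ball p r1 \<subseteq> U"
    and quad: "\<And>x y. x \<in> ball p r1 \<Longrightarrow> y \<in> ball p r1 \<Longrightarrow> \<bar>\<rho> y - \<rho> x - grad \<rho> x \<bullet> (y - x)\<bar> \<le> B * (norm (y - x))\<^sup>2"
    and gc: "\<And>x. x \<in> ball p r1 \<Longrightarrow> c / 2 \<le> norm (grad \<rho> x)"
    using grad_bounds by metis
  obtain rV where rV: "0 < rV" "ball p rV \<subseteq> V" using V openE by blast
  define r where "r = min (r1 / 2) (rV / 2)"
  define K where "K = max (2 * B / c) (2 / r1)"
  have K: "0 < K" "2 * B / c \<le> K" "2 / r1 \<le> K" using r1 by (auto simp: K_def less_max_iff_disj)
  \<comment> \<open>The bound \<open>c / (2 * B)\<close> puts the point inside the domain;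
    \<open>1 / (2 * K)\<close> makes \<open>\<zeta>\<close> its nearest boundary point.\<close>
  define \<delta>0 where "\<delta>0 = min r (min (c / (2 * B)) (1 / (2 * K)))"
  have r: "0 < r" "r \<le> r1 / 2" "r \<le> rV / 2" using r1 rV by (auto simp: r_def)
  have d0: "0 < \<delta>0" "\<delta>0 \<le> r" "\<delta>0 \<le> c / (2 * B)" "\<delta>0 \<le> 1 / (2 * K)"
    using r c r1 K by (auto simp: \<delta>0_def)
  show ?thesis
  proof
    show "0 < r" "0 < \<delta>0" by fact+
    show "ball p r \<subseteq> V" using r rV subset_ball[of r rV p] by auto
    fix \<zeta> \<delta> z assume \<zeta>: "\<zeta> \<in> frontier \<Omega>" "\<zeta> \<in> ball p r" and d: "0 < \<delta>" "\<delta> < \<delta>0"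
      and z: "z = \<zeta> - (\<delta> / norm (grad \<rho> \<zeta>)) *\<^sub>R grad \<rho> \<zeta>"
    define g where "g = grad \<rho> \<zeta>"
    define \<nu> where "\<nu> = (1 / norm g) *\<^sub>R g"
    have \<zeta>1: "\<zeta> \<in> ball p r1" using \<zeta>(2) r r1 by simp
    have g: "c / 2 \<le> norm g" "0 < norm g" using gc[OF \<zeta>1] c by (auto simp: g_def)
    have nu: "norm \<nu> = 1" using g by (simp add: \<nu>_def)
    have z': "z = \<zeta> - \<delta> *\<^sub>R \<nu>" by (simp add: z \<nu>_def g_def)
    have nz: "norm (z - \<zeta>) = \<delta>" using d by (simp add: z' nu)
    have "dist p z \<le> dist p \<zeta> + dist \<zeta> z" by (rule dist_triangle)
    also have "dist \<zeta> z = \<delta>" using nz by (simp add: dist_norm norm_minus_commute)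
    finally have pz: "dist p z < 2 * r" using \<zeta>(2) d d0 by simp
    have zb: "z \<in> ball p r1" "z \<in> ball p rV" using pz r by auto
    then have zU: "z \<in> U" "z \<in> V" using r1 rV by auto
    have "\<bar>\<rho> z - \<rho> \<zeta> - g \<bullet> (z - \<zeta>)\<bar> \<le> B * \<delta>\<^sup>2" using quad[OF \<zeta>1 zb(1)] nz by (simp add: g_def)
    moreover have gnu: "g \<bullet> \<nu> = norm g" using g by (simp add: \<nu>_def dot_square_norm power2_eq_square)
    moreover have "g \<bullet> (z - \<zeta>) = - (\<delta> * norm g)" by (simp add: z' gnu)
    ultimately have "\<rho> z \<le> B * \<delta>\<^sup>2 - \<delta> * norm g" using \<rho>_frontier[OF \<zeta>(1)] by (simp add: abs_le_iff)
    also have "\<dots> = \<delta> * (B * \<delta> - norm g)" by (simp add: power2_eq_square algebra_simps)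
    also have "\<dots> < 0"
    proof (rule mult_pos_neg[OF d(1)])
      have "\<delta> < c / (2 * B)" using d d0 by linarith
      then have "B * \<delta> < c / 2" using r1 by (simp add: pos_less_divide_eq mult_ac)
      then show "B * \<delta> - norm g < 0" using g by linarith
    qed
    finally have z\<Omega>: "z \<in> \<Omega>" using \<Omega>_iff[OF zU(1)] by simp
    have closest: "dist z \<zeta> < dist z y" if y: "y \<in> frontier \<Omega>" "y \<noteq> \<zeta>" for y
    proof -
      have nu_le: "(\<zeta> - y) \<bullet> \<nu> \<le> K * (norm (\<zeta> - y))\<^sup>2"
      proof (cases "y \<in> ball p r1")
        case True
        have "\<bar>g \<bullet> (y - \<zeta>)\<bar> \<le> B * (norm (y - \<zeta>))\<^sup>2"
          using quad[OF \<zeta>1 True] \<rho>_frontier[OF \<zeta>(1)] \<rho>_frontier[OF y(1)] by (simp add: g_def)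
        then have "(\<zeta> - y) \<bullet> g \<le> B * (norm (\<zeta> - y))\<^sup>2"
          by (simp add: abs_le_iff inner_diff_right inner_diff_left inner_commute norm_minus_commute)
        then have "(1 / norm g) * ((\<zeta> - y) \<bullet> g) \<le> (1 / norm g) * (B * (norm (\<zeta> - y))\<^sup>2)"
          using g by (intro mult_left_mono) auto
        also have "\<dots> \<le> (2 / c) * (B * (norm (\<zeta> - y))\<^sup>2)"
          using g c r1 frac_le[of 1 1 "c / 2" "norm g"] by (intro mult_right_mono) auto
        also have "\<dots> = (2 * B / c) * (norm (\<zeta> - y))\<^sup>2" by simp
        also have "\<dots> \<le> K * (norm (\<zeta> - y))\<^sup>2" by (intro mult_right_mono K) simp
        finally show ?thesis by (simp add: \<nu>_def)
      next
        case False
        have "dist p y \<le> dist p \<zeta> + dist \<zeta> y" by (rule dist_triangle)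
        then have far: "r1 / 2 \<le> norm (\<zeta> - y)" using False \<zeta>(2) r by (simp add: dist_norm)
        have "(\<zeta> - y) \<bullet> \<nu> \<le> norm (\<zeta> - y) * 1" using norm_cauchy_schwarz[of "\<zeta> - y" \<nu>] nu by simp
        also have "\<dots> \<le> norm (\<zeta> - y) * (2 / r1 * norm (\<zeta> - y))"
          using far r1 by (intro mult_left_mono) (auto simp: field_simps)
        also have "\<dots> = 2 / r1 * (norm (\<zeta> - y))\<^sup>2" by (simp add: power2_eq_square)
        also have "\<dots> \<le> K * (norm (\<zeta> - y))\<^sup>2" by (intro mult_right_mono K) simp
        finally show ?thesis .
      qed
      have npos: "0 < (norm (\<zeta> - y))\<^sup>2" using y by simp
      have "2 * \<delta> * K < 1"
      proof -
        have "\<delta> < 1 / (2 * K)" using d d0 by linarith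
        then show ?thesis using K by (simp add: pos_less_divide_eq mult_ac)
      qed
      then have "(2 * \<delta> * K) * (norm (\<zeta> - y))\<^sup>2 < 1 * (norm (\<zeta> - y))\<^sup>2" using npos by (intro mult_strict_right_mono)
      moreover have "2 * \<delta> * ((\<zeta> - y) \<bullet> \<nu>) \<le> 2 * \<delta> * (K * (norm (\<zeta> - y))\<^sup>2)"
        using nu_le d by (intro mult_left_mono) auto
      ultimately have lt: "2 * \<delta> * ((\<zeta> - y) \<bullet> \<nu>) < (norm (\<zeta> - y))\<^sup>2" by (simp add: mult.assoc)
      have nn: "\<nu> \<bullet> \<nu> = 1" using nu by (simp add: dot_square_norm)
      have zy: "z - y = (\<zeta> - y) - \<delta> *\<^sub>R \<nu>" by (simp add: z')
      have "(x - \<delta> *\<^sub>R \<nu>) \<bullet> (x - \<delta> *\<^sub>R \<nu>) = x \<bullet> x - 2 * \<delta> * (x \<bullet> \<nu>) + \<delta>\<^sup>2" for x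
        unfolding inner_diff_left inner_diff_right inner_scaleR_left inner_scaleR_right nn inner_commute[of \<nu> x]
        by (simp only: power2_eq_square) (simp add: algebra_simps)
      then have "(norm (z - y))\<^sup>2 = (norm (\<zeta> - y))\<^sup>2 - 2 * \<delta> * ((\<zeta> - y) \<bullet> \<nu>) + \<delta>\<^sup>2"
        by (simp only: zy power2_norm_eq_inner)
      then have "\<delta>\<^sup>2 < (norm (z - y))\<^sup>2" using lt by linarith
      then have "\<delta> < norm (z - y)" by (rule power2_less_imp_less) simp
      then show ?thesis using nz by (simp add: dist_norm)
    qed
    have "bproj \<Omega> z = \<zeta>"
      unfolding closest_point_def
    proof (rule some_equality)
      show "\<zeta> \<in> frontier \<Omega> \<and> (\<forall>y\<in>frontier \<Omega>. dist z \<zeta> \<le> dist z y)"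
        using \<zeta> closest by (metis less_imp_le order_refl)
      show "x = \<zeta>" if x: "x \<in> frontier \<Omega> \<and> (\<forall>y\<in>frontier \<Omega>. dist z x \<le> dist z y)" for x
        using closest[of x] x \<zeta> by (meson not_le)
    qed
    then show "z \<in> \<Omega> \<and> z \<in> V \<and> bproj \<Omega> z = \<zeta> \<and> norm (z - \<zeta>) = \<delta>" using z\<Omega> zU nz by simp
  qed
qed

end

section \<open>Positive surface measure of the boundary patch\<close>

text \<open>The map sends each piece of a cover into a closed ball whose radius is the diameter of
  the piece, and these balls have to exhaust the volume of \<open>ball q s\<close>. Taking the
  diameter as radius loses a power of 2, hence \<open>s / 2\<close> in the bound \<open>m\<close>.
  The estimate holds for covers of any mesh, so mesh 1 already gives it.\<close>

lemma hausdorff_measure_positive: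
  fixes A :: "'a::metric_space set" and \<tau> :: "'a \<Rightarrow> 'b::euclidean_space"
  assumes lip: "\<And>x y. dist (\<tau> x) (\<tau> y) \<le> dist x y"
    and s: "0 < s" "ball q s \<subseteq> \<tau> ` A"
  shows "0 < hausdorff_measure DIM('b) A"
proof -
  let ?n = "DIM('b)"
  define m where "m = ennreal (unit_ball_vol (real ?n) * (s / 2) ^ ?n)"
  have vol: "0 < unit_ball_vol (real ?n)" by simp
  have "m \<le> (\<Sum>i. ennreal (unit_ball_vol (real ?n) * (diameter (C i) / 2) ^ ?n))"
    if C: "A \<subseteq> (\<Union>i. C i)" "\<And>i. bounded (C i)" for C :: "nat \<Rightarrow> 'a set"
  proof -
    let ?k = "ennreal (2 ^ ?n)"
    \<comment> \<open>For an empty piece this is an arbitrary point, which is harmless: such a piece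
      covers nothing and its ball has radius 0.\<close>
    define x where "x i = (SOME y. y \<in> C i)" for i
    have sub: "ball q s \<subseteq> (\<Union>i. cball (\<tau> (x i)) (diameter (C i)))"
    proof
      fix y assume "y \<in> ball q s"
      then obtain a i where a: "a \<in> C i" "y = \<tau> a" using s C by blast
      then have "x i \<in> C i" unfolding x_def by (metis someI)
      then have "dist (x i) a \<le> diameter (C i)" using diameter_bounded_bound[OF C(2)] a by blast
      then show "y \<in> (\<Union>i. cball (\<tau> (x i)) (diameter (C i)))" using lip[of "x i" a] a by (intro UN_I[of i]) auto
    qed
    have d0: "0 \<le> diameter (C i)" for i by (rule diameter_ge_0[OF C(2)])
    have "?k * m = emeasure lborel (ball q s)"
      unfolding m_def emeasure_ball[OF less_imp_le[OF s(1)]] using s vol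
      by (simp add: ennreal_mult[symmetric] power_divide)
    also have "\<dots> \<le> emeasure lborel (\<Union>i. cball (\<tau> (x i)) (diameter (C i)))"
      by (rule emeasure_mono[OF sub]) (auto intro: sets.countable_UN)
    also have "\<dots> \<le> (\<Sum>i. emeasure lborel (cball (\<tau> (x i)) (diameter (C i))))"
      by (rule emeasure_subadditive_countably) auto
    also have "\<dots> = (\<Sum>i. ?k * ennreal (unit_ball_vol (real ?n) * (diameter (C i) / 2) ^ ?n))"
    proof (rule suminf_cong)
      fix i
      show "emeasure lborel (cball (\<tau> (x i)) (diameter (C i))) = ?k * ennreal (unit_ball_vol (real ?n) * (diameter (C i) / 2) ^ ?n)"
        using d0[of i] vol by (simp add: emeasure_cball ennreal_mult[symmetric] power_divide)
    qed
    also have "\<dots> = ?k * (\<Sum>i. ennreal (unit_ball_vol (real ?n) * (diameter (C i) / 2) ^ ?n))"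
      by (rule ennreal_suminf_cmult)
    finally show ?thesis by (subst (asm) ennreal_mult_le_mult_iff) auto
  qed
  then have "m \<le> hausdorff_measure ?n A"
    unfolding hausdorff_measure_def by (intro SUP_upper2[of 1] INF_greatest) auto
  moreover have "0 < m" unfolding m_def using s vol by simp
  ultimately show ?thesis by (rule order_less_le_trans[rotated])
qed

lemma hausdorff_measure_mono: "A \<subseteq> B \<Longrightarrow> hausdorff_measure d A \<le> hausdorff_measure d B"
  unfolding hausdorff_measure_def by (intro SUP_mono' INF_superset_mono) auto

text \<open>Project along the real part of the first coordinate onto the remaining three real
  dimensions. Each short segment in that direction near \<open>p\<close> starts in the domain and
  ends outside the unit ball, so it meets the boundary; hence the projected patch contains a
  ball.\<close>

lemma (in touching_domain) surface_patch_positive: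
  assumes p: "p = vector [1, 0]" and r: "0 < r"
  shows "0 < hausdorff_measure 3 (frontier \<Omega> \<inter> cball p r)"
proof -
  define \<tau> :: "c2 \<Rightarrow> real \<times> complex" where "\<tau> z = (Im (z $ 1), z $ 2)" for z
  define q :: "real \<times> complex \<Rightarrow> real \<Rightarrow> c2" where "q y x = vector [Complex x (fst y), snd y]" for y x
  have q_sel: "q y x $ 1 = Complex x (fst y)" "q y x $ 2 = snd y" for y x by (simp_all add: q_def)
  have lip: "dist (\<tau> x) (\<tau> y) \<le> dist x y" for x y
  proof -
    have "(dist (\<tau> x) (\<tau> y))\<^sup>2 = (Im ((x - y) $ 1))\<^sup>2 + (cmod ((x - y) $ 2))\<^sup>2"
      by (simp add: \<tau>_def dist_norm norm_Pair)
    also have "\<dots> \<le> (dist x y)\<^sup>2"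
      unfolding dist_norm norm_c2 by (simp add: cmod_power2)
    finally show ?thesis by (rule power2_le_imp_le) simp
  qed
  obtain r1 \<delta>0 where r1: "0 < r1" "0 < \<delta>0"
    and sp: "\<And>\<zeta> \<delta> z. \<zeta> \<in> frontier \<Omega> \<Longrightarrow> \<zeta> \<in> ball p r1 \<Longrightarrow> 0 < \<delta> \<Longrightarrow> \<delta> < \<delta>0 \<Longrightarrow>
       z = \<zeta> - (\<delta> / norm (grad \<rho> \<zeta>)) *\<^sub>R grad \<rho> \<zeta> \<Longrightarrow>
       z \<in> \<Omega> \<and> z \<in> UNIV \<and> bproj \<Omega> z = \<zeta> \<and> norm (z - \<zeta>) = \<delta>"
    using spike_geometry[OF open_UNIV UNIV_I] by metis
  define h where "h = min (r / 2) (\<delta>0 / 2)"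
  have h: "0 < h" "h < \<delta>0" "h \<le> r / 2" using r r1 by (auto simp: h_def)
  have "p - h *\<^sub>R p = p - (h / norm (grad \<rho> p)) *\<^sub>R grad \<rho> p"
    using c norm_p by (simp add: grad_p)
  then have "p - h *\<^sub>R p \<in> \<Omega>" using sp[OF p_frontier _ h(1,2)] r1 by auto
  then obtain s0 where s0: "0 < s0" "ball (p - h *\<^sub>R p) s0 \<subseteq> \<Omega>" using open_\<Omega> openE by blast
  define s where "s = min s0 (r / 2)"
  have s: "0 < s" "s \<le> s0" "s \<le> r / 2" using s0 r by (auto simp: s_def)
  have p12: "p $ 1 = 1" "p $ 2 = 0" by (simp_all add: p)
  have dq: "norm (q y x - t *\<^sub>R p) = sqrt ((x - t)\<^sup>2 + (norm y)\<^sup>2)" for y x t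
  proof -
    have "(norm (q y x - t *\<^sub>R p))\<^sup>2 = (x - t)\<^sup>2 + (norm y)\<^sup>2"
      unfolding norm_c2 by (simp add: q_sel p12 cmod_power2 norm_prod_def)
    then show ?thesis by (metis norm_ge_zero real_sqrt_unique)
  qed
  have "ball 0 s \<subseteq> \<tau> ` (frontier \<Omega> \<inter> cball p r)"
  proof
    fix y :: "real \<times> complex" assume y: "y \<in> ball 0 s"
    let ?L = "q y ` {1 - h..1 + h}"
    have "continuous_on {1 - h..1 + h} (q y)"
    proof -
      define k where "k = q y 0"
      have "q y = (\<lambda>x. x *\<^sub>R p + k)"
        by (rule ext) (simp add: k_def vec_eq_iff forall_2 q_sel p12 complex_eq_iff)
      moreover have "continuous_on {1 - h..1 + h} (\<lambda>x. x *\<^sub>R p + k)" by (intro continuous_intros)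
      ultimately show "continuous_on {1 - h..1 + h} (q y)" by simp
    qed
    then have "connected ?L" by (intro connected_continuous_image) auto
    moreover have "?L \<inter> \<Omega> \<noteq> {}"
    proof -
      have "q y (1 - h) \<in> ball (p - h *\<^sub>R p) s0"
        using dq[of y "1 - h" "1 - h"] y s by (simp add: dist_norm norm_minus_commute scaleR_diff_left)
      then show ?thesis using s0 h by force
    qed
    moreover have "?L - \<Omega> \<noteq> {}"
    proof -
      have "1 + h \<le> sqrt ((1 + h - 0)\<^sup>2 + (norm y)\<^sup>2)" using h by (intro real_le_rsqrt) simp
      moreover have "norm (q y (1 + h) - 0 *\<^sub>R p) = sqrt ((1 + h - 0)\<^sup>2 + (norm y)\<^sup>2)" by (rule dq)
      moreover have "q y (1 + h) - 0 *\<^sub>R p = q y (1 + h)" by simp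
      ultimately have "1 + h \<le> norm (q y (1 + h))" by metis
      then have "1 < norm (q y (1 + h))" using h by linarith
      then have "q y (1 + h) \<notin> \<Omega>" using norm_le_1 by force
      moreover have "q y (1 + h) \<in> ?L" using h by (intro imageI) simp
      ultimately show ?thesis by blast
    qed
    ultimately have "?L \<inter> frontier \<Omega> \<noteq> {}" by (rule connected_Int_frontier)
    then obtain x where x: "1 - h \<le> x" "x \<le> 1 + h" "q y x \<in> frontier \<Omega>" by auto
    have "norm (q y x - p) \<le> \<bar>x - 1\<bar> + norm y"
      using dq[of y x 1] sqrt_sum_squares_le_sum_abs[of "x - 1" "norm y"] by simp
    also have "\<dots> \<le> h + s" using x y by (intro add_mono) auto
    also have "\<dots> \<le> r" using h s by linarith
    finally have "q y x \<in> cball p r" by (simp add: dist_norm norm_minus_commute)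
    moreover have "\<tau> (q y x) = y" by (simp add: \<tau>_def q_sel)
    ultimately show "y \<in> \<tau> ` (frontier \<Omega> \<inter> cball p r)" using x by (intro image_eqI[of _ _ "q y x"]) auto
  qed
  then have "0 < hausdorff_measure DIM(real \<times> complex) (frontier \<Omega> \<inter> cball p r)"
    by (rule hausdorff_measure_positive[OF lip s(1)])
  moreover have "DIM(real \<times> complex) = 3" by simp
  ultimately show ?thesis by metis
qed

section \<open>Iterated commutators\<close>

lemma vector_4 [simp]:
  "(vector [x, y, z, w] :: ('a::zero)^4) $ 1 = x"
  "(vector [x, y, z, w] :: ('a::zero)^4) $ 2 = y"
  "(vector [x, y, z, w] :: ('a::zero)^4) $ 3 = z"
  "(vector [x, y, z, w] :: ('a::zero)^4) $ 4 = w"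
  unfolding vector_def by simp_all

lemma smooth_on_add: "open S \<Longrightarrow> smooth_on S f \<Longrightarrow> smooth_on S g \<Longrightarrow> smooth_on S (\<lambda>x. f x + g x)"
  by (simp add: smooth_on_def Ck_on_add)

lemma smooth_on_mult:
  fixes f g :: "'a::real_normed_vector \<Rightarrow> 'b::real_normed_algebra"
  shows "open S \<Longrightarrow> smooth_on S f \<Longrightarrow> smooth_on S g \<Longrightarrow> smooth_on S (\<lambda>x. f x * g x)"
  by (simp add: smooth_on_def Ck_on_mult)

lemma smooth_on_const: "smooth_on S (\<lambda>x. c)"
  by (simp add: smooth_on_def Ck_on_const)

lemma smooth_on_of_real: "open S \<Longrightarrow> smooth_on S f \<Longrightarrow> smooth_on S (\<lambda>x. complex_of_real (f x))"
  by (simp add: smooth_on_def Ck_on_bounded_linear[OF _ bounded_linear_of_real])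

lemma smooth_on_minus:
  fixes f :: "'a::real_normed_vector \<Rightarrow> complex"
  assumes "open S" "smooth_on S f"
  shows "smooth_on S (\<lambda>x. - f x)"
  using smooth_on_mult[OF assms(1) smooth_on_const[of S "- 1"] assms(2)] by simp

lemma smooth_on_diff:
  fixes f g :: "'a::real_normed_vector \<Rightarrow> complex"
  assumes "open S" "smooth_on S f" "smooth_on S g"
  shows "smooth_on S (\<lambda>x. f x - g x)"
  using smooth_on_add[OF assms(1,2) smooth_on_minus[OF assms(1,3)]] by simp

lemma smooth_on_frechet: "smooth_on S f \<Longrightarrow> smooth_on S (\<lambda>x. frechet_derivative f (at x) v)"
  unfolding smooth_on_def by (metis Ck_on.simps(2))

lemma smooth_on_imp_derivative: "smooth_on S f \<Longrightarrow> x \<in> S \<Longrightarrow> (f has_derivative frechet_derivative f (at x)) (at x)"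
  unfolding smooth_on_def using Ck_on.simps(2)[of 0 S f] frechet_derivative_works by metis

lemma smooth_on_imp_isCont: "smooth_on S f \<Longrightarrow> x \<in> S \<Longrightarrow> isCont f x"
  using smooth_on_imp_derivative has_derivative_continuous by blast

lemma smooth_on_dz: "open S \<Longrightarrow> smooth_on S f \<Longrightarrow> smooth_on S (dz j f)"
proof -
  assume S: "open S" "smooth_on S f"
  have "dz j f = (\<lambda>z. (1/2) * (frechet_derivative f (at z) (axis j 1) - \<i> * frechet_derivative f (at z) (axis j \<i>)))"
    by (rule ext) (simp add: dz_def)
  then show ?thesis using S
    by (simp only:) (intro smooth_on_mult smooth_on_diff smooth_on_const smooth_on_frechet)
qed

lemma smooth_on_dzbar: "open S \<Longrightarrow> smooth_on S f \<Longrightarrow> smooth_on S (dzbar j f)"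
proof -
  assume S: "open S" "smooth_on S f"
  have "dzbar j f = (\<lambda>z. (1/2) * (frechet_derivative f (at z) (axis j 1) + \<i> * frechet_derivative f (at z) (axis j \<i>)))"
    by (rule ext) (simp add: dzbar_def)
  then show ?thesis using S
    by (simp only:) (intro smooth_on_mult smooth_on_add smooth_on_const smooth_on_frechet)
qed

definition smooth_field :: "c2 set \<Rightarrow> cvf \<Rightarrow> bool" where
  "smooth_field S X \<longleftrightarrow> (\<forall>i. smooth_on S (\<lambda>z. X z $ i))"

lemma smooth_vf_apply:
  assumes "open S" "smooth_field S X" "smooth_on S f"
  shows "smooth_on S (vf_apply X f)"
proof -
  have "vf_apply X f = (\<lambda>z. X z $ 1 * dz 1 f z + X z $ 2 * dz 2 f z + X z $ 3 * dzbar 1 f z + X z $ 4 * dzbar 2 f z)"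
    by (rule ext) (simp add: vf_apply_def)
  then show ?thesis using assms unfolding smooth_field_def
    by (simp only:) (intro smooth_on_add smooth_on_mult smooth_on_dz smooth_on_dzbar, auto)
qed

lemma smooth_field_bracket:
  assumes "open S" "smooth_field S X" "smooth_field S Y"
  shows "smooth_field S (lie_bracket X Y)"
  unfolding smooth_field_def lie_bracket_def vec_lambda_beta
proof (intro allI smooth_on_diff smooth_vf_apply)
  show "smooth_on S (\<lambda>w. X w $ i)" "smooth_on S (\<lambda>w. Y w $ i)" for i
    using assms by (auto simp: smooth_field_def)
qed (use assms in auto)

lemma smooth_L:
  assumes "open S" "smooth_on S \<rho>"
  shows "smooth_field S (L_field \<rho>)" "smooth_field S (Lbar_field \<rho>)"
proof -
  note sm = smooth_on_of_real[OF assms]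
  note dz = smooth_on_dz[OF assms(1) sm] and dzb = smooth_on_dzbar[OF assms(1) sm]
  show "smooth_field S (L_field \<rho>)" "smooth_field S (Lbar_field \<rho>)"
    unfolding smooth_field_def L_field_def Lbar_field_def forall_4
    by (simp_all add: smooth_on_const dz dzb smooth_on_minus assms(1))
qed

lemma smooth_iterated_commutator:
  assumes "open S" "smooth_on S \<rho>" "iterated_commutator \<rho> k X"
  shows "smooth_field S X"
  using assms(3) by induction (auto intro: smooth_L smooth_field_bracket assms)

text \<open>The pairing of the (1,0)-part of \<open>X\<close> with the (1,0)-form of derivatives of
  \<open>\<rho>\<close>, divided by its value on \<open>T_field\<close>. It vanishes on
  \<open>L_field\<close> and \<open>Lbar_field\<close>, and for smooth fields it is continuous,
  which a definite description does not show.\<close>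

definition T_value :: "(c2 \<Rightarrow> real) \<Rightarrow> cvf \<Rightarrow> c2 \<Rightarrow> complex" where
  "T_value \<rho> X z = (rdz 1 \<rho> z * X z $ 1 + rdz 2 \<rho> z * X z $ 2) / (rdz 1 \<rho> z * rdzbar 1 \<rho> z)"

text \<open>This says X \<rho> = 0, tangency to the level sets of \<open>\<rho>\<close>.\<close>

definition annihilates :: "(c2 \<Rightarrow> real) \<Rightarrow> cvf \<Rightarrow> c2 \<Rightarrow> bool" where
  "annihilates \<rho> X z \<longleftrightarrow> rdz 1 \<rho> z * X z $ 1 + rdz 2 \<rho> z * X z $ 2 + rdzbar 1 \<rho> z * X z $ 3 + rdzbar 2 \<rho> z * X z $ 4 = 0"

lemma T_decomposition_value:
  assumes "rdz 1 \<rho> z \<noteq> 0" "rdzbar 1 \<rho> z \<noteq> 0"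
    and "X z = l *s T_field \<rho> z + a *s L_field \<rho> z + b *s Lbar_field \<rho> z"
  shows "l = T_value \<rho> X z"
proof -
  have "rdz 1 \<rho> z * X z $ 1 + rdz 2 \<rho> z * X z $ 2 = l * (rdz 1 \<rho> z * rdzbar 1 \<rho> z)"
    unfolding assms(3) by (simp add: T_field_def L_field_def Lbar_field_def algebra_simps)
  then show ?thesis using assms(1,2) unfolding T_value_def by (simp only: nonzero_mult_div_cancel_right mult_eq_0_iff) simp
qed

text \<open>Components 2 and 4 determine the coefficients of \<open>L_field\<close> and
  \<open>Lbar_field\<close>, component 1 that of \<open>T_field\<close>; component 3 then agrees
  because X \<rho> = 0.\<close>

lemma T_coeff_annihilates:
  assumes nz: "rdz 1 \<rho> z \<noteq> 0" "rdzbar 1 \<rho> z \<noteq> 0" and X: "annihilates \<rho> X z"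
  shows "T_coeff \<rho> X z = T_value \<rho> X z"
  unfolding T_coeff_def
proof (rule the_equality)
  define a where "a = X z $ 2 / rdz 1 \<rho> z"
  define b where "b = X z $ 4 / rdzbar 1 \<rho> z"
  have "X z = T_value \<rho> X z *s T_field \<rho> z + a *s L_field \<rho> z + b *s Lbar_field \<rho> z"
    unfolding vec_eq_iff forall_4
  proof (intro conjI)
    show "X z $ 3 = (T_value \<rho> X z *s T_field \<rho> z + a *s L_field \<rho> z + b *s Lbar_field \<rho> z) $ 3"
    proof -
      let ?N = "rdz 1 \<rho> z * X z $ 1 + rdz 2 \<rho> z * X z $ 2"
      have "rdzbar 1 \<rho> z * X z $ 3 = - ?N - rdzbar 2 \<rho> z * X z $ 4"
        using X unfolding annihilates_def by (simp add: algebra_simps add_eq_0_iff)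
      then have "X z $ 3 = (- ?N - rdzbar 2 \<rho> z * X z $ 4) / rdzbar 1 \<rho> z"
        using nz by (simp add: nonzero_eq_divide_eq mult.commute)
      also have "\<dots> = - (?N / (rdz 1 \<rho> z * rdzbar 1 \<rho> z)) * rdz 1 \<rho> z - (X z $ 4 / rdzbar 1 \<rho> z) * rdzbar 2 \<rho> z"
        using nz by (simp add: field_simps)
      finally show ?thesis
        by (simp add: T_value_def b_def T_field_def L_field_def Lbar_field_def)
    qed
  qed (use nz in \<open>simp_all add: T_value_def a_def b_def T_field_def L_field_def Lbar_field_def field_simps\<close>)
  then show "\<exists>a b. X z = T_value \<rho> X z *s T_field \<rho> z + a *s L_field \<rho> z + b *s Lbar_field \<rho> z" by blast
next
  fix l assume "\<exists>a b. X z = l *s T_field \<rho> z + a *s L_field \<rho> z + b *s Lbar_field \<rho> z"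
  then show "l = T_value \<rho> X z" using T_decomposition_value[OF nz] by blast
qed

text \<open>Where no decomposition exists, \<open>THE\<close> picks one fixed junk value, so the coefficients stay locally bounded.\<close>

lemma T_coeff_cases:
  assumes nz: "rdz 1 \<rho> z \<noteq> 0" "rdzbar 1 \<rho> z \<noteq> 0"
  shows "T_coeff \<rho> X z = T_value \<rho> X z \<or> T_coeff \<rho> X z = (THE l. False)"
proof (cases "\<exists>l a b. X z = l *s T_field \<rho> z + a *s L_field \<rho> z + b *s Lbar_field \<rho> z")
  case True
  then have "\<exists>a b. X z = T_value \<rho> X z *s T_field \<rho> z + a *s L_field \<rho> z + b *s Lbar_field \<rho> z"
    using T_decomposition_value[OF nz] by blast
  then show ?thesis using T_decomposition_value[OF nz] unfolding T_coeff_def by (intro disjI1 the_equality) blast+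
next
  case False
  then have "(\<lambda>l. \<exists>a b. X z = l *s T_field \<rho> z + a *s L_field \<rho> z + b *s Lbar_field \<rho> z) = (\<lambda>l. False)" by blast
  then show ?thesis unfolding T_coeff_def by simp
qed

lemma T_value_continuous:
  assumes "open U" "smooth_on U \<rho>" "smooth_field U X" "z \<in> U" "rdz 1 \<rho> z \<noteq> 0" "rdzbar 1 \<rho> z \<noteq> 0"
  shows "isCont (T_value \<rho> X) z"
proof -
  note sm = smooth_on_of_real[OF assms(1,2)]
  have c: "isCont (rdz j \<rho>) z" "isCont (rdzbar j \<rho>) z" "isCont (\<lambda>z. X z $ i) z" for i j
  proof -
    show "isCont (rdz j \<rho>) z" by (rule smooth_on_imp_isCont[OF smooth_on_dz[OF assms(1) sm] assms(4)])
    show "isCont (rdzbar j \<rho>) z" by (rule smooth_on_imp_isCont[OF smooth_on_dzbar[OF assms(1) sm] assms(4)])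
    have "smooth_on U (\<lambda>z. X z $ i)" using assms(3) by (simp add: smooth_field_def)
    then show "isCont (\<lambda>z. X z $ i) z" by (rule smooth_on_imp_isCont[OF _ assms(4)])
  qed
  have "T_value \<rho> X = (\<lambda>z. (rdz 1 \<rho> z * X z $ 1 + rdz 2 \<rho> z * X z $ 2) / (rdz 1 \<rho> z * rdzbar 1 \<rho> z))"
    by (rule ext) (simp add: T_value_def)
  then show ?thesis using assms(5,6) by (simp only:) (intro continuous_intros c, simp)
qed

lemma Lam_nonneg: "0 \<le> Lam \<rho> M k z"
  by (simp add: Lam_def sum_nonneg)

text \<open>Each coefficient is the continuous \<open>T_value\<close> or one fixed default value,
  and the bound \<open>b\<close> covers both. If \<open>M k\<close> is infinite, the sum is 0 by
  convention.\<close>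

lemma Lam_locally_bounded:
  assumes U: "open U" "smooth_on U \<rho>" and V: "open V" "V \<subseteq> U" "p \<in> V"
    and nz: "\<And>z. z \<in> V \<Longrightarrow> rdz 1 \<rho> z \<noteq> 0 \<and> rdzbar 1 \<rho> z \<noteq> 0"
    and M: "\<And>X. X \<in> M k \<Longrightarrow> \<exists>j. iterated_commutator \<rho> j X"
  shows "\<exists>B. \<forall>\<^sub>F z in nhds p. Lam \<rho> M k z \<le> B"
proof (cases "finite (M k)")
  case False
  then show ?thesis by (intro exI[of _ 0]) (simp add: Lam_def)
next
  case True
  define b where "b X = cmod (T_value \<rho> X p) + 1 + cmod (THE l. False)" for X
  have "\<forall>\<^sub>F z in nhds p. z \<in> V \<and> (\<forall>X\<in>M k. cmod (T_value \<rho> X z) < cmod (T_value \<rho> X p) + 1)"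
  proof (intro eventually_conj eventually_ball_finite True ballI)
    show "\<forall>\<^sub>F z in nhds p. z \<in> V" using V by (intro eventually_nhds_in_open)
    fix X assume X: "X \<in> M k"
    then have "smooth_field U X" using M smooth_iterated_commutator[OF U] by blast
    then have "isCont (T_value \<rho> X) p" using T_value_continuous[OF U] V nz by blast
    then have "((\<lambda>z. cmod (T_value \<rho> X z)) \<longlongrightarrow> cmod (T_value \<rho> X p)) (nhds p)"
      by (intro tendsto_norm) (simp add: isCont_def tendsto_at_iff_tendsto_nhds[of "T_value \<rho> X"])
    then show "\<forall>\<^sub>F z in nhds p. cmod (T_value \<rho> X z) < cmod (T_value \<rho> X p) + 1"
      by (rule order_tendstoD) simp
  qed
  then have "\<forall>\<^sub>F z in nhds p. Lam \<rho> M k z \<le> sqrt (\<Sum>X\<in>M k. (b X)\<^sup>2)"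
  proof eventually_elim
    case (elim z)
    have "cmod (T_coeff \<rho> X z) \<le> b X" if "X \<in> M k" for X
    proof -
      have "cmod (T_value \<rho> X z) \<le> b X"
        using elim that unfolding b_def by (metis add_increasing2 less_imp_le norm_ge_zero)
      moreover have "cmod (THE l. False) \<le> b X" unfolding b_def by simp
      moreover have "T_coeff \<rho> X z = T_value \<rho> X z \<or> T_coeff \<rho> X z = (THE l. False)"
        using T_coeff_cases nz elim by blast
      ultimately show ?thesis by metis
    qed
    then show ?case unfolding Lam_def by (intro real_sqrt_le_mono sum_mono power_mono) auto
  qed
  then show ?thesis by blast
qed

section \<open>The Levi form as a commutator coefficient\<close>

lemma frechet_of_real:
  assumes "(f has_derivative D) (at x)"
  shows "frechet_derivative (\<lambda>z. complex_of_real (f z)) (at x) v = of_real (D v)"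
  by (rule fun_cong[OF has_derivative_imp_frechet[OF bounded_linear.has_derivative[OF bounded_linear_of_real assms]]])

lemma rdz_eq:
  assumes "(\<rho> has_derivative D) (at z)"
  shows "rdz j \<rho> z = (of_real (D (axis j 1)) - \<i> * of_real (D (axis j \<i>))) / 2"
    and "rdzbar j \<rho> z = (of_real (D (axis j 1)) + \<i> * of_real (D (axis j \<i>))) / 2"
  unfolding dz_def dzbar_def frechet_of_real[OF assms] by simp_all

text \<open>The entry of the Levi matrix, the second derivative of \<open>\<rho>\<close> in z_j and
  the conjugate of z_k, in terms of real second derivatives.\<close>

definition levi_entry :: "(c2 \<Rightarrow> real) \<Rightarrow> 2 \<Rightarrow> 2 \<Rightarrow> c2 \<Rightarrow> complex" where
  "levi_entry \<rho> j k z = (of_real (hess \<rho> z (axis j 1) (axis k 1) + hess \<rho> z (axis j \<i>) (axis k \<i>))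
     + \<i> * of_real (hess \<rho> z (axis j 1) (axis k \<i>) - hess \<rho> z (axis j \<i>) (axis k 1))) / 4"

text \<open>The two orders of differentiation agree by symmetry of the real Hessian. Both are
  needed, since the bracket differentiates the coefficients of each field along the other.\<close>

lemma second_wirtinger:
  assumes U: "open U" "Ck_on 2 U \<rho>" and z: "z \<in> U"
  shows "dzbar k (rdz j \<rho>) z = levi_entry \<rho> j k z" and "dz j (rdzbar k \<rho>) z = levi_entry \<rho> j k z"
proof -
  let ?D = "\<lambda>w v. frechet_derivative \<rho> (at w) v"
  have d: "((\<lambda>w. complex_of_real (?D w v)) has_derivative (\<lambda>u. of_real (hess \<rho> z v u))) (at z)" for v
    by (rule bounded_linear.has_derivative[OF bounded_linear_of_real C2_derivatives(2)[OF U(2) z]])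
  have dm: "((\<lambda>w. (of_real (?D w (axis l 1)) - \<i> * of_real (?D w (axis l \<i>))) / 2) has_derivative
      (\<lambda>u. (of_real (hess \<rho> z (axis l 1) u) - \<i> * of_real (hess \<rho> z (axis l \<i>) u)) / 2)) (at z)" for l :: 2
    by (rule bounded_linear.has_derivative[OF bounded_linear_divide
        has_derivative_diff[OF d bounded_linear.has_derivative[OF bounded_linear_mult_right d]]])
  have dp: "((\<lambda>w. (of_real (?D w (axis l 1)) + \<i> * of_real (?D w (axis l \<i>))) / 2) has_derivative
      (\<lambda>u. (of_real (hess \<rho> z (axis l 1) u) + \<i> * of_real (hess \<rho> z (axis l \<i>) u)) / 2)) (at z)" for l :: 2
    by (rule bounded_linear.has_derivative[OF bounded_linear_divide
        has_derivative_add[OF d bounded_linear.has_derivative[OF bounded_linear_mult_right d]]])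
  have 1: "frechet_derivative (rdz l \<rho>) (at z) u = (of_real (hess \<rho> z (axis l 1) u) - \<i> * of_real (hess \<rho> z (axis l \<i>) u)) / 2" for l u
    by (rule fun_cong[OF has_derivative_imp_frechet[OF has_derivative_transform_within_open[OF dm U(1) z]]])
      (rule rdz_eq(1)[OF C2_derivatives(1)[OF U(2)], symmetric])
  have 2: "frechet_derivative (rdzbar l \<rho>) (at z) u = (of_real (hess \<rho> z (axis l 1) u) + \<i> * of_real (hess \<rho> z (axis l \<i>) u)) / 2" for l u
    by (rule fun_cong[OF has_derivative_imp_frechet[OF has_derivative_transform_within_open[OF dp U(1) z]]])
      (rule rdz_eq(2)[OF C2_derivatives(1)[OF U(2)], symmetric])
  show "dzbar k (rdz j \<rho>) z = levi_entry \<rho> j k z"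
    unfolding dzbar_def[of k "rdz j \<rho>"] 1 levi_entry_def by (simp add: complex_eq_iff)
  have s: "hess \<rho> z (axis k a) (axis j b) = hess \<rho> z (axis j b) (axis k a)" for a b
    by (rule hess_symmetric[OF U z])
  show "dz j (rdzbar k \<rho>) z = levi_entry \<rho> j k z"
    unfolding dz_def[of j "rdzbar k \<rho>"] 2 levi_entry_def s by (simp add: complex_eq_iff)
qed

lemma dz_minus:
  assumes "(f has_derivative D) (at z)"
  shows "dz j (\<lambda>w. - f w) z = - dz j f z" "dzbar j (\<lambda>w. - f w) z = - dzbar j f z"
  using has_derivative_imp_frechet[OF assms] has_derivative_imp_frechet[OF has_derivative_minus[OF assms]]
  by (simp_all add: dz_def dzbar_def field_simps)

lemma dz_zero: "dz j (\<lambda>w. 0) z = 0" "dzbar j (\<lambda>w. 0) z = 0"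
  by (simp_all add: dz_def dzbar_def)

lemma levi_bracket:
  assumes U: "open U" "smooth_on U \<rho>" and z: "z \<in> U"
  defines "r \<equiv> \<lambda>j. rdz j \<rho> z" and "rb \<equiv> \<lambda>j. rdzbar j \<rho> z" and "Q \<equiv> \<lambda>j k. levi_entry \<rho> j k z"
  shows "lie_bracket (L_field \<rho>) (Lbar_field \<rho>) z = vector [rb 1 * Q 2 2 - rb 2 * Q 2 1,
     rb 2 * Q 1 1 - rb 1 * Q 1 2, r 2 * Q 1 2 - r 1 * Q 2 2, r 1 * Q 2 1 - r 2 * Q 1 1]"
proof -
  have C2: "Ck_on 2 U \<rho>" using U by (simp add: smooth_on_def)
  note w = second_wirtinger[OF U(1) C2 z]
  have d: "(rdz j \<rho> has_derivative frechet_derivative (rdz j \<rho>) (at z)) (at z)"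
     "(rdzbar j \<rho> has_derivative frechet_derivative (rdzbar j \<rho>) (at z)) (at z)" for j
    by (rule smooth_on_imp_derivative[OF _ z], rule smooth_on_dz smooth_on_dzbar, rule U(1), rule smooth_on_of_real[OF U])+
  note m = dz_minus[OF d(1)] dz_minus[OF d(2)]
  show ?thesis
    unfolding vec_eq_iff forall_4 lie_bracket_def vec_lambda_beta vf_apply_def L_field_def Lbar_field_def vector_4
      dz_zero m w r_def rb_def Q_def
    by (simp add: algebra_simps)
qed

lemma annihilates_L:
  "annihilates \<rho> (L_field \<rho>) z" "annihilates \<rho> (Lbar_field \<rho>) z"
  by (simp_all add: annihilates_def L_field_def Lbar_field_def)

lemma annihilates_levi_bracket:
  assumes "open U" "smooth_on U \<rho>" "z \<in> U"
  shows "annihilates \<rho> (lie_bracket (L_field \<rho>) (Lbar_field \<rho>)) z"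
  unfolding annihilates_def levi_bracket[OF assms] vector_4 by (simp add: algebra_simps)

lemma iterated_commutator_pos: "iterated_commutator \<rho> k X \<Longrightarrow> 1 \<le> k"
  by (induction rule: iterated_commutator.induct) auto

lemma iterated_commutator_1: "iterated_commutator \<rho> 1 X \<Longrightarrow> X = L_field \<rho> \<or> X = Lbar_field \<rho>"
  by (erule iterated_commutator.cases) (auto dest: iterated_commutator_pos)

lemma lie_bracket_self: "lie_bracket X X z = 0"
  by (simp add: lie_bracket_def vec_eq_iff)

lemma lie_bracket_anti: "lie_bracket X Y z = - lie_bracket Y X z"
  by (simp add: lie_bracket_def vec_eq_iff)

text \<open>By listing: in degree 2 the brackets are zero or plus or minus the bracket of
  \<open>L_field\<close> with \<open>Lbar_field\<close>. This covers all members of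
  \<open>M 2\<close>.\<close>

lemma annihilates_degree_le_2:
  assumes U: "open U" "smooth_on U \<rho>" "z \<in> U" and X: "iterated_commutator \<rho> j X" "j \<le> 2"
  shows "annihilates \<rho> X z"
proof -
  have neg: "annihilates \<rho> X z" if "annihilates \<rho> Y z" "X z = - Y z" for X Y
  proof -
    have "rdz 1 \<rho> z * X z $ 1 + rdz 2 \<rho> z * X z $ 2 + rdzbar 1 \<rho> z * X z $ 3 + rdzbar 2 \<rho> z * X z $ 4
      = - (rdz 1 \<rho> z * Y z $ 1 + rdz 2 \<rho> z * Y z $ 2 + rdzbar 1 \<rho> z * Y z $ 3 + rdzbar 2 \<rho> z * Y z $ 4)"
      by (simp add: that(2))
    then show ?thesis using that(1) by (simp only: annihilates_def) simp
  qed
  have zero: "annihilates \<rho> X z" if "X z = 0" for X using that by (simp add: annihilates_def)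
  note lb = annihilates_levi_bracket[OF U]
  have lb': "annihilates \<rho> (lie_bracket (Lbar_field \<rho>) (L_field \<rho>)) z"
    by (rule neg[OF lb]) (rule lie_bracket_anti)
  have self: "annihilates \<rho> (lie_bracket Z Z) z" for Z by (rule zero) (rule lie_bracket_self)
  have one: "Y = L_field \<rho> \<or> Y = Lbar_field \<rho>" if "iterated_commutator \<rho> k Y" "Suc k = j" for k Y
    using that X(2) iterated_commutator_pos[OF that(1)] iterated_commutator_1[of \<rho> Y] by (cases "k = 1") auto
  from X(1) show ?thesis
  proof cases
    case (3 k Y)
    then show ?thesis using one[OF 3(3)] self lb by auto
  next
    case (4 k Y)
    then show ?thesis using one[OF 4(3)] self lb' by auto
  qed (auto simp: annihilates_L)
qed

text \<open>A sum over an infinite set is 0 by convention, so the constant coefficient 1 would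
  violate independence.\<close>

lemma independent_fields_finite: "independent_fields W B \<Longrightarrow> finite B"
proof (rule ccontr)
  assume B: "independent_fields W B" "infinite B"
  then obtain X where X: "X \<in> B" by fastforce
  have "\<forall>z\<in>W. (\<Sum>X\<in>B. (\<lambda>_. 1) X *s X z) = 0" using B(2) by simp
  then have "\<forall>X\<in>B. (\<lambda>_::cvf. 1::complex) X = 0"
    by (rule B(1)[unfolded independent_fields_def, THEN spec, THEN mp])
  then show False using X by auto
qed

text \<open>Maximality gives a relation with constant coefficients, and independence of
  \<open>B\<close> forces the coefficient of \<open>X\<close> in it to be nonzero.\<close>

lemma commutator_basis_spans:
  assumes B: "commutator_basis \<rho> W k B" and X: "iterated_commutator \<rho> j X" "j \<le> k"
  obtains a where "\<And>z. z \<in> W \<Longrightarrow> X z = (\<Sum>Y\<in>B. a Y *s Y z)"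
proof (cases "X \<in> B")
  case True
  have fin: "finite B" using B independent_fields_finite by (auto simp: commutator_basis_def)
  have "X z = (\<Sum>Y\<in>B. (if Y = X then 1 else 0) *s Y z)" for z
  proof -
    have "(\<Sum>Y\<in>B. (if Y = X then 1 else 0) *s Y z) = (\<Sum>Y\<in>B. if Y = X then X z else 0)"
      by (intro sum.cong) (auto simp: vec_eq_iff)
    then show ?thesis using fin True by simp
  qed
  then show ?thesis by (rule that)
next
  case False
  have ind: "independent_fields W B" using B by (simp add: commutator_basis_def)
  have fin: "finite B" by (rule independent_fields_finite[OF ind])
  have "\<not> independent_fields W (insert X B)" using B X False unfolding commutator_basis_def by blast
  then obtain c Y where c: "\<And>z. z \<in> W \<Longrightarrow> (\<Sum>Z\<in>insert X B. c Z *s Z z) = 0" and Y: "Y \<in> insert X B" "c Y \<noteq> 0"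
    unfolding independent_fields_def by blast
  have c': "c X *s X z + (\<Sum>Z\<in>B. c Z *s Z z) = 0" if "z \<in> W" for z
    using c[OF that] fin False by simp
  have cX: "c X \<noteq> 0"
  proof
    assume 0: "c X = 0"
    have "(\<Sum>Z\<in>B. c Z *s Z z) = 0" if "z \<in> W" for z using c'[OF that] 0 by simp
    then have "\<forall>Z\<in>B. c Z = 0" using ind unfolding independent_fields_def by blast
    then show False using Y 0 by auto
  qed
  have "X z = (\<Sum>Z\<in>B. (- c Z / c X) *s Z z)" if z: "z \<in> W" for z
  proof -
    have "c X *s X z = - (\<Sum>Z\<in>B. c Z *s Z z)" using c'[OF z] by (simp add: add_eq_0_iff)
    then have "(1 / c X) *s (c X *s X z) = (1 / c X) *s (- (\<Sum>Z\<in>B. c Z *s Z z))" by simp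
    then show ?thesis using cX
      by (simp add: vec_eq_iff sum_distrib_left sum_negf[symmetric])
  qed
  then show ?thesis by (rule that)
qed

lemma cmod_T_coeff_le_Lam:
  assumes "finite (M k)" "Y \<in> M k"
  shows "cmod (T_coeff \<rho> Y z) \<le> Lam \<rho> M k z"
proof -
  have "(cmod (T_coeff \<rho> Y z))\<^sup>2 \<le> (\<Sum>X\<in>M k. (cmod (T_coeff \<rho> X z))\<^sup>2)"
    using assms by (intro member_le_sum) auto
  then show ?thesis unfolding Lam_def by (rule real_le_rsqrt)
qed

lemma T_value_sum:
  assumes "X z = (\<Sum>Y\<in>B. a Y *s Y z)"
  shows "T_value \<rho> X z = (\<Sum>Y\<in>B. a Y * T_value \<rho> Y z)"
proof -
  have "rdz 1 \<rho> z * X z $ 1 + rdz 2 \<rho> z * X z $ 2 = (\<Sum>Y\<in>B. a Y * (rdz 1 \<rho> z * Y z $ 1 + rdz 2 \<rho> z * Y z $ 2))"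
    by (simp add: assms sum_distrib_left sum.distrib[symmetric] algebra_simps)
  then show ?thesis by (simp only: T_value_def sum_divide_distrib times_divide_eq_right)
qed

context touching_domain
begin

lemma smooth_\<rho>: "smooth_on U \<rho>"
  using def_fun by (simp add: defining_function_def)

text \<open>At \<open>p\<close> the second derivative coefficient of \<open>\<rho>\<close> vanishes,
  so the \<open>T\<close> coefficient of the bracket is \<open>levi_entry \<rho> 2 2 p\<close>,
  positive by \<open>hess_tangent\<close> in the two real directions of the second axis. The bracket
  is a constant combination of \<open>M 2\<close>, which carries the bound over to
  \<open>Lam\<close> for every choice of the family.\<close>

lemma Lam2_lower_bound:
  assumes p: "p = vector [1, 0]" and V: "open V" "V \<subseteq> U" "p \<in> V"
    and nz: "\<And>z. z \<in> V \<Longrightarrow> rdz 1 \<rho> z \<noteq> 0 \<and> rdzbar 1 \<rho> z \<noteq> 0"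
    and M: "commutator_basis \<rho> V 2 (M 2)"
  obtains m where "0 < m" "\<forall>\<^sub>F z in nhds p. m \<le> Lam \<rho> M 2 z"
proof -
  let ?X = "lie_bracket (L_field \<rho>) (Lbar_field \<rho>)"
  have X: "iterated_commutator \<rho> 2 ?X"
    using iterated_commutator.intros(3)[OF iterated_commutator.intros(2)] by (simp add: numeral_2_eq_2)
  obtain a where a: "\<And>z. z \<in> V \<Longrightarrow> ?X z = (\<Sum>Y\<in>M 2. a Y *s Y z)"
    using commutator_basis_spans[OF M X] by auto
  have fin: "finite (M 2)" using M independent_fields_finite by (auto simp: commutator_basis_def)
  define A where "A = (\<Sum>Y\<in>M 2. cmod (a Y)) + 1"
  have A: "0 < A" unfolding A_def by (intro add_nonneg_pos sum_nonneg) auto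
  have le: "cmod (T_value \<rho> ?X z) \<le> A * Lam \<rho> M 2 z" if z: "z \<in> V" for z
  proof -
    have zU: "z \<in> U" using z V by auto
    have "cmod (T_value \<rho> ?X z) \<le> (\<Sum>Y\<in>M 2. cmod (a Y * T_value \<rho> Y z))"
      unfolding T_value_sum[where X = ?X, OF a[OF z]] by (rule norm_sum)
    also have "\<dots> \<le> (\<Sum>Y\<in>M 2. cmod (a Y) * Lam \<rho> M 2 z)"
    proof (rule sum_mono)
      fix Y assume Y: "Y \<in> M 2"
      then obtain j where "j \<le> 2" "iterated_commutator \<rho> j Y" using M unfolding commutator_basis_def by blast
      then have "annihilates \<rho> Y z" using annihilates_degree_le_2[OF U(1) smooth_\<rho> zU] by blast
      then have "T_coeff \<rho> Y z = T_value \<rho> Y z" using T_coeff_annihilates nz[OF z] by blast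
      then have "cmod (T_value \<rho> Y z) \<le> Lam \<rho> M 2 z" using cmod_T_coeff_le_Lam[where M = M and k = 2, OF fin Y, of \<rho> z] by simp
      then show "cmod (a Y * T_value \<rho> Y z) \<le> cmod (a Y) * Lam \<rho> M 2 z"
        unfolding norm_mult by (rule mult_left_mono) simp
    qed
    also have "\<dots> = (\<Sum>Y\<in>M 2. cmod (a Y)) * Lam \<rho> M 2 z" by (simp add: sum_distrib_right)
    also have "\<dots> \<le> A * Lam \<rho> M 2 z" by (intro mult_right_mono Lam_nonneg) (simp add: A_def)
    finally show ?thesis .
  qed
  have p_axis: "p \<bullet> axis 1 w = Re w" "p \<bullet> axis 2 w = 0" for w
    by (simp_all add: p inner_axis inner_complex_def)
  note rd = rdz_eq[OF deriv_\<rho>[OF U(3)]]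
  have r: "rdz 1 \<rho> p = of_real c / 2" "rdz 2 \<rho> p = 0" "rdzbar 1 \<rho> p = of_real c / 2" "rdzbar 2 \<rho> p = 0"
    unfolding rd normal p_axis by simp_all
  have "T_value \<rho> ?X p = levi_entry \<rho> 2 2 p"
    unfolding T_value_def levi_bracket[OF U(1) smooth_\<rho> U(3)] r using c by simp
  moreover have "0 < Re (levi_entry \<rho> 2 2 p)"
  proof -
    have n: "(norm (axis 2 w :: c2))\<^sup>2 = (cmod w)\<^sup>2" for w by (simp add: norm_c2 axis_def)
    have "c \<le> hess \<rho> p (axis 2 1) (axis 2 1)" "c \<le> hess \<rho> p (axis 2 \<i>) (axis 2 \<i>)"
      using hess_tangent[OF p_axis(2), of 1] hess_tangent[OF p_axis(2), of \<i>] by (simp_all add: n)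
    then show ?thesis using c by (simp add: levi_entry_def)
  qed
  ultimately have pos: "0 < cmod (T_value \<rho> ?X p)" by auto
  have "smooth_field U ?X" by (rule smooth_iterated_commutator[OF U(1) smooth_\<rho> X])
  then have "isCont (T_value \<rho> ?X) p" using T_value_continuous[OF U(1) smooth_\<rho>] U(3) nz V by blast
  then have "((\<lambda>z. cmod (T_value \<rho> ?X z)) \<longlongrightarrow> cmod (T_value \<rho> ?X p)) (nhds p)"
    by (intro tendsto_norm) (simp add: isCont_def tendsto_at_iff_tendsto_nhds[of "T_value \<rho> ?X"])
  then have "\<forall>\<^sub>F z in nhds p. cmod (T_value \<rho> ?X p) / 2 < cmod (T_value \<rho> ?X z)"
    by (rule order_tendstoD) (use pos in simp)
  moreover have "\<forall>\<^sub>F z in nhds p. z \<in> V" using V by (intro eventually_nhds_in_open)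
  ultimately have "\<forall>\<^sub>F z in nhds p. cmod (T_value \<rho> ?X p) / 2 / A \<le> Lam \<rho> M 2 z"
  proof eventually_elim
    case (elim z)
    then have "cmod (T_value \<rho> ?X p) / 2 \<le> A * Lam \<rho> M 2 z" using le[of z] by linarith
    then show ?case using A by (simp add: pos_divide_le_eq mult.commute)
  qed
  then show ?thesis using that[of "cmod (T_value \<rho> ?X p) / 2 / A"] pos A by simp
qed

end

text \<open>Commutators of degree 1 have no \<open>T\<close> component. The result puts the index 2
  into the ranges of \<open>D_fun\<close> and \<open>Lam_sum\<close>.\<close>

lemma domain_type_ge_2:
  assumes p: "p \<in> frontier \<Omega>" "rdz 1 \<rho> p \<noteq> 0"
  shows "2 \<le> domain_type \<rho> \<Omega>"
proof -
  have "(2::enat) \<le> chart_type \<rho> p"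
    unfolding chart_type_def
  proof (rule Inf_greatest)
    fix t :: enat assume "t \<in> {enat k | k. \<exists>W M. open W \<and> p \<in> W \<and> (\<forall>z\<in>W. rdz 1 \<rho> z \<noteq> 0 \<and> rdzbar 1 \<rho> z \<noteq> 0) \<and>
      (\<forall>j. commutator_basis \<rho> W j (M j)) \<and> Lam \<rho> M k p \<noteq> 0}"
    then obtain k W M where t: "t = enat k" and W: "p \<in> W" "\<forall>z\<in>W. rdz 1 \<rho> z \<noteq> 0 \<and> rdzbar 1 \<rho> z \<noteq> 0"
      and M': "\<forall>j. commutator_basis \<rho> W j (M j)" and L: "Lam \<rho> M k p \<noteq> 0"
      unfolding mem_Collect_eq by blast
    have M: "commutator_basis \<rho> W k (M k)" using M' by blast
    have "2 \<le> k"
    proof (rule ccontr)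
      assume "\<not> 2 \<le> k"
      then have k: "k \<le> 1" by simp
      have "T_coeff \<rho> X p = 0" if X: "X \<in> M k" for X
      proof -
        obtain j where j: "j \<le> k" "iterated_commutator \<rho> j X" using M X unfolding commutator_basis_def by blast
        then have "j = 1" using iterated_commutator_pos k by fastforce
        then have X': "X = L_field \<rho> \<or> X = Lbar_field \<rho>" using j iterated_commutator_1 by blast
        have "annihilates \<rho> X p" using X' annihilates_L by blast
        then have "T_coeff \<rho> X p = T_value \<rho> X p" using T_coeff_annihilates W by blast
        also have "\<dots> = 0" using X' by (auto simp: T_value_def L_field_def Lbar_field_def)
        finally show ?thesis .
      qed
      then show False using L by (simp add: Lam_def)
    qed
    then have "enat 2 \<le> enat k" by simp
    then show "2 \<le> t" unfolding t numeral_eq_enat .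
  qed
  then have "2 \<le> point_type \<rho> p" using p by (simp add: point_type_def)
  also have "\<dots> \<le> domain_type \<rho> \<Omega>" unfolding domain_type_def by (rule SUP_upper[OF p(1)])
  finally show ?thesis .
qed

section \<open>Polarization\<close>

lemma quadratic_bound_has_derivative_zero:
  assumes "\<And>z. dist z w < e \<Longrightarrow> norm (f z) \<le> K * (norm (z - w))\<^sup>2" "0 < e"
  shows "(f has_derivative (\<lambda>v. 0)) (at w)"
proof -
  have f0: "f w = 0" using assms(1)[of w] assms(2) by simp
  have "((\<lambda>z. K * norm (z - w)) \<longlongrightarrow> K * norm (w - w)) (at w)" by (intro tendsto_intros)
  then have lim: "((\<lambda>z. K * norm (z - w)) \<longlongrightarrow> 0) (at w)" by simp
  show ?thesis
  proof (rule has_derivativeI_sandwich[OF assms(2) _ _ lim])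
    fix z assume z: "z \<noteq> w" "dist z w < e"
    have "norm (f z) / norm (z - w) \<le> K * (norm (z - w))\<^sup>2 / norm (z - w)"
      by (intro divide_right_mono assms(1) z) simp
    also have "\<dots> = K * norm (z - w)" using z by (simp add: power2_eq_square)
    finally show "norm (f z - f w - 0) / norm (z - w) \<le> K * norm (z - w)" by (simp add: f0)
  qed simp
qed

lemma flat_on_diagonalD:
  assumes "flat_on_diagonal U g" "w \<in> U"
  obtains e K where "0 < e" "\<And>z. dist z w < e \<Longrightarrow> cmod (g z w) \<le> K * norm (z - w) ^ N"
proof -
  have "(\<lambda>(z, w). cmod (g z w)) \<in> O[nhds (w, w)](\<lambda>(z, w). norm (z - w) ^ N)"
    using assms unfolding flat_on_diagonal_def by blast
  then obtain K where "\<forall>\<^sub>F x in nhds (w, w). norm ((\<lambda>(z, w). cmod (g z w)) x) \<le> K * norm ((\<lambda>(z, w). norm (z - w) ^ N) x)"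
    unfolding bigo_def by blast
  then obtain e where e: "0 < e" "\<And>x. dist x (w, w) < e \<Longrightarrow> norm ((\<lambda>(z, w). cmod (g z w)) x) \<le> K * norm ((\<lambda>(z, w). norm (z - w) ^ N) x)"
    unfolding eventually_nhds_metric by blast
  have "cmod (g z w) \<le> K * norm (z - w) ^ N" if "dist z w < e" for z
    using e(2)[of "(z, w)"] that by (simp add: dist_Pair_Pair)
  then show ?thesis using that e(1) by blast
qed

context touching_domain
begin

text \<open>Let \<open>A\<close> and \<open>B\<close> be the partial differentials in the two
  arguments. Hermitian symmetry on the diagonal gives \<open>A v = cnj (B v)\<close>, and the
  diagonal values give A + B = d\<rho>, so the real part of \<open>A\<close> is half of d\<rho>.
  Vanishing of the antiholomorphic derivative makes \<open>A\<close> complex linear, and such a form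
  is determined by its real part.\<close>

lemma polarization_derivative:
  assumes R: "polarization \<rho> U R" and w: "w \<in> U"
    and F': "((\<lambda>(z, w). R z w) has_derivative F') (at (w, w))"
  shows "F' (v, 0) = hpair (grad \<rho> w) v / 2"
proof -
  define A where "A v = F' (v, 0)" for v
  define B where "B v = F' (0, v)" for v
  have lin: "linear F'" using F' has_derivative_linear by blast
  have F'_eq: "F' (v, u) = A v + B u" for v u
    using linear_add[OF lin, of "(v, 0)" "(0, u)"] by (simp add: A_def B_def)
  have linA: "linear A"
  proof (rule linearI)
    show "A (x + y) = A x + A y" for x y using linear_add[OF lin, of "(x, 0)" "(y, 0)"] by (simp add: A_def)
    show "A (r *\<^sub>R x) = r *\<^sub>R A x" for r x using linear_scale[OF lin, of r "(x, 0)"] by (simp add: A_def)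
  qed
  have dA: "((\<lambda>z. R z w) has_derivative A) (at w)"
  proof -
    have "((\<lambda>z. (z, w)) has_derivative (\<lambda>v. (v, 0))) (at w)"
      by (intro has_derivative_Pair has_derivative_ident has_derivative_const)
    from has_derivative_compose[OF this, of "\<lambda>(z, w). R z w" F'] F' show ?thesis by (simp add: A_def[abs_def])
  qed
  have dB: "((\<lambda>z. R w z) has_derivative B) (at w)"
  proof -
    have "((\<lambda>z. (w, z)) has_derivative (\<lambda>v. (0, v))) (at w)"
      by (intro has_derivative_Pair has_derivative_ident has_derivative_const)
    from has_derivative_compose[OF this, of "\<lambda>(z, w). R z w" F'] F' show ?thesis by (simp add: B_def[abs_def])
  qed
  have AB: "A v = cnj (B v)" for v
  proof -
    have flat: "flat_on_diagonal U (\<lambda>z w. R z w - cnj (R w z))" using R by (simp add: polarization_def)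
    obtain e K where e: "0 < e" "\<And>z. dist z w < e \<Longrightarrow> cmod (R z w - cnj (R w z)) \<le> K * (norm (z - w))\<^sup>2"
      using flat_on_diagonalD[OF flat w, of 2] by blast
    have "((\<lambda>z. R z w - cnj (R w z)) has_derivative (\<lambda>v. 0)) (at w)"
      by (rule quadratic_bound_has_derivative_zero[OF e(2,1)])
    moreover have "((\<lambda>z. R z w - cnj (R w z)) has_derivative (\<lambda>v. A v - cnj (B v))) (at w)"
      by (rule has_derivative_diff[OF dA bounded_linear.has_derivative[OF bounded_linear_cnj dB]])
    ultimately have "(\<lambda>v. 0) = (\<lambda>v. A v - cnj (B v))" by (rule has_derivative_unique)
    then show ?thesis by (metis eq_iff_diff_eq_0)
  qed
  have re: "grad \<rho> w \<bullet> v = 2 * Re (A v)" for v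
  proof -
    have d1: "((\<lambda>z. R z z) has_derivative (\<lambda>v. A v + B v)) (at w)"
    proof -
      have "((\<lambda>z. (z, z)) has_derivative (\<lambda>v. (v, v))) (at w)"
        by (intro has_derivative_Pair has_derivative_ident)
      from has_derivative_compose[OF this, of "\<lambda>(z, w). R z w" F'] F' show ?thesis by (simp add: F'_eq)
    qed
    have "((\<lambda>z. complex_of_real (\<rho> z)) has_derivative (\<lambda>v. A v + B v)) (at w)"
      by (rule has_derivative_transform_within_open[OF d1 U(1) w]) (use R in \<open>simp add: polarization_def\<close>)
    moreover have "((\<lambda>z. complex_of_real (\<rho> z)) has_derivative (\<lambda>v. of_real (frechet_derivative \<rho> (at w) v))) (at w)"
      by (rule bounded_linear.has_derivative[OF bounded_linear_of_real deriv_\<rho>[OF w]])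
    ultimately have "(\<lambda>v. A v + B v) = (\<lambda>v. of_real (frechet_derivative \<rho> (at w) v))" by (rule has_derivative_unique)
    then have "A v + B v = of_real (grad \<rho> w \<bullet> v)" unfolding deriv_grad[OF w] by (rule fun_cong)
    then have "Re (A v) + Re (B v) = grad \<rho> w \<bullet> v" by (metis Re_complex_of_real plus_complex.simps(1))
    then show ?thesis using AB[of v] by simp
  qed
  have cr: "A (axis j \<i>) = \<i> * A (axis j 1)" for j
  proof -
    have flat: "flat_on_diagonal U (\<lambda>z w. dzbar j (\<lambda>\<xi>. R \<xi> w) z)" using R by (simp add: polarization_def)
    obtain e K where e: "0 < e" "\<And>z. dist z w < e \<Longrightarrow> cmod (dzbar j (\<lambda>\<xi>. R \<xi> w) z) \<le> K * norm (z - w) ^ 1"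
      using flat_on_diagonalD[OF flat w, of 1] by blast
    have "dzbar j (\<lambda>\<xi>. R \<xi> w) w = 0" using e(2)[of w] e(1) by simp
    then have "A (axis j 1) + \<i> * A (axis j \<i>) = 0"
      unfolding dzbar_def has_derivative_imp_frechet[OF dA] by simp
    then have "\<i> * (A (axis j 1) + \<i> * A (axis j \<i>)) = 0" by simp
    then show ?thesis by (simp add: distrib_left mult.assoc[symmetric])
  qed
  have axis_val: "A (axis j 1) = cnj (grad \<rho> w $ j) / 2" for j
  proof -
    have "2 * Re (A (axis j 1)) = Re (grad \<rho> w $ j)"
      using re[of "axis j 1"] by (simp add: inner_axis inner_complex_def)
    moreover have "2 * Re (A (axis j \<i>)) = Im (grad \<rho> w $ j)"
      using re[of "axis j \<i>"] by (simp add: inner_axis inner_complex_def)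
    ultimately show ?thesis unfolding cr by (simp add: complex_eq_iff)
  qed
  have axis_c: "A (axis j x) = x * A (axis j 1)" for j x
  proof -
    have "axis j x = Re x *\<^sub>R axis j 1 + Im x *\<^sub>R (axis j \<i> :: c2)"
      by (simp add: vec_eq_iff axis_def complex_eq_iff)
    then have "A (axis j x) = Re x *\<^sub>R A (axis j 1) + Im x *\<^sub>R (\<i> * A (axis j 1))"
      by (simp only: linear_add[OF linA] linear_scale[OF linA] cr)
    then show ?thesis by (simp add: complex_eq_iff)
  qed
  have "v = axis 1 (v $ 1) + axis 2 (v $ 2)" by (simp add: vec_eq_iff forall_2 axis_def)
  then have "A v = v $ 1 * A (axis 1 1) + v $ 2 * A (axis 2 1)"
    by (metis linear_add[OF linA] axis_c)
  then show ?thesis unfolding axis_val by (simp add: A_def hpair_def field_simps)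
qed

text \<open>Taylor's formula at \<open>(w, w)\<close>, where \<open>R\<close> vanishes. The linear
  term is based at the second argument \<open>w\<close>.\<close>

lemma polarization_bound:
  assumes R: "polarization \<rho> U R"
  obtains r B where "0 < r" "0 < B"
    "\<And>\<zeta> w. \<zeta> \<in> frontier \<Omega> \<Longrightarrow> w \<in> frontier \<Omega> \<Longrightarrow> \<zeta> \<in> ball p r \<Longrightarrow> w \<in> ball p r \<Longrightarrow>
      cmod (R \<zeta> w) \<le> B * (cmod (hpair (grad \<rho> w) (\<zeta> - w)) + (norm (\<zeta> - w))\<^sup>2)"
proof -
  let ?F = "\<lambda>(z, w). R z w"
  have op: "open (U \<times> U)" by (intro open_Times U)
  have F: "Ck_on 2 (U \<times> U) ?F" using R by (simp add: polarization_def smooth_on_def)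
  have pp: "(p, p) \<in> U \<times> U" using U by simp
  obtain r B where r: "0 < r" "0 \<le> B" "ball (p, p) r \<subseteq> U \<times> U"
    and b: "\<And>x y. x \<in> ball (p, p) r \<Longrightarrow> y \<in> ball (p, p) r \<Longrightarrow>
      norm (?F y - ?F x - frechet_derivative ?F (at x) (y - x)) \<le> B * (norm (y - x))\<^sup>2"
    using C2_local_bounds[OF op F pp] by metis
  have mem: "(x, y) \<in> ball (p, p) r" if "x \<in> ball p (r / 2)" "y \<in> ball p (r / 2)" for x y
  proof -
    have "dist (p, p) (x, y) \<le> \<bar>dist p x\<bar> + \<bar>dist p y\<bar>" unfolding dist_Pair_Pair by (rule sqrt_sum_squares_le_sum_abs)
    then show ?thesis using that by simp
  qed
  show ?thesis
  proof
    show "0 < r / 2" "0 < B + 1" using r by auto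
    fix \<zeta> w assume f: "\<zeta> \<in> frontier \<Omega>" "w \<in> frontier \<Omega>" and bl: "\<zeta> \<in> ball p (r / 2)" "w \<in> ball p (r / 2)"
    have wU: "w \<in> U" using f U by auto
    have "(?F has_derivative frechet_derivative ?F (at (w, w))) (at (w, w))"
      by (rule C2_derivatives(1)[OF F]) (use wU in simp)
    then have d: "frechet_derivative ?F (at (w, w)) (\<zeta> - w, 0) = hpair (grad \<rho> w) (\<zeta> - w) / 2"
      by (rule polarization_derivative[OF R wU])
    have Rw: "R w w = 0" using R wU \<rho>_frontier[OF f(2)] by (simp add: polarization_def)
    have "cmod (R \<zeta> w - hpair (grad \<rho> w) (\<zeta> - w) / 2) \<le> B * (norm (\<zeta> - w))\<^sup>2"
      using b[OF mem[OF bl(2) bl(2)] mem[OF bl]] by (simp add: d Rw norm_Pair)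
    then have "cmod (R \<zeta> w) \<le> cmod (hpair (grad \<rho> w) (\<zeta> - w) / 2) + B * (norm (\<zeta> - w))\<^sup>2"
      using norm_triangle_sub[of "R \<zeta> w" "hpair (grad \<rho> w) (\<zeta> - w) / 2"] by linarith
    also have "cmod (hpair (grad \<rho> w) (\<zeta> - w) / 2) = cmod (hpair (grad \<rho> w) (\<zeta> - w)) / 2" by (simp add: norm_divide)
    also have "\<dots> + B * (norm (\<zeta> - w))\<^sup>2 \<le> (B + 1) * (cmod (hpair (grad \<rho> w) (\<zeta> - w)) + (norm (\<zeta> - w))\<^sup>2)"
      using mult_nonneg_nonneg[OF r(2) norm_ge_zero[of "hpair (grad \<rho> w) (\<zeta> - w)"]] by (simp add: algebra_simps add_increasing)
    finally show "cmod (R \<zeta> w) \<le> (B + 1) * (cmod (hpair (grad \<rho> w) (\<zeta> - w)) + (norm (\<zeta> - w))\<^sup>2)" .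
  qed
qed

lemma grad_nth:
  assumes "z \<in> U"
  shows "grad \<rho> z $ j = 2 * rdzbar j \<rho> z"
  using deriv_grad[OF assms, of "axis j 1"] deriv_grad[OF assms, of "axis j \<i>"]
  unfolding rdz_eq(2)[OF deriv_\<rho>[OF assms]] by (simp add: inner_axis inner_complex_def complex_eq_iff)

text \<open>The vector \<open>complex_normal \<rho> \<zeta>\<close> is half the gradient, and a
  displacement along the gradient lies entirely in the complex normal line, so its component there
  has full length.\<close>

lemma normal_dist_eq:
  assumes z: "bproj \<Omega> z = \<zeta>" "\<zeta> \<in> U" "z = \<zeta> - (\<delta> / norm (grad \<rho> \<zeta>)) *\<^sub>R grad \<rho> \<zeta>"
    and d: "0 < \<delta>" and g: "grad \<rho> \<zeta> \<noteq> 0"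
  shows "normal_dist \<rho> \<Omega> z = \<delta>"
proof -
  let ?g = "grad \<rho> \<zeta>"
  have \<nu>: "complex_normal \<rho> \<zeta> = (1/2) *\<^sub>R ?g"
    unfolding vec_eq_iff complex_normal_def vec_lambda_beta vector_scaleR_component grad_nth[OF z(2)]
    by (simp add: scaleR_conv_of_real)
  have z\<zeta>: "z - \<zeta> = (- 2 * \<delta> / norm ?g) *\<^sub>R ((1/2) *\<^sub>R ?g)" by (simp add: z(3))
  have "(\<Sum>j\<in>UNIV. (z - \<zeta>) $ j * cnj (((1/2) *\<^sub>R ?g) $ j)) = hpair ((1/2) *\<^sub>R ?g) (z - \<zeta>)"
    by (simp add: sum_2 hpair_def mult.commute)
  then have "(\<Sum>j\<in>UNIV. (z - \<zeta>) $ j * cnj (((1/2) *\<^sub>R ?g) $ j)) =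
      of_real (- 2 * \<delta> / norm ?g * (norm ((1/2) *\<^sub>R ?g))\<^sup>2)"
    unfolding z\<zeta> by (simp only: hpair_scaleR_right hpair_self of_real_mult)
  then have "cmod (\<Sum>j\<in>UNIV. (z - \<zeta>) $ j * cnj (((1/2) *\<^sub>R ?g) $ j)) = \<bar>- 2 * \<delta> / norm ?g * (norm ((1/2) *\<^sub>R ?g))\<^sup>2\<bar>"
    by (simp only: norm_of_real)
  also have "\<dots> = \<delta> * (norm ?g / 2)" using d g by (simp add: power2_eq_square abs_mult)
  finally show ?thesis using g unfolding normal_dist_def Let_def z(1) \<nu> by simp
qed

end

section \<open>Failure of the Fatou property\<close>

text \<open>The inequality of \<open>strong_convexity\<close> is closed in \<open>z\<close>, so it
  extends to the closure of the domain and thus to pairs of boundary points.\<close>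

lemma (in touching_domain) patch_is_convex_patch:
  assumes p: "p = vector [1, 0]"
  obtains r0 C where "0 < r0"
    "\<And>r. r < r0 \<Longrightarrow> convex_patch \<Omega> (frontier \<Omega> \<inter> cball p r) (grad \<rho>) C"
proof -
  obtain ra a where ra: "0 < ra" "0 < a"
    "\<And>\<zeta> z. \<zeta> \<in> frontier \<Omega> \<Longrightarrow> \<zeta> \<in> ball p ra \<Longrightarrow> z \<in> \<Omega> \<Longrightarrow> a * (norm (\<zeta> - z))\<^sup>2 \<le> grad \<rho> \<zeta> \<bullet> (\<zeta> - z)"
    using strong_convexity by blast
  obtain rb B where rb: "0 < rb" "1 \<le> B" "ball p rb \<subseteq> U"
    and lip: "\<And>x y. x \<in> ball p rb \<Longrightarrow> y \<in> ball p rb \<Longrightarrow> norm (grad \<rho> y - grad \<rho> x) \<le> B * norm (y - x)"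
    and gB: "\<And>x. x \<in> ball p rb \<Longrightarrow> norm (grad \<rho> x) \<le> B"
    and gc: "\<And>x. x \<in> ball p rb \<Longrightarrow> c / 2 \<le> p \<bullet> grad \<rho> x"
    using grad_bounds by metis
  define C where "C = max B (max (1 / a) (2 / c))"
  have C: "1 \<le> C" "B \<le> C" "1 / a \<le> C" "2 / c \<le> C" using rb by (auto simp: C_def)
  show ?thesis
  proof
    show "0 < min ra rb" using ra rb by simp
    fix r assume r: "r < min ra rb"
    let ?S = "frontier \<Omega> \<inter> cball p r"
    have Sa: "\<zeta> \<in> ball p ra" "\<zeta> \<in> ball p rb" if "\<zeta> \<in> ?S" for \<zeta> using that r by auto
    have conv: "a * (norm (\<zeta> - z))\<^sup>2 \<le> grad \<rho> \<zeta> \<bullet> (\<zeta> - z)" if \<zeta>: "\<zeta> \<in> ?S" and z: "z \<in> \<Omega> \<union> ?S" for \<zeta> z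
    proof -
      have "closed {z. a * (norm (\<zeta> - z))\<^sup>2 \<le> grad \<rho> \<zeta> \<bullet> (\<zeta> - z)}"
        by (intro closed_Collect_le continuous_intros)
      moreover have "\<Omega> \<subseteq> {z. a * (norm (\<zeta> - z))\<^sup>2 \<le> grad \<rho> \<zeta> \<bullet> (\<zeta> - z)}"
        using ra(3) \<zeta> Sa by blast
      ultimately have "closure \<Omega> \<subseteq> {z. a * (norm (\<zeta> - z))\<^sup>2 \<le> grad \<rho> \<zeta> \<bullet> (\<zeta> - z)}"
        by (intro closure_minimal)
      moreover have "z \<in> closure \<Omega>" using z closure_subset by (auto simp: frontier_def)
      ultimately show ?thesis by blast
    qed
    show "convex_patch \<Omega> ?S (grad \<rho>) C"
    proof
      show "1 \<le> C" by fact
      show "open \<Omega>" by (rule open_\<Omega>)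
      show "norm z \<le> 1" if "z \<in> \<Omega> \<union> ?S" for z using that norm_le_1 norm_frontier by blast
      show "compact ?S" by (intro closed_Int_compact) auto
      show "\<Omega> \<inter> ?S = {}" using frontier_disjoint by blast
      fix \<zeta> assume \<zeta>: "\<zeta> \<in> ?S"
      show "norm (grad \<rho> \<zeta>) \<le> C" using gB[OF Sa(2)[OF \<zeta>]] C by linarith
      show "1 \<le> C * cmod (grad \<rho> \<zeta> $ 1)"
      proof -
        have "p \<bullet> grad \<rho> \<zeta> = Re (grad \<rho> \<zeta> $ 1)" by (simp add: p inner_vec_def sum_2 inner_complex_def)
        then have "c / 2 \<le> cmod (grad \<rho> \<zeta> $ 1)"
          using gc[OF Sa(2)[OF \<zeta>]] complex_Re_le_cmod[of "grad \<rho> \<zeta> $ 1"] by linarith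
        then have "2 / c * (c / 2) \<le> C * cmod (grad \<rho> \<zeta> $ 1)" using C c by (intro mult_mono) auto
        then show ?thesis using c by simp
      qed
      show "norm (grad \<rho> \<zeta> - grad \<rho> \<zeta>') \<le> C * norm (\<zeta> - \<zeta>')" if \<zeta>': "\<zeta>' \<in> ?S" for \<zeta>'
      proof -
        have "norm (grad \<rho> \<zeta> - grad \<rho> \<zeta>') \<le> B * norm (\<zeta> - \<zeta>')" by (rule lip[OF Sa(2)[OF \<zeta>'] Sa(2)[OF \<zeta>]])
        also have "\<dots> \<le> C * norm (\<zeta> - \<zeta>')" using C by (intro mult_right_mono) auto
        finally show ?thesis .
      qed
      fix z assume z: "z \<in> \<Omega> \<union> ?S"
      have le: "a * (norm (\<zeta> - z))\<^sup>2 \<le> grad \<rho> \<zeta> \<bullet> (\<zeta> - z)" by (rule conv[OF \<zeta> z])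
      then have "(norm (\<zeta> - z))\<^sup>2 \<le> 1 / a * (grad \<rho> \<zeta> \<bullet> (\<zeta> - z))" using ra by (simp add: field_simps)
      also have "\<dots> \<le> C * (grad \<rho> \<zeta> \<bullet> (\<zeta> - z))"
      proof (rule mult_right_mono[OF C(3)])
        have "0 \<le> a * (norm (\<zeta> - z))\<^sup>2" using ra by simp
        then show "0 \<le> grad \<rho> \<zeta> \<bullet> (\<zeta> - z)" using le by linarith
      qed
      finally show "(norm (\<zeta> - z))\<^sup>2 \<le> C * Re (hpair (grad \<rho> \<zeta>) (\<zeta> - z))" by (simp add: Re_hpair)
    qed
  qed
qed

text \<open>A lower bound suffices, as the approach region grows with \<open>D_fun\<close>. Because
  \<open>\<delta> / B\<close> is at most 1, the exponent \<open>1 / 2\<close> gives the smallest of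
  the powers with exponent \<open>1 / k\<close>.\<close>

lemma D_fun_lower_bound:
  assumes z: "bproj \<Omega> z = \<zeta>" "norm (z - \<zeta>) = \<delta>" and \<tau>: "2 \<le> \<tau>"
    and L: "0 < Lam \<rho> M 2 \<zeta>" "\<And>k. k \<in> {2..\<tau>} \<Longrightarrow> Lam \<rho> M k \<zeta> \<le> B"
    and d: "0 < \<delta>" "\<delta> \<le> B"
  shows "sqrt (\<delta> / B) \<le> D_fun \<rho> \<Omega> M \<tau> z"
  unfolding D_fun_def bdist_def z
proof (rule cINF_greatest)
  show "{k \<in> {2..\<tau>}. Lam \<rho> M k \<zeta> \<noteq> 0} \<noteq> {}" using \<tau> L(1) by force
  fix k assume k: "k \<in> {k \<in> {2..\<tau>}. Lam \<rho> M k \<zeta> \<noteq> 0}"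
  have Lk: "0 < Lam \<rho> M k \<zeta>" "Lam \<rho> M k \<zeta> \<le> B" using k L(2) Lam_nonneg[of \<rho> M k \<zeta>] by auto
  have q: "0 < \<delta> / B" "\<delta> / B \<le> 1" using d by auto
  have "sqrt (\<delta> / B) = (\<delta> / B) powr (1 / 2)" using q by (simp add: powr_half_sqrt)
  also have "\<dots> \<le> (\<delta> / B) powr (1 / real k)"
    using k q by (intro powr_mono') (auto simp: field_simps)
  also have "\<dots> \<le> (\<delta> / Lam \<rho> M k \<zeta>) powr (1 / real k)"
    using Lk d by (intro powr_mono2 divide_left_mono) auto
  finally show "sqrt (\<delta> / B) \<le> (\<delta> / Lam \<rho> M k \<zeta>) powr (1 / real k)" .
qed

lemma Lam_sum_lower_bound:
  assumes "2 \<le> \<tau>" "0 \<le> \<theta>"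
  shows "\<theta>\<^sup>2 * Lam \<rho> M 2 w \<le> Lam_sum \<rho> M \<tau> \<theta> w"
  unfolding Lam_sum_def
  by (rule member_le_sum[of 2 "{2..\<tau>}" "\<lambda>k. \<theta> ^ k * Lam \<rho> M k w"])
    (use assms in \<open>auto intro!: mult_nonneg_nonneg Lam_nonneg\<close>)

context touching_domain
begin

text \<open>For each \<open>w\<close> in the patch, the spikes within
  \<open>k \<delta> * \<delta>\<close> of \<open>w\<close> lie in its approach region and tend to
  \<open>w\<close>, with values alternately close to 0 and 1. What remains is to find a function
  \<open>k\<close>, tending to infinity, that is small enough for both defining
  inequalities.\<close>

lemma failing_function_exists:
  assumes p: "p = vector [1, 0]" and ft: "finite_type \<rho> \<Omega>"
    and V: "admissible_nhd \<rho> U \<Omega> p V" and M: "\<forall>k. commutator_basis \<rho> V k (M k)"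
    and R: "polarization \<rho> U R" and h: "decreasing_aperture h1" "decreasing_aperture h2"
  obtains f r where "holomorphic_c2 f \<Omega>" "bounded (f ` \<Omega>)" "0 < r" "cball p r \<subseteq> V"
    "\<And>w l. w \<in> frontier \<Omega> \<Longrightarrow> w \<in> cball p r \<Longrightarrow>
       \<not> (f \<longlongrightarrow> l) (at w within approach_region \<rho> \<Omega> V M R h1 h2 w)"
proof -
  have V': "open V" "p \<in> V" "V \<subseteq> U" and nz: "\<And>z. z \<in> V \<Longrightarrow> rdz 1 \<rho> z \<noteq> 0 \<and> rdzbar 1 \<rho> z \<noteq> 0"
    using V by (auto simp: admissible_nhd_def)
  define \<tau> where "\<tau> = the_enat (domain_type \<rho> \<Omega>)"
  have \<tau>: "2 \<le> \<tau>"
  proof -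
    have ge: "2 \<le> domain_type \<rho> \<Omega>" using domain_type_ge_2 p_frontier nz V'(2) by blast
    obtain n where n: "domain_type \<rho> \<Omega> = enat n" using ft by (auto simp: finite_type_def)
    then show ?thesis using ge by (simp add: \<tau>_def numeral_eq_enat)
  qed
  obtain rp C where rp: "0 < rp" and patch: "\<And>r. r < rp \<Longrightarrow> convex_patch \<Omega> (frontier \<Omega> \<inter> cball p r) (grad \<rho>) C"
    using patch_is_convex_patch[OF p] by blast
  obtain rs \<delta>s where rs: "0 < rs" "0 < \<delta>s" "ball p rs \<subseteq> V"
    and sp: "\<And>\<zeta> \<delta> z. \<zeta> \<in> frontier \<Omega> \<Longrightarrow> \<zeta> \<in> ball p rs \<Longrightarrow> 0 < \<delta> \<Longrightarrow> \<delta> < \<delta>s \<Longrightarrow>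
       z = \<zeta> - (\<delta> / norm (grad \<rho> \<zeta>)) *\<^sub>R grad \<rho> \<zeta> \<Longrightarrow>
       z \<in> \<Omega> \<and> z \<in> V \<and> bproj \<Omega> z = \<zeta> \<and> norm (z - \<zeta>) = \<delta>"
    using spike_geometry[OF V'(1,2)] by metis
  obtain rR BR where rR: "0 < rR" "0 < BR"
    and R_le: "\<And>\<zeta> w. \<zeta> \<in> frontier \<Omega> \<Longrightarrow> w \<in> frontier \<Omega> \<Longrightarrow> \<zeta> \<in> ball p rR \<Longrightarrow> w \<in> ball p rR \<Longrightarrow>
      cmod (R \<zeta> w) \<le> BR * (cmod (hpair (grad \<rho> w) (\<zeta> - w)) + (norm (\<zeta> - w))\<^sup>2)"
    using polarization_bound[OF R] by metis
  obtain m where m: "0 < m" "\<forall>\<^sub>F z in nhds p. m \<le> Lam \<rho> M 2 z"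
    using Lam2_lower_bound[OF p V'(1,3,2) nz, of M] M by blast
  have "\<forall>k. \<exists>B. \<forall>\<^sub>F z in nhds p. Lam \<rho> M k z \<le> B"
  proof
    fix k
    have "\<exists>j. iterated_commutator \<rho> j X" if "X \<in> M k" for X
      using M that unfolding commutator_basis_def by blast
    then show "\<exists>B. \<forall>\<^sub>F z in nhds p. Lam \<rho> M k z \<le> B"
      by (intro Lam_locally_bounded[OF U(1) smooth_\<rho> V'(1,3,2) nz]) auto
  qed
  then obtain Bk where Bk: "\<And>k. \<forall>\<^sub>F z in nhds p. Lam \<rho> M k z \<le> Bk k" by metis
  define BL where "BL = (\<Sum>k\<in>{2..\<tau>}. \<bar>Bk k\<bar>) + 1"
  have BL: "0 < BL" unfolding BL_def by (intro add_nonneg_pos sum_nonneg) auto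
  have "\<forall>\<^sub>F z in nhds p. (\<forall>k\<in>{2..\<tau>}. Lam \<rho> M k z \<le> Bk k) \<and> m \<le> Lam \<rho> M 2 z"
    by (intro eventually_conj eventually_ball_finite ballI Bk m(2)) simp
  then obtain rl where rl: "0 < rl" and Lam_near: "\<And>z. dist z p < rl \<Longrightarrow> (\<forall>k\<in>{2..\<tau>}. Lam \<rho> M k z \<le> Bk k) \<and> m \<le> Lam \<rho> M 2 z"
    unfolding eventually_nhds_metric by blast
  define r where "r = min (min rp rs) (min rR rl) / 2"
  have "0 < min (min rp rs) (min rR rl)" using rp rs rR rl by simp
  then have r: "0 < r" "r < rp" "r < rs" "r < rR" "r < rl" unfolding r_def by linarith+
  define S where "S = frontier \<Omega> \<inter> cball p r"
  have S: "\<zeta> \<in> frontier \<Omega>" "\<zeta> \<in> ball p rs" "\<zeta> \<in> ball p rR" "dist \<zeta> p < rl" if "\<zeta> \<in> S" for \<zeta>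
    using that r by (auto simp: S_def dist_commute)
  have Lam2: "m \<le> Lam \<rho> M 2 \<zeta>" if "\<zeta> \<in> S" for \<zeta> using Lam_near[OF S(4)[OF that]] by blast
  have Lamk: "Lam \<rho> M k \<zeta> \<le> BL" if "\<zeta> \<in> S" "k \<in> {2..\<tau>}" for \<zeta> k
  proof -
    have "Lam \<rho> M k \<zeta> \<le> \<bar>Bk k\<bar>" using Lam_near[OF S(4)[OF that(1)]] that(2) by force
    also have "\<dots> \<le> (\<Sum>k\<in>{2..\<tau>}. \<bar>Bk k\<bar>)" by (rule member_le_sum[OF that(2)]) auto
    finally show ?thesis by (simp add: BL_def)
  qed
  interpret cp: convex_patch \<Omega> S "grad \<rho>" C unfolding S_def by (rule patch[OF r(2)])
  \<comment> \<open>\<open>A1\<close> keeps the horizontal displacement below half of what the first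
    inequality allows, leaving the other half for the height of the spike; \<open>A2\<close> uses up
    half of the second one, which makes it strict.\<close>
  define A1 where "A1 = 1 / (4 * BL * C)"
  define A2 where "A2 = m / (2 * BL * BR * (1 + C\<^sup>2 + C))"
  have C: "1 \<le> C" by (rule cp.C)
  have C2: "0 < 1 + C\<^sup>2 + C" using C by (simp add: add_nonneg_pos)
  have A: "0 < A1" "0 < A2" using BL C m rR C2 by (simp_all add: A1_def A2_def)
  \<comment> \<open>The cap \<open>1 / sqrt \<delta>\<close> gives
    \<open>k \<delta> * \<delta> \<le> sqrt \<delta>\<close>, so the spikes assigned to
    \<open>w\<close> converge to it however fast the apertures grow.\<close>
  define k where "k \<delta> = min (min (A1 * h1 \<delta>) (A2 * h2 \<delta>)) (1 / sqrt \<delta>)" for \<delta>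
  have h_top: "filterlim h1 at_top (at_right 0)" "filterlim h2 at_top (at_right 0)"
    and h_ge: "\<And>x. 0 < x \<Longrightarrow> x \<le> 1 \<Longrightarrow> 1 \<le> h1 x \<and> 1 \<le> h2 x"
    using h by (auto simp: decreasing_aperture_def)
  have k_top: "filterlim k at_top (at_right 0)"
    unfolding filterlim_at_top
  proof
    fix Z :: real
    have "\<forall>\<^sub>F \<delta> in at_right 0. \<delta> < 1 / (\<bar>Z\<bar> + 1)\<^sup>2"
      unfolding eventually_at_right_field by (intro exI[of _ "1 / (\<bar>Z\<bar> + 1)\<^sup>2"]) (auto simp: add_nonneg_pos zero_less_power)
    moreover have "\<forall>\<^sub>F \<delta> in at_right 0. Z / A1 \<le> h1 \<delta>" "\<forall>\<^sub>F \<delta> in at_right 0. Z / A2 \<le> h2 \<delta>"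
      using h_top unfolding filterlim_at_top by blast+
    moreover have "\<forall>\<^sub>F \<delta> in at_right (0::real). 0 < \<delta>" by (rule eventually_at_right_less)
    ultimately show "\<forall>\<^sub>F \<delta> in at_right 0. Z \<le> k \<delta>"
    proof eventually_elim
      case (elim \<delta>)
      have Zp: "0 < \<bar>Z\<bar> + 1" by (simp add: add_nonneg_pos)
      have "\<delta> * (\<bar>Z\<bar> + 1)\<^sup>2 \<le> 1" using elim(1) Zp by (simp add: pos_less_divide_eq)
      then have "sqrt (\<delta> * (\<bar>Z\<bar> + 1)\<^sup>2) \<le> sqrt 1" by (rule real_sqrt_le_mono)
      then have "sqrt \<delta> * (\<bar>Z\<bar> + 1) \<le> 1" using Zp by (simp add: real_sqrt_mult)
      then have "\<bar>Z\<bar> + 1 \<le> 1 / sqrt \<delta>" using elim(4) by (simp add: field_simps)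
      moreover have "Z \<le> A1 * h1 \<delta>" "Z \<le> A2 * h2 \<delta>" using elim A by (simp_all add: field_simps)
      ultimately show ?case by (simp add: k_def)
    qed
  qed
  have "\<forall>\<^sub>F \<delta> in at_right 0. 2 * sqrt BL + 1 \<le> h1 \<delta>" using h_top(1) unfolding filterlim_at_top by blast
  then obtain \<delta>h where \<delta>h: "0 < \<delta>h" "\<And>\<delta>. 0 < \<delta> \<Longrightarrow> \<delta> < \<delta>h \<Longrightarrow> 2 * sqrt BL + 1 \<le> h1 \<delta>"
    unfolding eventually_at_right_field by blast
  \<comment> \<open>\<open>\<delta>s\<close> is for the geometry of spikes, 1 for the domain of the
    apertures, \<open>BL\<close> for \<open>D_fun_lower_bound\<close>, and \<open>\<delta>h\<close>
    makes \<open>h1 \<delta>\<close> large enough to absorb the height.\<close>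
  define \<delta>0 where "\<delta>0 = min (min \<delta>s 1) (min BL \<delta>h)"
  have \<delta>0: "0 < \<delta>0" "\<delta>0 \<le> \<delta>s" "\<delta>0 \<le> 1" "\<delta>0 \<le> BL" "\<delta>0 \<le> \<delta>h"
    using rs BL \<delta>h by (auto simp: \<delta>0_def)
  have spk: "cp.spike \<delta> \<zeta> \<in> \<Omega> \<and> cp.spike \<delta> \<zeta> \<in> V \<and> bproj \<Omega> (cp.spike \<delta> \<zeta>) = \<zeta> \<and> norm (cp.spike \<delta> \<zeta> - \<zeta>) = \<delta>"
    if "0 < \<delta>" "\<delta> < \<delta>0" "\<zeta> \<in> S" for \<delta> \<zeta>
    using sp[OF S(1,2)[OF that(3)] that(1) _ cp.spike_def] that \<delta>0 by simp
  have dist_le: "norm (\<zeta> - w) \<le> sqrt (C * k \<delta>) * sqrt \<delta>"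
    if "\<zeta> \<in> S" "w \<in> S" "0 < \<delta>" "cmod (cp.P \<zeta> w) \<le> k \<delta> * \<delta>" for \<zeta> w \<delta>
    using cp.norm_diff_sq_le[OF that(1) _ that(4)] that(2) by (simp add: real_sqrt_mult mult.assoc)
  have k_pos: "0 < k \<delta>" if "0 < \<delta>" "\<delta> < \<delta>0" for \<delta>
    using h_ge[of \<delta>] that A \<delta>0 by (auto simp: k_def intro!: mult_pos_pos)
  have region: "cp.spike \<delta> \<zeta> \<in> approach_region \<rho> \<Omega> V M R h1 h2 w"
    if d: "0 < \<delta>" "\<delta> < \<delta>0" and \<zeta>: "\<zeta> \<in> S" and w: "w \<in> S" and P: "cmod (cp.P \<zeta> w) \<le> k \<delta> * \<delta>" for \<delta> \<zeta> w
  proof -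
    let ?z = "cp.spike \<delta> \<zeta>"
    have z: "?z \<in> \<Omega>" "?z \<in> V" "bproj \<Omega> ?z = \<zeta>" "norm (?z - \<zeta>) = \<delta>" using spk[OF d \<zeta>] by auto
    have nd: "normal_dist \<rho> \<Omega> ?z = \<delta>"
    proof (rule normal_dist_eq[OF z(3) _ cp.spike_def d(1)])
      show "\<zeta> \<in> U" using S(1)[OF \<zeta>] U by auto
      show "grad \<rho> \<zeta> \<noteq> 0" using cp.norm_g_pos[OF \<zeta>] by auto
    qed
    have h1d: "2 * sqrt BL + 1 \<le> h1 \<delta>" using \<delta>h(2) d \<delta>0 by auto
    have hd: "1 \<le> h1 \<delta>" "1 \<le> h2 \<delta>" using h_ge d \<delta>0 by auto
    have D: "sqrt (\<delta> / BL) \<le> D_fun \<rho> \<Omega> M \<tau> ?z"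
      using z(3,4) \<tau> Lam2[OF \<zeta>] m(1) Lamk[OF \<zeta>] d \<delta>0 by (intro D_fun_lower_bound[where \<zeta> = \<zeta>]) auto
    have D0: "0 \<le> D_fun \<rho> \<Omega> M \<tau> ?z"
    proof -
      have "0 \<le> sqrt (\<delta> / BL)" using d BL by simp
      then show ?thesis using D by linarith
    qed
    have "norm (?z - w) < h1 \<delta> * D_fun \<rho> \<Omega> M \<tau> ?z"
    proof -
      have "norm (?z - w) \<le> norm (?z - \<zeta>) + norm (\<zeta> - w)" using norm_triangle_ineq[of "?z - \<zeta>" "\<zeta> - w"] by simp
      also have "\<dots> \<le> \<delta> + sqrt (C * k \<delta>) * sqrt \<delta>" using z(4) dist_le[OF \<zeta> w d(1) P] by simp
      also have "\<dots> \<le> (1 + sqrt (C * k \<delta>)) * sqrt \<delta>"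
      proof -
        have "sqrt \<delta> * sqrt \<delta> \<le> 1 * sqrt \<delta>" using d \<delta>0 by (intro mult_right_mono) auto
        then show ?thesis using d by (simp add: algebra_simps)
      qed
      also have "\<dots> < (h1 \<delta> / sqrt BL) * sqrt \<delta>"
      proof (rule mult_strict_right_mono)
        have "k \<delta> \<le> A1 * h1 \<delta>" by (simp add: k_def)
        \<comment> \<open>Since \<open>h1 \<delta>\<close> is at least 1, it may be replaced by its
          square, which compensates the square root in the passage from Koranyi to Euclidean
          distance.\<close>
        also have "\<dots> \<le> A1 * (h1 \<delta>)\<^sup>2" using hd A by (intro mult_left_mono) (auto simp: power2_eq_square)
        finally have "C * k \<delta> \<le> C * (A1 * (h1 \<delta>)\<^sup>2)" using C by (intro mult_left_mono) auto
        also have "\<dots> = (h1 \<delta> / (2 * sqrt BL))\<^sup>2"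
          using C BL by (simp add: A1_def power_divide power_mult_distrib)
        finally have "sqrt (C * k \<delta>) \<le> h1 \<delta> / (2 * sqrt BL)"
          using hd BL by (intro real_le_lsqrt) auto
        moreover have "1 < h1 \<delta> / (2 * sqrt BL)" using h1d BL by (simp add: pos_less_divide_eq)
        moreover have "h1 \<delta> / sqrt BL = h1 \<delta> / (2 * sqrt BL) + h1 \<delta> / (2 * sqrt BL)" by simp
        ultimately show "1 + sqrt (C * k \<delta>) < h1 \<delta> / sqrt BL" by linarith
      qed (use d in simp)
      also have "\<dots> = h1 \<delta> * sqrt (\<delta> / BL)" by (simp add: real_sqrt_divide)
      also have "\<dots> \<le> h1 \<delta> * D_fun \<rho> \<Omega> M \<tau> ?z" using D hd by (intro mult_left_mono) auto
      finally show ?thesis .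
    qed
    moreover have "cmod (R \<zeta> w) < h2 \<delta> * Lam_sum \<rho> M \<tau> (D_fun \<rho> \<Omega> M \<tau> ?z) w"
    proof -
      have kd: "0 < k \<delta> * \<delta>" using k_pos[OF d] d by simp
      \<comment> \<open>The polarization is expanded at \<open>w\<close> while the covering is based
        at \<open>\<zeta>\<close>; \<open>P_sym\<close> exchanges the two.\<close>
      have "cmod (hpair (grad \<rho> w) (\<zeta> - w)) = cmod (cp.P w \<zeta>)"
        by (simp add: cp.P_def hpair_diff_right norm_minus_commute)
      also have "\<dots> \<le> (1 + C\<^sup>2) * cmod (cp.P \<zeta> w)" by (rule cp.P_sym[OF w \<zeta>])
      also have "\<dots> \<le> (1 + C\<^sup>2) * (k \<delta> * \<delta>)" using P by (intro mult_left_mono) auto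
      finally have e1: "cmod (hpair (grad \<rho> w) (\<zeta> - w)) \<le> (1 + C\<^sup>2) * (k \<delta> * \<delta>)" .
      have "norm (\<zeta> - w) \<le> sqrt (C * (k \<delta> * \<delta>))" using cp.norm_diff_sq_le[OF \<zeta> _ P] w by simp
      then have "(norm (\<zeta> - w))\<^sup>2 \<le> (sqrt (C * (k \<delta> * \<delta>)))\<^sup>2" by (intro power_mono) auto
      then have e2: "(norm (\<zeta> - w))\<^sup>2 \<le> C * (k \<delta> * \<delta>)" using kd C by simp
      have "cmod (R \<zeta> w) \<le> BR * (cmod (hpair (grad \<rho> w) (\<zeta> - w)) + (norm (\<zeta> - w))\<^sup>2)"
        by (rule R_le[OF S(1)[OF \<zeta>] S(1)[OF w] S(3)[OF \<zeta>] S(3)[OF w]])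
      also have "\<dots> \<le> BR * ((1 + C\<^sup>2) * (k \<delta> * \<delta>) + C * (k \<delta> * \<delta>))"
        using e1 e2 rR by (intro mult_left_mono add_mono) auto
      also have "\<dots> = (BR * (1 + C\<^sup>2 + C)) * (k \<delta> * \<delta>)" by (simp add: algebra_simps)
      also have "\<dots> \<le> (BR * (1 + C\<^sup>2 + C)) * (A2 * h2 \<delta> * \<delta>)"
        using rR C2 d by (intro mult_left_mono mult_right_mono) (auto simp: k_def)
      also have "\<dots> = (m / (2 * BL)) * (h2 \<delta> * \<delta>)" using rR C2 by (simp add: A2_def)
      also have "\<dots> < (m / BL) * (h2 \<delta> * \<delta>)"
        using m BL hd d by (intro mult_strict_right_mono divide_strict_left_mono) auto
      also have "\<dots> = h2 \<delta> * ((sqrt (\<delta> / BL))\<^sup>2 * m)" using d BL by simp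
      also have "\<dots> \<le> h2 \<delta> * ((D_fun \<rho> \<Omega> M \<tau> ?z)\<^sup>2 * Lam \<rho> M 2 w)"
        using D Lam2[OF w] m hd d BL by (intro mult_left_mono mult_mono power_mono) auto
      also have "\<dots> \<le> h2 \<delta> * Lam_sum \<rho> M \<tau> (D_fun \<rho> \<Omega> M \<tau> ?z) w"
        using hd by (intro mult_left_mono Lam_sum_lower_bound[OF \<tau> D0]) auto
      finally show ?thesis .
    qed
    ultimately show ?thesis
      unfolding approach_region_def Let_def \<tau>_def[symmetric] using z nd by simp
  qed
  obtain f where f: "holomorphic_c2 f \<Omega>" "bounded (f ` \<Omega>)"
    and osc: "\<And>w n. w \<in> S \<Longrightarrow> \<exists>\<delta> \<zeta>. 0 < \<delta> \<and> \<delta> < (1/2) ^ n \<and> \<delta> < \<delta>0 \<and> \<zeta> \<in> S \<and> cmod (cp.P \<zeta> w) \<le> k \<delta> * \<delta> \<and>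
       cmod (f (cp.spike \<delta> \<zeta>) - of_bool (odd n)) \<le> 2 * (1/2) ^ n"
    using cp.oscillating_function_exists[OF k_top \<delta>0(1)] spk by metis
  have fails: "\<not> (f \<longlongrightarrow> l) (at w within approach_region \<rho> \<Omega> V M R h1 h2 w)" if w: "w \<in> S" for w l
  proof
    assume lim: "(f \<longlongrightarrow> l) (at w within approach_region \<rho> \<Omega> V M R h1 h2 w)"
    have "\<exists>\<delta> \<zeta>. \<forall>n. 0 < \<delta> n \<and> \<delta> n < (1/2) ^ n \<and> \<delta> n < \<delta>0 \<and> \<zeta> n \<in> S \<and> cmod (cp.P (\<zeta> n) w) \<le> k (\<delta> n) * \<delta> n \<and>
       cmod (f (cp.spike (\<delta> n) (\<zeta> n)) - of_bool (odd n)) \<le> 2 * (1/2) ^ n"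
      using osc[OF w] by metis
    then obtain \<delta> \<zeta> where dz: "\<And>n. 0 < \<delta> n" "\<And>n. \<delta> n < (1/2) ^ n" "\<And>n. \<delta> n < \<delta>0" "\<And>n. \<zeta> n \<in> S"
      "\<And>n. cmod (cp.P (\<zeta> n) w) \<le> k (\<delta> n) * \<delta> n"
      "\<And>n. cmod (f (cp.spike (\<delta> n) (\<zeta> n)) - of_bool (odd n)) \<le> 2 * (1/2) ^ n" by blast
    define x where "x n = cp.spike (\<delta> n) (\<zeta> n)" for n
    have pow0: "(\<lambda>n. (1/2 :: real) ^ n) \<longlonglongrightarrow> 0" by (rule LIMSEQ_power_zero) simp
    have d0: "\<delta> \<longlonglongrightarrow> 0"
      by (rule tendsto_sandwich[OF _ _ tendsto_const pow0]) (auto intro!: always_eventually less_imp_le dz)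
    have x_mem: "x n \<in> approach_region \<rho> \<Omega> V M R h1 h2 w - {w}" for n
    proof -
      have "x n \<in> \<Omega>" using spk[OF dz(1,3,4)] by (simp add: x_def)
      moreover have "w \<notin> \<Omega>" by (rule frontier_disjoint[OF S(1)[OF w]])
      ultimately show ?thesis using region[OF dz(1,3,4) w dz(5)] by (auto simp: x_def)
    qed
    have x_lim: "x \<longlonglongrightarrow> w"
    proof (rule Lim_null[THEN iffD2], rule Lim_null_comparison)
      show "\<forall>\<^sub>F n in sequentially. norm (x n - w) \<le> \<delta> n + sqrt (C * sqrt (\<delta> n))"
      proof (intro always_eventually allI)
        fix n
        have "k (\<delta> n) * \<delta> n \<le> (1 / sqrt (\<delta> n)) * \<delta> n"
          using dz(1)[of n] by (intro mult_right_mono) (auto simp: k_def)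
        also have "\<dots> = sqrt (\<delta> n)" using dz(1)[of n] by (simp add: real_div_sqrt)
        finally have "cmod (cp.P (\<zeta> n) w) \<le> sqrt (\<delta> n)" using dz(5)[of n] by linarith
        then have "norm (\<zeta> n - w) \<le> sqrt (C * sqrt (\<delta> n))" using cp.norm_diff_sq_le[OF dz(4)] w by simp
        moreover have "norm (x n - w) \<le> norm (x n - \<zeta> n) + norm (\<zeta> n - w)"
          using norm_triangle_ineq[of "x n - \<zeta> n" "\<zeta> n - w"] by simp
        moreover have "norm (x n - \<zeta> n) = \<delta> n" using spk[OF dz(1,3,4)] by (simp add: x_def)
        ultimately show "norm (x n - w) \<le> \<delta> n + sqrt (C * sqrt (\<delta> n))" by linarith
      qed
      have "(\<lambda>n. \<delta> n + sqrt (C * sqrt (\<delta> n))) \<longlonglongrightarrow> 0 + sqrt (C * sqrt 0)"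
        by (intro tendsto_intros d0)
      then show "(\<lambda>n. \<delta> n + sqrt (C * sqrt (\<delta> n))) \<longlonglongrightarrow> 0" by simp
    qed
    have fx: "(\<lambda>n. f (x n)) \<longlonglongrightarrow> l"
      using lim x_mem x_lim unfolding tendsto_at_iff_sequentially comp_def by blast
    have "(\<lambda>n. f (x n) - of_bool (odd n)) \<longlonglongrightarrow> 0"
    proof (rule Lim_null_comparison)
      show "\<forall>\<^sub>F n in sequentially. norm (f (x n) - of_bool (odd n)) \<le> 2 * (1/2) ^ n"
        using dz(6) by (simp add: x_def)
      show "(\<lambda>n. 2 * (1/2 :: real) ^ n) \<longlonglongrightarrow> 0" using tendsto_mult[OF tendsto_const[of 2] pow0] by simp
    qed
    from tendsto_diff[OF fx this] have ob: "(\<lambda>n. of_bool (odd n) :: complex) \<longlonglongrightarrow> l" by simp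
    have sub: "strict_mono (\<lambda>n::nat. 2 * n)" "strict_mono (\<lambda>n::nat. 2 * n + 1)" by (auto intro!: strict_monoI)
    have "(\<lambda>n::nat. 0 :: complex) \<longlonglongrightarrow> l"
      using LIMSEQ_subseq_LIMSEQ[OF ob sub(1)] by (simp add: comp_def)
    moreover have "(\<lambda>n::nat. 1 :: complex) \<longlonglongrightarrow> l"
      using LIMSEQ_subseq_LIMSEQ[OF ob sub(2)] by (simp add: comp_def)
    ultimately show False by (metis LIMSEQ_const_iff zero_neq_one)
  qed
  show ?thesis
  proof (rule that[OF f r(1)])
    show "cball p r \<subseteq> V" using r(3) rs(3) by auto
  qed (use fails in \<open>auto simp: S_def\<close>)
qed

end

theorem corollary3p6:
  fixes \<Omega> U V :: "c2 set" and \<rho> :: "c2 \<Rightarrow> real"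
    and M :: "nat \<Rightarrow> cvf set" and R :: "c2 \<Rightarrow> c2 \<Rightarrow> complex"
    and h1 h2 :: "real \<Rightarrow> real"
  assumes "open \<Omega>" and "connected \<Omega>"
    and "defining_function \<rho> U \<Omega>"
    and "finite_type \<rho> \<Omega>"
    and "\<forall>z\<in>\<Omega>. norm z \<le> 1"
    and "vector [1, 0] \<in> frontier \<Omega>"
    and "rdz 1 \<rho> (vector [1, 0]) \<noteq> 0" and "rdzbar 1 \<rho> (vector [1, 0]) \<noteq> 0"
    and "outward_normal \<rho> (vector [1, 0]) (vector [1, 0])"
    and "admissible_nhd \<rho> U \<Omega> (vector [1, 0]) V"
    and "\<forall>k. commutator_basis \<rho> V k (M k)"
    and "polarization \<rho> U R"
    and "decreasing_aperture h1" and "decreasing_aperture h2"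
  shows "\<not> (\<forall>f. holomorphic_c2 f \<Omega> \<and> bounded (f ` \<Omega>) \<longrightarrow>
            surface_measure \<Omega>
              {\<zeta> \<in> frontier \<Omega> \<inter> V.
                 \<not> (\<exists>l. (f \<longlongrightarrow> l) (at \<zeta> within approach_region \<rho> \<Omega> V M R h1 h2 \<zeta>))} = 0)"
proof -
  define p :: c2 where "p = vector [1, 0]"
  obtain c where c: "0 < c" "frechet_derivative \<rho> (at p) = (\<lambda>v. c * (p \<bullet> v))"
    using assms(9) unfolding outward_normal_def p_def by blast
  have "(norm p)\<^sup>2 = 1\<^sup>2" unfolding norm_c2 by (simp add: p_def)
  then have "norm p = 1" by (rule power2_eq_imp_eq) simp_all
  then interpret touching_domain \<Omega> U \<rho> p c
    using assms c by unfold_locales (simp_all add: p_def)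
  obtain f r where f: "holomorphic_c2 f \<Omega>" "bounded (f ` \<Omega>)" and r: "0 < r" "cball p r \<subseteq> V"
    and fails: "\<And>w l. w \<in> frontier \<Omega> \<Longrightarrow> w \<in> cball p r \<Longrightarrow>
       \<not> (f \<longlongrightarrow> l) (at w within approach_region \<rho> \<Omega> V M R h1 h2 w)"
    using failing_function_exists[OF p_def assms(4) assms(10)[folded p_def] assms(11-14)] by blast
  let ?N = "{\<zeta> \<in> frontier \<Omega> \<inter> V. \<not> (\<exists>l. (f \<longlongrightarrow> l) (at \<zeta> within approach_region \<rho> \<Omega> V M R h1 h2 \<zeta>))}"
  have "0 < hausdorff_measure 3 (frontier \<Omega> \<inter> cball p r)"
    by (rule surface_patch_positive[OF p_def r(1)])
  also have "\<dots> \<le> surface_measure \<Omega> ?N"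
    unfolding surface_measure_def by (rule hausdorff_measure_mono) (use r fails in blast)
  finally show ?thesis using f by (metis (no_types, lifting) less_irrefl)
qed

end
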